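(* Let $V\in C^1(\mathbb{R},[0,\infty))$ and let $(\mu_{n,t})_{n\in\mathbb{N}}$ be the time-evolved measures obtained at time $t$ from the sequence of finite-volume mean-field Gibbs measures with potential $V$ under independent Brownian motions. For $t\in(0,\infty)$ and $\alpha\in\mathbb{R}$ put $C_{t,\alpha}=\inf_{s\in\mathbb{R}}\big[V(s)+\frac{s^2}{2}+\frac{(s-\alpha)^2}{2t}\big]$ and consider the functions $$I^{t,\alpha}\colon\mathbb{R}\to[0,\infty),\qquad I^{t,\alpha}(r)=V(r)+\frac{r^2}{2}+\frac{(r-\alpha)^2}{2t}-C_{t,\alpha},$$ and $J^{t,\alpha}\colon C([0,t),\mathbb{R})\to[0,\infty]$, $$J^{t,\alpha}(\phi)=\begin{cases}V(\phi(0))+\frac12\phi(0)^2+\frac12\int_0^t\dot\phi(s)^2\,ds-C_{t,\alpha}, & \text{if }\phi\in\mathcal{AC}([0,t),\mathbb{R})\text{ and }\lim_{s\uparrow t}\phi(s)=\alpha,\\ \infty, &\text{otherwise.}\end{cases}$$ Then for every $t\in(0,\infty)$: (a) For $\alpha\in\mathbb{R}$ the following are equivalent: (a1) $\alpha$ is a good magnetisation for $(\mu_{n,t})_{n\in\mathbb{N}}$; (a2) $I^{t,\alpha}$ has a unique global minimiser; (a3) $J^{t,\alpha}$ has a unique global minimiser. (b) The following are equivalent: (b1) $(\mu_{n,t})_{n\in\mathbb{N}}$ is sequentially Gibbs; (b2) $I^{t,\alpha}$ has a unique global minimiser for all $\alpha\in\mathbb{R}$; (b3) $J^{t,\alpha}$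 has a unique global minimiser for all $\alpha\in\mathbb{R}$.
   Context: $\mathcal{AC}([0,t),\mathbb{R})$ is the set of absolutely continuous functions on $[0,t]$ restricted to $[0,t)$. $\mathcal{B}(\cdot)$ denotes the Borel $\sigma$-algebra. $\mu_{\mathcal{N}(v,A)}$ is the normal distribution with mean $v$ and (co)variance $A$; $I_n$ is the $n\times n$ identity matrix. The empirical magnetisation is $m_n(x_1,\dots,x_n)=\frac1n\sum_{i=1}^n x_i$. Time-evolved measures: for a potential $V\colon\mathbb{R}\to[0,\infty)$ and $t>0$, $$\mu_{n,t}(A)=\frac1{Z_n}\int_{\mathbb{R}^n}\mu_{\mathcal{N}(z,tI_n)}(A)\,e^{-nV(m_n(z))}\,d\mu_{\mathcal{N}(0,I_n)}(z)\qquad(A\in\mathcal{B}(\mathbb{R}^n)),$$ with $Z_n$ the normalising constant. For a probability measure $\rho_n$ on $\mathcal{B}(\mathbb{R}^n)$, $n\ge2$, let $\pi_{(2:n)}(y_1,\dots,y_n)=(y_2,\dots,y_n)$. A regular conditional probability under $\rho_n$ of the first spin given the other spins is a transition kernel $\gamma_n\colon\mathbb{R}^{n-1}\times\mathcal{B}(\mathbb{R})\to[0,1]$ with $\rho_n(A\times B)=\int \mathbf{1}_B(y)\,\gamma_n(y,A)\,d[\rho_n\circ\pi_{(2:n)}^{-1}](y)$ for all $A\in\mathcal{B}(\mathbb{R})$, $B\in\mathcal{B}(\mathbb{R}^{n-1})$. It is proper if $\gamma_n(y,\cdot)=0$ for all $y$ outside the support of $\rho_n\circ\pi_{(2:n)}^{-1}$,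 and weakly continuous if $y\mapsto\gamma_n(y,\cdot)$ is continuous for the weak topology; a weakly continuous proper one is unique if it exists (and it exists for $\rho_n=\mu_{n,t}$). Let $(\rho_n)_{n\in\mathbb{N}}$ be probability measures on $\mathcal{B}(\mathbb{R}^n)$ such that for every $n\ge 2$ a weakly continuous proper regular conditional probability $\gamma_n$ of the first spin given the other spins exists. Then $\alpha\in\mathbb{R}$ is a good magnetisation for $(\rho_n)$ if there is a probability measure $\gamma_\alpha$ on $\mathcal{B}(\mathbb{R})$ such that $\gamma_n(v_{n-1},\cdot)\to\gamma_\alpha$ weakly for all sequences $(v_{n-1})_{n\ge2}$ with $v_{n-1}\in\mathbb{R}^{n-1}$ and $m_{n-1}(v_{n-1})\to\alpha$. The sequence $(\rho_n)$ is sequentially Gibbs if all $\alpha\in\mathbb{R}$ are good magnetisations. *)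

theory Defs
  imports "HOL-Probability.Probability"
begin

section \<open>Euclidean space of varying dimension\<close>

text \<open>
  Vectors in n-dimensional space are the extensional functions on \<open>{..<n}\<close>, so coordinates are
  numbered from 0 and the first spin of a configuration \<open>x\<close> is \<open>x 0\<close>. The product sigma-algebra
  of \<open>borel_space n\<close> is the Borel sigma-algebra of the topology \<open>euclid n\<close>; both
  have the carrier \<open>PiE {..<n} (\<lambda>_. UNIV)\<close>.
\<close>

abbreviation euclid :: "nat \<Rightarrow> (nat \<Rightarrow> real) topology" where
  "euclid n \<equiv> product_topology (\<lambda>_. euclideanreal) {..<n}"

abbreviation borel_space :: "nat \<Rightarrow> (nat \<Rightarrow> real) measure" where
  "borel_space n \<equiv> PiM {..<n} (\<lambda>_. borel)"

definition magnetisation :: "nat \<Rightarrow> (nat \<Rightarrow> real) \<Rightarrow> real" where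
  "magnetisation n x = (1 / real n) * (\<Sum>i<n. x i)"

definition other_spins :: "nat \<Rightarrow> (nat \<Rightarrow> real) \<Rightarrow> (nat \<Rightarrow> real)" where
  "other_spins n x = (\<lambda>i\<in>{..<n - 1}. x (Suc i))"


section \<open>The time-evolved measures\<close>

text \<open>
  The normal distribution on n-dimensional space with mean \<open>v\<close> and covariance matrix \<open>c\<close> times the
  identity, for \<open>c > 0\<close>. The second parameter of \<open>normal_density\<close> is the standard deviation,
  and the product below is \<open>(2 * pi * c) powr (- n / 2) * exp (- (norm (x - v))^2 / (2 * c))\<close>.
\<close>

definition normal_dist :: "nat \<Rightarrow> (nat \<Rightarrow> real) \<Rightarrow> real \<Rightarrow> (nat \<Rightarrow> real) measure" where
  "normal_dist n v c =
     density (PiM {..<n} (\<lambda>_. lborel)) (\<lambda>x. ennreal (\<Prod>i<n. normal_density (v i) (sqrt c) (x i)))"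

definition normalising_const :: "(real \<Rightarrow> real) \<Rightarrow> nat \<Rightarrow> ennreal" where
  "normalising_const V n =
     (\<integral>\<^sup>+z. ennreal (exp (- real n * V (magnetisation n z))) \<partial>normal_dist n (\<lambda>_. 0) 1)"

definition time_evolved :: "(real \<Rightarrow> real) \<Rightarrow> real \<Rightarrow> nat \<Rightarrow> (nat \<Rightarrow> real) measure" where
  "time_evolved V t n =
     measure_of (space (borel_space n)) (sets (borel_space n))
       (\<lambda>A. (\<integral>\<^sup>+z. emeasure (normal_dist n z t) A * ennreal (exp (- real n * V (magnetisation n z)))
               \<partial>normal_dist n (\<lambda>_. 0) 1) / normalising_const V n)"

text \<open>
  \<open>measure_of\<close> yields the zero measure unless its set function is countably additive; the lemma
  \<open>emeasure_time_evolved\<close> shows that this is the case here.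
\<close>

lemma sets_normal_dist [simp, measurable_cong]: "sets (normal_dist n v c) = sets (borel_space n)"
  unfolding normal_dist_def sets_density by (intro sets_PiM_cong) auto

lemma measurable_emeasure_normal_dist:
  assumes "A \<in> sets (borel_space n)"
  shows "(\<lambda>z. emeasure (normal_dist n z t) A) \<in> borel_measurable (borel_space n)"
proof -
  interpret product_sigma_finite "\<lambda>_::nat. lborel :: real measure"
    by standard
  interpret L: sigma_finite_measure "PiM {..<n} (\<lambda>_. lborel :: real measure)"
    by (rule sigma_finite) simp
  have [measurable_cong]: "sets (PiM {..<n} (\<lambda>_. lborel :: real measure)) = sets (borel_space n)"
    by (intro sets_PiM_cong) auto
  have A[measurable]: "A \<in> sets (PiM {..<n} (\<lambda>_. lborel :: real measure))"
    using assms by (simp cong: sets_PiM_cong)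
  show ?thesis
    unfolding normal_dist_def normal_density_def
    by (subst emeasure_density) measurable
qed

lemma emeasure_time_evolved:
  assumes [measurable]: "V \<in> borel_measurable borel" and A: "A \<in> sets (borel_space n)"
  shows "emeasure (time_evolved V t n) A =
     (\<integral>\<^sup>+z. emeasure (normal_dist n z t) A * ennreal (exp (- real n * V (magnetisation n z)))
        \<partial>normal_dist n (\<lambda>_. 0) 1) / normalising_const V n"
proof (rule emeasure_measure_of[OF time_evolved_def])
  have mg[measurable]: "magnetisation n \<in> borel_measurable (borel_space n)"
    unfolding magnetisation_def[abs_def] by measurable
  show "sets (borel_space n) \<subseteq> Pow (space (borel_space n))"
    by (rule sets.space_closed)
  show "A \<in> sets (time_evolved V t n)"
    using A unfolding time_evolved_def by simp
  let ?f = "\<lambda>A. (\<integral>\<^sup>+z. emeasure (normal_dist n z t) A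
               * ennreal (exp (- real n * V (magnetisation n z)))
               \<partial>normal_dist n (\<lambda>_. 0) 1) / normalising_const V n"
  show "positive (sets (time_evolved V t n)) ?f"
    by (simp add: positive_def)
  show "countably_additive (sets (time_evolved V t n)) ?f"
  proof (rule countably_additiveI)
    fix B :: "nat \<Rightarrow> (nat \<Rightarrow> real) set"
    assume B: "range B \<subseteq> sets (time_evolved V t n)" "disjoint_family B"
    then have rB: "range B \<subseteq> sets (borel_space n)"
      unfolding time_evolved_def by simp
    then have [measurable]: "(\<lambda>z. emeasure (normal_dist n z t) (B i)) \<in> borel_measurable (borel_space n)" for i
      by (intro measurable_emeasure_normal_dist) auto
    have "emeasure (normal_dist n z t) (\<Union>i. B i) = (\<Sum>i. emeasure (normal_dist n z t) (B i))" for z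
      using suminf_emeasure[of B "normal_dist n z t"] rB B(2) by simp
    then show "(\<Sum>i. ?f (B i)) = ?f (\<Union>i. B i)"
      by (simp add: ennreal_suminf_divide flip: nn_integral_suminf ennreal_suminf_multc)
  qed
qed


section \<open>Good magnetisations and sequentially Gibbs sequences\<close>

text \<open>
  Weak continuity and weak convergence are stated with bounded continuous test functions, because
  kernels may take values of total mass less than one.
\<close>

definition weakly_continuous_kernel ::
  "'a topology \<Rightarrow> ('a \<Rightarrow> real measure) \<Rightarrow> bool" where
  "weakly_continuous_kernel X \<gamma> \<longleftrightarrow>
     (\<forall>f :: real \<Rightarrow> real. continuous_on UNIV f \<longrightarrow> bounded (range f) \<longrightarrow>
        continuous_map X euclideanreal (\<lambda>y. \<integral>x. f x \<partial>\<gamma> y))"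

definition converges_weakly :: "(nat \<Rightarrow> real measure) \<Rightarrow> real measure \<Rightarrow> bool" where
  "converges_weakly M N \<longleftrightarrow>
     (\<forall>f :: real \<Rightarrow> real. continuous_on UNIV f \<longrightarrow> bounded (range f) \<longrightarrow>
        (\<lambda>n. \<integral>x. f x \<partial>M n) \<longlonglongrightarrow> (\<integral>x. f x \<partial>N))"

definition measure_support :: "'a topology \<Rightarrow> 'a measure \<Rightarrow> 'a set" where
  "measure_support X M =
     {y \<in> topspace X. \<forall>U. openin X U \<longrightarrow> y \<in> U \<longrightarrow> emeasure M U > 0}"

definition others_law :: "nat \<Rightarrow> (nat \<Rightarrow> real) measure \<Rightarrow> (nat \<Rightarrow> real) measure" where
  "others_law n \<rho> = distr \<rho> (borel_space (n - 1)) (other_spins n)"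

definition regular_cond_prob ::
  "nat \<Rightarrow> (nat \<Rightarrow> real) measure \<Rightarrow> ((nat \<Rightarrow> real) \<Rightarrow> real measure) \<Rightarrow> bool" where
  "regular_cond_prob n \<rho> \<gamma> \<longleftrightarrow>
     \<gamma> \<in> measurable (borel_space (n - 1)) (subprob_algebra borel) \<and>
     (\<forall>A\<in>sets borel. \<forall>B\<in>sets (borel_space (n - 1)).
        emeasure \<rho> {x \<in> space (borel_space n). x 0 \<in> A \<and> other_spins n x \<in> B} =
        (\<integral>\<^sup>+y. indicator B y * emeasure (\<gamma> y) A \<partial>others_law n \<rho>))"

definition proper_kernel ::
  "nat \<Rightarrow> (nat \<Rightarrow> real) measure \<Rightarrow> ((nat \<Rightarrow> real) \<Rightarrow> real measure) \<Rightarrow> bool" where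
  "proper_kernel n \<rho> \<gamma> \<longleftrightarrow>
     (\<forall>y \<in> space (borel_space (n - 1)) - measure_support (euclid (n - 1)) (others_law n \<rho>).
        \<gamma> y = null_measure borel)"

text \<open>
  A weakly continuous proper regular conditional probability is unique on the carrier, so it does not
  matter whether the family \<open>\<gamma>\<close> below is quantified existentially or universally, once it exists.
\<close>

definition good_magnetisation :: "(nat \<Rightarrow> (nat \<Rightarrow> real) measure) \<Rightarrow> real \<Rightarrow> bool" where
  "good_magnetisation \<rho> \<alpha> \<longleftrightarrow>
     (\<exists>\<gamma>. (\<forall>n\<ge>2. regular_cond_prob n (\<rho> n) (\<gamma> n) \<and> proper_kernel n (\<rho> n) (\<gamma> n) \<and>
                   weakly_continuous_kernel (euclid (n - 1)) (\<gamma> n)) \<and>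
          (\<exists>\<gamma>\<^sub>\<alpha>. real_distribution \<gamma>\<^sub>\<alpha> \<and>
             (\<forall>v. (\<forall>n\<ge>2. v (n - 1) \<in> space (borel_space (n - 1))) \<longrightarrow>
                  (\<lambda>n. magnetisation (n - 1) (v (n - 1))) \<longlonglongrightarrow> \<alpha> \<longrightarrow>
                  converges_weakly (\<lambda>n. \<gamma> n (v (n - 1))) \<gamma>\<^sub>\<alpha>)))"

definition sequentially_Gibbs :: "(nat \<Rightarrow> (nat \<Rightarrow> real) measure) \<Rightarrow> bool" where
  "sequentially_Gibbs \<rho> \<longleftrightarrow> (\<forall>\<alpha>. good_magnetisation \<rho> \<alpha>)"


section \<open>The rate functions\<close>

definition C_const :: "(real \<Rightarrow> real) \<Rightarrow> real \<Rightarrow> real \<Rightarrow> real" where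
  "C_const V t \<alpha> = (INF s. V s + s\<^sup>2 / 2 + (s - \<alpha>)\<^sup>2 / (2 * t))"

definition I_fun :: "(real \<Rightarrow> real) \<Rightarrow> real \<Rightarrow> real \<Rightarrow> real \<Rightarrow> real" where
  "I_fun V t \<alpha> r = V r + r\<^sup>2 / 2 + (r - \<alpha>)\<^sup>2 / (2 * t) - C_const V t \<alpha>"

definition abs_continuous_on :: "real \<Rightarrow> real \<Rightarrow> (real \<Rightarrow> real) \<Rightarrow> bool" where
  "abs_continuous_on a b f \<longleftrightarrow>
     (\<forall>\<epsilon>>0. \<exists>\<delta>>0. \<forall>(m::nat) l u.
        (\<forall>k<m. a \<le> l k \<and> l k \<le> u k \<and> u k \<le> b) \<longrightarrow>
        disjoint_family_on (\<lambda>k. {l k<..<u k}) {..<m} \<longrightarrow>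
        (\<Sum>k<m. u k - l k) < \<delta> \<longrightarrow>
        (\<Sum>k<m. \<bar>f (u k) - f (l k)\<bar>) < \<epsilon>)"

text \<open>
  Functions on \<open>{0..<t}\<close> are represented by their extensional version, so that distinct elements of
  \<open>C_paths t\<close> differ as functions on \<open>{0..<t}\<close>.
\<close>

definition C_paths :: "real \<Rightarrow> (real \<Rightarrow> real) set" where
  "C_paths t = {\<phi> \<in> extensional {0..<t}. continuous_on {0..<t} \<phi>}"

definition AC_paths :: "real \<Rightarrow> (real \<Rightarrow> real) set" where
  "AC_paths t = (\<lambda>\<psi>. restrict \<psi> {0..<t}) ` {\<psi>. abs_continuous_on 0 t \<psi>}"

text \<open>
  Paths in \<open>AC_paths t\<close> are differentiable almost everywhere, so the arbitrary value of \<open>deriv\<close> at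
  the other points does not affect the integral.
\<close>

definition J_fun :: "(real \<Rightarrow> real) \<Rightarrow> real \<Rightarrow> real \<Rightarrow> (real \<Rightarrow> real) \<Rightarrow> ereal" where
  "J_fun V t \<alpha> \<phi> =
     (if \<phi> \<in> AC_paths t \<and> (\<phi> \<longlongrightarrow> \<alpha>) (at_left t)
      then ereal (V (\<phi> 0) + (\<phi> 0)\<^sup>2 / 2)
           + ereal (1 / 2) * enn2ereal (\<integral>\<^sup>+s. ennreal ((deriv \<phi> s)\<^sup>2) * indicator {0..<t} s \<partial>lborel)
           - ereal (C_const V t \<alpha>)
      else \<infinity>)"

end

theory Submission
  imports Defs
begin

text \<open>
  A convolution of Gaussians shows that the conditional law of the first spin depends only on the
  magnetisation \<open>\<beta>\<close> of the others. It is a mixture of normal distributions whose means are increasing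
  affine functions of the magnetisation \<open>r\<close> at time 0, and up to corrections of relative order \<open>1/n\<close>
  in the exponent the mixing density is proportional to \<open>exp (- n * I_fun V t \<beta> r)\<close>. By Laplace's method it
  concentrates on the minimisers of \<open>I_fun V t \<beta>\<close>, so a unique minimiser at \<open>\<alpha>\<close> yields a limit along
  every sequence \<open>\<beta>\<close> tending to \<open>\<alpha>\<close>. Since \<open>\<beta>\<close> enters \<open>I_fun V t \<beta>\<close> through \<open>- r * \<beta> / t\<close>, two
  minimisers at \<open>\<alpha>\<close> can be selected by letting \<open>\<beta>\<close> tend to \<open>\<alpha>\<close> slowly from above or from below, and the
  limits differ.

  Among the absolutely continuous paths from \<open>r\<close> to \<open>\<alpha>\<close> the straight line is the only one of least
  energy \<open>(r - \<alpha>)\<^sup>2 / (2 * t)\<close>, so the minimisers of \<open>J_fun V t \<alpha>\<close> are the lines that start at the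
  minimisers of \<open>I_fun V t \<alpha>\<close>. This rests on the fundamental theorem of calculus for absolutely
  continuous functions: the variation function gives a Lebesgue--Stieltjes measure with a density,
  and by the Lebesgue differentiation theorem this density is the derivative almost everywhere.
\<close>

section \<open>Absolutely continuous functions\<close>

text \<open>The mixing density at size n is exactly proportional to
  \<open>exp (- n * energy_n n \<beta> r)\<close>, where the centre \<open>loc n \<beta>\<close> and
  the factor \<open>slope n\<close> vary with n. Hence \<open>energy_n\<close> need not converge
  uniformly on the line to its limit \<open>energy\<close>, which is \<open>I_fun\<close> up to a
  term free of r. One-sided control suffices: a lower bound with small relative error on a far-away
  set, and an upper bound near a minimiser. The factor \<open>1 / (1 + t)\<close> in the centre is
  the regression coefficient of an initial spin, of variance 1, on its value at time t, of variance
  \<open>1 + t\<close>.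

  Good magnetisation asks for some kernel, so a refutation has to treat every admissible one. As the
  law of the other spins charges every nonempty open set, weak continuity pins down all integrals of
  test functions, and the explicit kernel may be used instead. The two tilts are told apart by a
  bounded strictly increasing test function: its Gaussian averages increase with the mean, so
  nothing needs to be known about how the mass is shared among minimisers on the same side.\<close>

abbreviation disjoint_intervals :: "('i \<Rightarrow> real) \<Rightarrow> ('i \<Rightarrow> real) \<Rightarrow> 'i set \<Rightarrow> bool" where
  "disjoint_intervals l u \<equiv> disjoint_family_on (\<lambda>i. {l i<..<u i})"

text \<open>Keeping both constants visible lets a modulus of absolute continuity be transferred from
  a function to its variation. The intervals range over the whole line, so paths on
  \<open>{0..t}\<close> are first extended by constants.\<close>

definition ac_bound :: "(real \<Rightarrow> real) \<Rightarrow> real \<Rightarrow> real \<Rightarrow> bool" where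
  "ac_bound f \<delta> \<epsilon> \<longleftrightarrow>
     (\<forall>(m::nat) l u. (\<forall>k<m. l k \<le> u k) \<longrightarrow> disjoint_intervals l u {..<m} \<longrightarrow>
        (\<Sum>k<m. u k - l k) < \<delta> \<longrightarrow> (\<Sum>k<m. \<bar>f (u k) - f (l k)\<bar>) < \<epsilon>)"

definition abs_cont :: "(real \<Rightarrow> real) \<Rightarrow> bool" where
  "abs_cont f \<longleftrightarrow> (\<forall>\<epsilon>>0. \<exists>\<delta>>0. ac_bound f \<delta> \<epsilon>)"

lemma ac_boundD:
  fixes l u :: "'i \<Rightarrow> real"
  assumes f: "ac_bound f \<delta> \<epsilon>" and I: "finite I" and le: "\<And>i. i \<in> I \<Longrightarrow> l i \<le> u i"
    and disj: "disjoint_intervals l u I" and sum: "(\<Sum>i\<in>I. u i - l i) < \<delta>"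
  shows "(\<Sum>i\<in>I. \<bar>f (u i) - f (l i)\<bar>) < \<epsilon>"
proof -
  obtain h where h: "bij_betw h {..<card I} I"
    using ex_bij_betw_nat_finite[OF I] by (auto simp: atLeast0LessThan)
  have "disjoint_family_on (\<lambda>k. {l (h k)<..<u (h k)}) {..<card I}"
    unfolding disjoint_family_on_def
  proof (intro ballI impI)
    fix m n assume mn: "m \<in> {..<card I}" "n \<in> {..<card I}" "m \<noteq> n"
    then have "h m \<in> I" "h n \<in> I" "h m \<noteq> h n"
      using h by (auto simp: bij_betw_def inj_on_def)
    then show "{l (h m)<..<u (h m)} \<inter> {l (h n)<..<u (h n)} = {}"
      using disj by (auto simp: disjoint_family_on_def)
  qed
  moreover have "\<forall>k<card I. l (h k) \<le> u (h k)"
    using h le by (auto simp: bij_betw_def)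
  moreover have "(\<Sum>k<card I. u (h k) - l (h k)) < \<delta>"
    using sum sum.reindex_bij_betw[OF h, of "\<lambda>i. u i - l i"] by simp
  ultimately have "(\<Sum>k<card I. \<bar>f (u (h k)) - f (l (h k))\<bar>) < \<epsilon>"
    using f[unfolded ac_bound_def, rule_format, of "card I" "l \<circ> h" "u \<circ> h"] by simp
  then show ?thesis
    using sum.reindex_bij_betw[OF h, of "\<lambda>i. \<bar>f (u i) - f (l i)\<bar>"] by simp
qed

lemma sum_length_le:
  fixes l u :: "'i \<Rightarrow> real"
  assumes I: "finite I" and le: "\<And>i. i \<in> I \<Longrightarrow> l i \<le> u i"
    and disj: "disjoint_intervals l u I"
    and sub: "\<And>i. i \<in> I \<Longrightarrow> {l i<..<u i} \<subseteq> S" and S: "S \<in> fmeasurable lborel"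
  shows "(\<Sum>i\<in>I. u i - l i) \<le> measure lborel S"
proof -
  have "(\<Sum>i\<in>I. u i - l i) = (\<Sum>i\<in>I. measure lborel {l i<..<u i})"
    using le by (intro sum.cong) auto
  also have "\<dots> = measure lborel (\<Union>i\<in>I. {l i<..<u i})"
    by (rule measure_finite_Union[symmetric]) (use I disj le in auto)
  also have "\<dots> \<le> measure lborel S"
    using sub by (intro measure_mono_fmeasurable) (auto intro!: S sets.finite_UN I)
  finally show ?thesis .
qed

lemma Icc_fmeasurable: "{a..b::real} \<in> fmeasurable lborel"
  by (simp add: fmeasurable_def emeasure_lborel_Icc_eq)

section \<open>Total variation and its modulus of continuity\<close>

definition var_sums :: "(real \<Rightarrow> real) \<Rightarrow> real set \<Rightarrow> real set" where
  "var_sums f A = {\<Sum>k<m. \<bar>f (u k) - f (l k)\<bar> | (m::nat) l u.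
     (\<forall>k<m. l k \<le> u k \<and> l k \<in> A \<and> u k \<in> A) \<and> disjoint_intervals l u {..<m}}"

text \<open>Sums over disjoint families have the same supremum as sums over partitions, and such
  families can be cut, extended or merged without putting them in order.\<close>

definition variation :: "(real \<Rightarrow> real) \<Rightarrow> real \<Rightarrow> real" where
  "variation f x = Sup (var_sums f {..x})"

lemma zero_in_var_sums: "0 \<in> var_sums f A"
  unfolding var_sums_def by (auto intro!: exI[of _ "0::nat"] simp: disjoint_family_on_def)

lemma var_sumsI:
  assumes "\<And>k. k < m \<Longrightarrow> l k \<le> u k" "\<And>k. k < m \<Longrightarrow> l k \<in> A" "\<And>k. k < m \<Longrightarrow> u k \<in> A"
    and "disjoint_intervals l u {..<m::nat}"
  shows "(\<Sum>k<m. \<bar>f (u k) - f (l k)\<bar>) \<in> var_sums f A"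
  unfolding var_sums_def using assms by blast

lemma var_sumsE:
  assumes "s \<in> var_sums f A"
  obtains m :: nat and l u where "\<And>k. k < m \<Longrightarrow> l k \<le> u k" "\<And>k. k < m \<Longrightarrow> l k \<in> A"
    "\<And>k. k < m \<Longrightarrow> u k \<in> A" "disjoint_intervals l u {..<m}"
    "s = (\<Sum>k<m. \<bar>f (u k) - f (l k)\<bar>)"
proof -
  from assms have "\<exists>(m::nat) l u. s = (\<Sum>k<m. \<bar>f (u k) - f (l k)\<bar>) \<and>
      (\<forall>k<m. l k \<le> u k \<and> l k \<in> A \<and> u k \<in> A) \<and> disjoint_intervals l u {..<m}"
    unfolding var_sums_def by simp
  then show thesis by (elim exE conjE) (rule that, auto)
qed

lemma disjoint_family_on_antimono:
  "disjoint_family_on B I \<Longrightarrow> (\<And>i. i \<in> I \<Longrightarrow> A i \<subseteq> B i) \<Longrightarrow> disjoint_family_on A I"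
  unfolding disjoint_family_on_def by blast

lemma var_sums_mono: "A \<subseteq> B \<Longrightarrow> var_sums f A \<subseteq> var_sums f B"
  unfolding var_sums_def by blast

text \<open>Clamping the end points of every interval at x, from above and from below, yields one
  family on each side of x. The clamped open intervals are subsets of the original ones, so
  disjointness survives, and the triangle inequality is spent only on an interval that straddles
  x.\<close>

lemma var_sums_split:
  assumes s: "s \<in> var_sums f {..y}" and xy: "x \<le> y"
  shows "\<exists>s1\<in>var_sums f {..x}. \<exists>s2\<in>var_sums f {x..y}. s \<le> s1 + s2"
proof -
  obtain m :: nat and l u where
    lu: "\<forall>k<m. l k \<le> u k \<and> l k \<in> {..y} \<and> u k \<in> {..y}"
    and disj: "disjoint_intervals l u {..<m}"
    and s_eq: "s = (\<Sum>k<m. \<bar>f (u k) - f (l k)\<bar>)"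
    using s unfolding var_sums_def by blast
  let ?s1 = "\<Sum>k<m. \<bar>f (min (u k) x) - f (min (l k) x)\<bar>"
  let ?s2 = "\<Sum>k<m. \<bar>f (max (u k) x) - f (max (l k) x)\<bar>"
  have "disjoint_family_on (\<lambda>k. {min (l k) x<..<min (u k) x}) {..<m}"
    by (rule disjoint_family_on_antimono[OF disj]) auto
  moreover have "disjoint_family_on (\<lambda>k. {max (l k) x<..<max (u k) x}) {..<m}"
    by (rule disjoint_family_on_antimono[OF disj]) auto
  ultimately have "?s1 \<in> var_sums f {..x}" "?s2 \<in> var_sums f {x..y}"
    using lu xy by (auto intro!: var_sumsI min.mono max.mono)
  moreover have "s \<le> ?s1 + ?s2"
    unfolding s_eq sum.distrib[symmetric]
  proof (rule sum_mono)
    fix k assume "k \<in> {..<m}"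
    then have "l k \<le> u k" using lu by auto
    then show "\<bar>f (u k) - f (l k)\<bar> \<le> \<bar>f (min (u k) x) - f (min (l k) x)\<bar> +
                 \<bar>f (max (u k) x) - f (max (l k) x)\<bar>"
      by (cases "u k \<le> x"; cases "l k \<le> x") (auto simp: min_def max_def)
  qed
  ultimately show ?thesis by blast
qed

lemma var_sums_append:
  assumes s: "s \<in> var_sums f {..x}" and xy: "x \<le> y"
  shows "s + \<bar>f y - f x\<bar> \<in> var_sums f {..y}"
proof -
  obtain m :: nat and l u where
    lu: "\<forall>k<m. l k \<le> u k \<and> l k \<in> {..x} \<and> u k \<in> {..x}"
    and disj: "disjoint_intervals l u {..<m}"
    and s_eq: "s = (\<Sum>k<m. \<bar>f (u k) - f (l k)\<bar>)"
    using s unfolding var_sums_def by blast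
  let ?l = "l(m := x)" and ?u = "u(m := y)"
  have "disjoint_family_on (\<lambda>k. {?l k<..<?u k}) {..<Suc m}"
    using disj lu unfolding disjoint_family_on_def by (fastforce simp: less_Suc_eq)
  moreover have "\<forall>k<Suc m. ?l k \<le> ?u k \<and> ?l k \<in> {..y} \<and> ?u k \<in> {..y}"
    using lu xy by (auto simp: less_Suc_eq)
  moreover have "s + \<bar>f y - f x\<bar> = (\<Sum>k<Suc m. \<bar>f (?u k) - f (?l k)\<bar>)"
    by (simp add: s_eq)
  ultimately show ?thesis
    unfolding var_sums_def by blast
qed

lemma var_sums_bounded_short:
  assumes "ac_bound f \<delta> \<epsilon>" "s \<in> var_sums f {x..y}" "y - x < \<delta>" "x \<le> y"
  shows "s < \<epsilon>"
proof -
  obtain m :: nat and l u where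
    lu: "\<forall>k<m. l k \<le> u k \<and> l k \<in> {x..y} \<and> u k \<in> {x..y}"
    and disj: "disjoint_intervals l u {..<m}"
    and s_eq: "s = (\<Sum>k<m. \<bar>f (u k) - f (l k)\<bar>)"
    using assms unfolding var_sums_def by blast
  have "(\<Sum>k<m. u k - l k) \<le> measure lborel {x..y}"
    by (rule sum_length_le[OF _ _ disj]) (use lu in \<open>force intro!: Icc_fmeasurable\<close>)+
  then show ?thesis
    unfolding s_eq using assms lu disj by (intro ac_boundD[OF assms(1)]) auto
qed

text \<open>A path on \<open>{0..t}\<close> extended by its end values. The extension has no
  variation outside \<open>{0..t}\<close>, so half-lines can replace intervals in
  \<open>variation\<close>.\<close>

locale ac_path =
  fixes f :: "real \<Rightarrow> real" and t :: real
  assumes ac: "abs_cont f" and left: "\<And>x. x \<le> 0 \<Longrightarrow> f x = f 0" and right: "\<And>x. x \<ge> t \<Longrightarrow> f x = f t"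
begin

lemma bdd_above_var_sums: "bdd_above (var_sums f A)"
proof -
  obtain \<delta> where \<delta>: "\<delta> > 0" "ac_bound f \<delta> 1"
    using ac unfolding abs_cont_def by (meson zero_less_one)
  \<comment> \<open>A piece of length \<open>\<delta> / 2\<close> is shorter than
    \<open>\<delta>\<close>, so each such piece adds variation less than 1, starting from none on
    the half-line \<open>{..0}\<close>.\<close>
  have step: "\<forall>s\<in>var_sums f {..real n * (\<delta> / 2)}. s \<le> real n" for n
  proof (induction n)
    case 0
    have "s \<le> 0" if "s \<in> var_sums f {..0}" for s
    proof -
      obtain m :: nat and l u where "\<forall>k<m. l k \<in> {..0} \<and> u k \<in> {..0}"
        and s_eq: "s = (\<Sum>k<m. \<bar>f (u k) - f (l k)\<bar>)"
        using \<open>s \<in> var_sums f {..0}\<close> unfolding var_sums_def by blast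
      then have "f (u k) = f 0" "f (l k) = f 0" if "k < m" for k
        using left[of "u k"] left[of "l k"] that by auto
      then show ?thesis by (simp add: s_eq)
    qed
    then show ?case by simp
  next
    case (Suc n)
    show ?case
    proof
      fix s assume "s \<in> var_sums f {..real (Suc n) * (\<delta> / 2)}"
      then obtain s1 s2 where s: "s1 \<in> var_sums f {..real n * (\<delta> / 2)}"
        "s2 \<in> var_sums f {real n * (\<delta> / 2)..real (Suc n) * (\<delta> / 2)}" "s \<le> s1 + s2"
        using var_sums_split[of s f _ "real n * (\<delta> / 2)"] \<delta>(1) by (fastforce simp: field_simps)
      have "s2 < 1"
        by (rule var_sums_bounded_short[OF \<delta>(2) s(2)]) (use \<delta>(1) in \<open>auto simp: field_simps\<close>)
      with s Suc show "s \<le> real (Suc n)" by fastforce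
    qed
  qed
  obtain n where n: "t \<le> real n * (\<delta> / 2)"
    using \<delta>(1) real_arch_simple[of "t / (\<delta> / 2)"] by (auto simp: field_simps)
  \<comment> \<open>End points beyond t may be replaced by t without changing the values of
    f.\<close>
  have "var_sums f UNIV \<subseteq> var_sums f {..real n * (\<delta> / 2)}"
  proof
    fix s assume "s \<in> var_sums f UNIV"
    then obtain m :: nat and l u where lu: "\<And>k. k < m \<Longrightarrow> l k \<le> u k"
      and "\<And>k. k < m \<Longrightarrow> l k \<in> UNIV" "\<And>k. k < m \<Longrightarrow> u k \<in> UNIV"
      and disj: "disjoint_intervals l u {..<m}"
      and s_eq: "s = (\<Sum>k<m. \<bar>f (u k) - f (l k)\<bar>)"
      by (rule var_sumsE) (rule that)
    have min_t: "min x t \<le> real n * (\<delta> / 2)" for x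
      by (rule order_trans[OF min.cobounded2 n])
    have f: "f (min x t) = f x" for x
      using right[of x] by (cases "x \<le> t") simp_all
    have disj_t: "disjoint_family_on (\<lambda>k. {min (l k) t<..<min (u k) t}) {..<m}"
      by (rule disjoint_family_on_antimono[OF disj]) auto
    have "(\<Sum>k<m. \<bar>f (min (u k) t) - f (min (l k) t)\<bar>) \<in> var_sums f {..real n * (\<delta> / 2)}"
    proof (rule var_sumsI)
      show "min (l k) t \<le> min (u k) t" if "k < m" for k
        by (rule min.mono) (simp_all add: lu that)
    qed (simp_all only: min_t atMost_iff disj_t)
    then show "s \<in> var_sums f {..real n * (\<delta> / 2)}"
      by (simp add: s_eq f)
  qed
  then have "bdd_above (var_sums f UNIV)"
    using step[of n] by (meson bdd_above.I subsetD)
  then show ?thesis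
    using var_sums_mono[of A UNIV] by (meson bdd_above_mono subset_UNIV)
qed

lemma variation_add_le:
  assumes "x \<le> y" shows "variation f x + \<bar>f y - f x\<bar> \<le> variation f y"
proof -
  have "variation f x \<le> variation f y - \<bar>f y - f x\<bar>"
    unfolding variation_def
  proof (rule cSup_least)
    fix s assume "s \<in> var_sums f {..x}"
    from cSup_upper[OF var_sums_append[OF this assms] bdd_above_var_sums]
    show "s \<le> Sup (var_sums f {..y}) - \<bar>f y - f x\<bar>" by simp
  qed (use zero_in_var_sums in blast)
  then show ?thesis by simp
qed

lemma variation_diff_le:
  assumes "x \<le> y" shows "variation f y - variation f x \<le> Sup (var_sums f {x..y})"
proof -
  have "Sup (var_sums f {..y}) \<le> variation f x + Sup (var_sums f {x..y})"
  proof (rule cSup_least)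
    fix s assume "s \<in> var_sums f {..y}"
    from var_sums_split[OF this assms] obtain s1 s2 where
      s: "s1 \<in> var_sums f {..x}" "s2 \<in> var_sums f {x..y}" "s \<le> s1 + s2" by blast
    then show "s \<le> variation f x + Sup (var_sums f {x..y})"
      using cSup_upper[OF s(1) bdd_above_var_sums] cSup_upper[OF s(2) bdd_above_var_sums]
      unfolding variation_def by simp
  qed (use zero_in_var_sums in blast)
  then show ?thesis by (simp add: variation_def)
qed

lemma mono_variation: "mono (variation f)"
  using variation_add_le by (fastforce intro: monoI)

text \<open>Together with \<open>mono_variation\<close> this is the Jordan decomposition of f as a
  difference of two increasing functions.\<close>

lemma mono_variation_diff: "mono (\<lambda>x. variation f x - f x)"
  using variation_add_le by (fastforce intro: monoI)

text \<open>On each interval the increment of the variation is nearly attained by a finite family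
  inside it. All these families together form one disjoint family, no longer in total than the given
  one, to which the modulus of f applies.\<close>

lemma ac_bound_variation:
  assumes "ac_bound f \<delta> \<epsilon>" "\<epsilon> > 0"
  shows "ac_bound (variation f) \<delta> (3 * \<epsilon>)"
  unfolding ac_bound_def
proof (intro allI impI)
  fix m :: nat and l u
  assume lu: "\<forall>k<m. l k \<le> u k" and disj: "disjoint_intervals l u {..<m}"
    and len: "(\<Sum>k<m. u k - l k) < \<delta>"
  \<comment> \<open>Errors of \<open>\<epsilon> / (m + 1)\<close> add up to at most
    \<open>\<epsilon>\<close>, also for \<open>m = 0\<close>. With the bound
    \<open>\<epsilon>\<close> for the merged family the total stays below
    \<open>3 * \<epsilon>\<close>.\<close>
  have "\<exists>s\<in>var_sums f {l k..u k}. variation f (u k) - variation f (l k) \<le> s + \<epsilon> / (real m + 1)"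
    if "k < m" for k
  proof -
    have "Sup (var_sums f {l k..u k}) - \<epsilon> / (real m + 1) < Sup (var_sums f {l k..u k})"
      using assms(2) by simp
    then obtain s where s: "s \<in> var_sums f {l k..u k}" "Sup (var_sums f {l k..u k}) - \<epsilon> / (real m + 1) < s"
      using zero_in_var_sums by (subst (asm) less_cSup_iff) (auto intro: bdd_above_var_sums)
    then show ?thesis
      using variation_diff_le[of "l k" "u k"] lu that by (intro bexI[of _ s]) auto
  qed
  then obtain s where s: "\<And>k. k < m \<Longrightarrow> s k \<in> var_sums f {l k..u k}"
    "\<And>k. k < m \<Longrightarrow> variation f (u k) - variation f (l k) \<le> s k + \<epsilon> / (real m + 1)"
    by metis
  have "\<exists>n l' u'. (\<forall>j<n. l' j \<le> u' j \<and> l' j \<in> {l k..u k} \<and> u' j \<in> {l k..u k}) \<and>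
      disjoint_family_on (\<lambda>k. {l' k<..<u' k}) {..<(n::nat)} \<and> s k = (\<Sum>j<n. \<bar>f (u' j) - f (l' j)\<bar>)"
    if "k < m" for k
    using s(1)[OF that] unfolding var_sums_def by blast
  then have "\<forall>k\<in>{..<m}. \<exists>n l' u'. (\<forall>j<n. l' j \<le> u' j \<and> l' j \<in> {l k..u k} \<and> u' j \<in> {l k..u k}) \<and>
      disjoint_family_on (\<lambda>k. {l' k<..<u' k}) {..<(n::nat)} \<and> s k = (\<Sum>j<n. \<bar>f (u' j) - f (l' j)\<bar>)"
    by blast
  from this[unfolded bchoice_iff] obtain n :: "nat \<Rightarrow> nat" and l' u' :: "nat \<Rightarrow> nat \<Rightarrow> real" where
    lu': "\<And>k j. k < m \<Longrightarrow> j < n k \<Longrightarrow> l' k j \<le> u' k j \<and> l' k j \<in> {l k..u k} \<and> u' k j \<in> {l k..u k}"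
    and disj': "\<And>k. k < m \<Longrightarrow> disjoint_family_on (\<lambda>j. {l' k j<..<u' k j}) {..<n k}"
    and s_eq: "\<And>k. k < m \<Longrightarrow> s k = (\<Sum>j<n k. \<bar>f (u' k j) - f (l' k j)\<bar>)"
    by blast
  let ?I = "SIGMA k:{..<m}. {..<n k}"
  have "(\<Sum>i\<in>?I. \<bar>f (case_prod u' i) - f (case_prod l' i)\<bar>) < \<epsilon>"
  proof (rule ac_boundD[OF assms(1)])
    show "disjoint_family_on (\<lambda>i. {case_prod l' i<..<case_prod u' i}) ?I"
      unfolding disjoint_family_on_def
    proof (intro ballI impI)
      fix a b assume ab: "a \<in> ?I" "b \<in> ?I" "a \<noteq> b"
      obtain k j k' j' where [simp]: "a = (k, j)" "b = (k', j')" by fastforce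
      show "{case_prod l' a<..<case_prod u' a} \<inter> {case_prod l' b<..<case_prod u' b} = {}"
      proof (cases "k = k'")
        case True
        then show ?thesis using ab disj'[of k] by (auto simp: disjoint_family_on_def)
      next
        case False
        then have "{l k<..<u k} \<inter> {l k'<..<u k'} = {}"
          using disj ab by (auto simp: disjoint_family_on_def)
        moreover have "{l' k j<..<u' k j} \<subseteq> {l k<..<u k}" "{l' k' j'<..<u' k' j'} \<subseteq> {l k'<..<u k'}"
          using ab lu'[of k j] lu'[of k' j'] by auto
        ultimately have "{l' k j<..<u' k j} \<inter> {l' k' j'<..<u' k' j'} = {}" by blast
        then show ?thesis by simp
      qed
    qed
    have "(\<Sum>i\<in>?I. case_prod u' i - case_prod l' i) = (\<Sum>k<m. \<Sum>j<n k. u' k j - l' k j)"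
      by (subst sum.Sigma) (auto simp: case_prod_beta)
    also have "\<dots> \<le> (\<Sum>k<m. u k - l k)"
    proof (rule sum_mono)
      fix k assume "k \<in> {..<m}"
      then have k: "k < m" by simp
      have "(\<Sum>j<n k. u' k j - l' k j) \<le> measure lborel {l k..u k}"
        by (rule sum_length_le[OF _ _ disj'[OF k]]) (use lu'[OF k] in \<open>force intro!: Icc_fmeasurable\<close>)+
      then show "(\<Sum>j<n k. u' k j - l' k j) \<le> u k - l k" using lu k by simp
    qed
    finally show "(\<Sum>i\<in>?I. case_prod u' i - case_prod l' i) < \<delta>" using len by simp
  qed (use lu' in auto)
  also have "(\<Sum>i\<in>?I. \<bar>f (case_prod u' i) - f (case_prod l' i)\<bar>) = (\<Sum>k<m. s k)"
    by (subst sum.cong[OF refl s_eq]) (auto simp: sum.Sigma case_prod_beta)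
  finally have "(\<Sum>k<m. s k) < \<epsilon>" .
  moreover have "(\<Sum>k<m. \<bar>variation f (u k) - variation f (l k)\<bar>) \<le> (\<Sum>k<m. s k + \<epsilon> / (real m + 1))"
    using s(2) lu monoD[OF mono_variation] by (intro sum_mono) (auto simp: abs_of_nonneg)
  moreover have "(\<Sum>k<m. s k + \<epsilon> / (real m + 1)) \<le> (\<Sum>k<m. s k) + \<epsilon>"
  proof -
    have "real m * (\<epsilon> / (real m + 1)) \<le> \<epsilon>"
      using assms(2) by (simp add: field_simps)
    then show ?thesis unfolding sum.distrib by simp
  qed
  ultimately show "(\<Sum>k<m. \<bar>variation f (u k) - variation f (l k)\<bar>) < 3 * \<epsilon>"
    using assms(2) by linarith
qed

lemma abs_cont_variation: "abs_cont (variation f)"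
  unfolding abs_cont_def
proof (intro allI impI)
  fix \<epsilon> :: real assume "\<epsilon> > 0"
  then have "\<epsilon> / 3 > 0" by simp
  then obtain \<delta> where "\<delta> > 0" "ac_bound f \<delta> (\<epsilon> / 3)"
    using ac unfolding abs_cont_def by blast
  with ac_bound_variation[of \<delta> "\<epsilon> / 3"] \<open>\<epsilon> / 3 > 0\<close> show "\<exists>\<delta>>0. ac_bound (variation f) \<delta> \<epsilon>"
    by auto
qed

end

lemma abs_cont_diff:
  assumes "abs_cont f" "abs_cont g" shows "abs_cont (\<lambda>x. f x - g x)"
  unfolding abs_cont_def
proof (intro allI impI)
  fix \<epsilon> :: real assume "\<epsilon> > 0"
  then have "\<epsilon> / 2 > 0" by simp
  then obtain d e where d: "d > 0" "ac_bound f d (\<epsilon> / 2)" and e: "e > 0" "ac_bound g e (\<epsilon> / 2)"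
    using assms unfolding abs_cont_def by meson
  have "ac_bound (\<lambda>x. f x - g x) (min d e) \<epsilon>"
    unfolding ac_bound_def
  proof (intro allI impI)
    fix m :: nat and l u
    assume lu: "\<forall>k<m. l k \<le> u k" "disjoint_intervals l u {..<m}"
      "(\<Sum>k<m. u k - l k) < min d e"
    then have "(\<Sum>k<m. \<bar>f (u k) - f (l k)\<bar>) < \<epsilon> / 2" "(\<Sum>k<m. \<bar>g (u k) - g (l k)\<bar>) < \<epsilon> / 2"
      using d(2) e(2) unfolding ac_bound_def by auto
    moreover have "(\<Sum>k<m. \<bar>f (u k) - g (u k) - (f (l k) - g (l k))\<bar>) \<le>
        (\<Sum>k<m. \<bar>f (u k) - f (l k)\<bar> + \<bar>g (u k) - g (l k)\<bar>)"
      by (intro sum_mono) auto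
    ultimately show "(\<Sum>k<m. \<bar>f (u k) - g (u k) - (f (l k) - g (l k))\<bar>) < \<epsilon>"
      by (simp add: sum.distrib)
  qed
  with d e show "\<exists>\<delta>>0. ac_bound (\<lambda>x. f x - g x) \<delta> \<epsilon>"
    by (intro exI[of _ "min d e"]) auto
qed

lemma abs_cont_imp_continuous:
  assumes "abs_cont f" shows "continuous_on UNIV f"
  unfolding continuous_on_iff
proof (intro ballI allI impI)
  fix x e :: real assume "e > 0"
  with assms obtain d where d: "d > 0" "ac_bound f d e" unfolding abs_cont_def by blast
  have "\<bar>f y - f x\<bar> < e" if "\<bar>y - x\<bar> < d" for y
    using ac_boundD[OF d(2), of "{()}" "\<lambda>_. min x y" "\<lambda>_. max x y"] that
    by (cases "x \<le> y") (auto simp: disjoint_family_on_def abs_minus_commute)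
  with d(1) show "\<exists>d>0. \<forall>x'\<in>UNIV. dist x' x < d \<longrightarrow> dist (f x') (f x) < e"
    by (auto simp: dist_real_def)
qed

section \<open>The Lebesgue-Stieltjes measure of an increasing absolutely continuous
  function\<close>

lemma component_interval:
  fixes C :: "real set"
  assumes "C \<in> components G" "open G" "bounded G"
  shows "\<exists>c d. c \<le> d \<and> {c<..<d} \<subseteq> C \<and> C \<subseteq> {c..d}"
proof -
  have C: "C \<noteq> {}" "connected C" "bounded C"
    using assms in_components_nonempty in_components_connected in_components_subset bounded_subset by metis+
  have bdd: "bdd_above C" "bdd_below C"
    using C(3) bounded_imp_bdd_above bounded_imp_bdd_below by auto
  have "{Inf C<..<Sup C} \<subseteq> C"
  proof
    fix x assume "x \<in> {Inf C<..<Sup C}"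
    then obtain a b where "a \<in> C" "a < x" "b \<in> C" "x < b"
      using C(1) bdd cInf_less_iff[of C x] less_cSup_iff[of C x] by auto
    then show "x \<in> C"
      using C(2) connected_contains_Icc[of C a b] by auto
  qed
  moreover have "C \<subseteq> {Inf C..Sup C}"
    using bdd by (auto intro: cInf_lower cSup_upper)
  moreover have "Inf C \<le> Sup C"
    using C(1) bdd by (meson cInf_lower cSup_upper ex_in_conv order_trans)
  ultimately show ?thesis by blast
qed

text \<open>A bounded open set is the disjoint union of countably many components, each squeezed
  between an open and a closed interval with the same end points. The modulus bounds the Stieltjes
  measure of every finite union of components, and hence that of the whole set.\<close>

lemma interval_measure_open_le:
  assumes mono: "mono W" and cont: "continuous_on UNIV W" and ac: "ac_bound W \<delta> \<epsilon>"
    and G: "open G" "bounded G" "measure lborel G < \<delta>"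
  shows "emeasure (interval_measure W) G \<le> ennreal \<epsilon>"
proof -
  let ?N = "interval_measure W"
  define CC where "CC = components G"
  have openC: "open C" if "C \<in> CC" for C
    using that G(1) open_components unfolding CC_def by blast
  have disj: "C \<inter> D = {}" if "C \<in> CC" "D \<in> CC" "C \<noteq> D" for C D
    using that pairwise_disjoint_components[of G] unfolding CC_def pairwise_def by blast
  have "countable CC"
    using openC disj by (intro countable_disjoint_open_subsets) (auto simp: pairwise_def disjnt_def)
  obtain c d where cd: "\<And>C. C \<in> CC \<Longrightarrow> c C \<le> d C \<and> {c C<..<d C} \<subseteq> C \<and> C \<subseteq> {c C..d C}"
    using component_interval[OF _ G(1,2)] unfolding CC_def by metis
  have em: "emeasure ?N C \<le> ennreal (W (d C) - W (c C))" if "C \<in> CC" for C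
  proof -
    have "emeasure ?N C \<le> emeasure ?N {c C..d C}"
      using cd[OF that] by (intro emeasure_mono) auto
    then show ?thesis
      using cd[OF that] monoD[OF mono] cont by (subst (asm) emeasure_interval_measure_Icc) auto
  qed
  have fmG: "G \<in> fmeasurable lborel"
    using G(1) emeasure_bounded_finite[OF G(2)] by (simp add: fmeasurable_def)
  have fm: "C \<in> fmeasurable ?N" if "C \<in> CC" for C
    using em[OF that] openC[OF that]
    by (auto simp: fmeasurable_def intro: order_le_less_trans)
  have meas: "measure ?N C \<le> W (d C) - W (c C)" if "C \<in> CC" for C
    using em[OF that] cd[OF that] monoD[OF mono, of "c C" "d C"]
    unfolding measure_def by (simp add: enn2real_leI)
  have bound: "measure ?N (\<Union>I) \<le> \<epsilon>" if "I \<subseteq> CC" "finite I" for I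
  proof -
    have dj: "disjoint_family_on (\<lambda>C. {c C<..<d C}) I"
      unfolding disjoint_family_on_def
    proof (intro ballI impI)
      fix C D assume "C \<in> I" "D \<in> I" "C \<noteq> D"
      then have CD: "C \<in> CC" "D \<in> CC" using that(1) by auto
      have "C \<inter> D = {}" using disj[OF CD \<open>C \<noteq> D\<close>] .
      moreover have "{c C<..<d C} \<subseteq> C" "{c D<..<d D} \<subseteq> D" using cd[OF CD(1)] cd[OF CD(2)] by simp_all
      ultimately show "{c C<..<d C} \<inter> {c D<..<d D} = {}" by (meson disjoint_iff subsetD)
    qed
    have "(\<Sum>C\<in>I. d C - c C) \<le> measure lborel G"
    proof (rule sum_length_le[OF that(2) _ dj _ fmG])
      fix C assume "C \<in> I"
      then have C: "C \<in> CC" using that by blast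
      show "c C \<le> d C" using cd[OF C] by blast
      show "{c C<..<d C} \<subseteq> G"
        using cd[OF C] in_components_subset C unfolding CC_def by blast
    qed
    then have "(\<Sum>C\<in>I. \<bar>W (d C) - W (c C)\<bar>) < \<epsilon>"
      using cd that G(3) by (intro ac_boundD[OF ac that(2) _ dj]) auto
    moreover have "measure ?N (\<Union>I) \<le> (\<Sum>C\<in>I. measure ?N C)"
    proof -
      have "C \<in> sets ?N" if "C \<in> I" for C
        using openC[of C] that \<open>I \<subseteq> CC\<close> by auto
      then show ?thesis using measure_UNION_le[of I "\<lambda>C. C" ?N] that(2) by simp
    qed
    moreover have "(\<Sum>C\<in>I. measure ?N C) \<le> (\<Sum>C\<in>I. \<bar>W (d C) - W (c C)\<bar>)"
      using meas that by (intro sum_mono) fastforce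
    ultimately show ?thesis by linarith
  qed
  have "\<Union>CC \<in> fmeasurable ?N" "measure ?N (\<Union>CC) \<le> \<epsilon>"
    using fmeasurable_Union_bound[OF \<open>countable CC\<close> fm bound] measure_Union_bound[OF \<open>countable CC\<close> fm bound]
    by auto
  moreover have "\<Union>CC = G"
    unfolding CC_def by (rule Union_components)
  ultimately show ?thesis
    by (simp add: emeasure_eq_measure2 ennreal_leI fmeasurableD2 emeasure_eq_ennreal_measure)
qed

text \<open>Outer regularity encloses a bounded null set in an open set of arbitrarily small length,
  whose Stieltjes measure is then small.\<close>

lemma absolutely_continuous_interval_measure:
  assumes mono: "mono W" and ac: "abs_cont W"
  shows "absolutely_continuous lborel (interval_measure W)"
  unfolding absolutely_continuous_def
proof
  note cont = abs_cont_imp_continuous[OF ac]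
  let ?N = "interval_measure W"
  fix A :: "real set" assume A: "A \<in> null_sets lborel"
  have bounded_null: "emeasure ?N B = 0" if B: "B \<in> null_sets lborel" "bounded B" for B
  proof (rule ccontr)
    assume "emeasure ?N B \<noteq> 0"
    then have "0 < emeasure ?N B" by (simp add: zero_less_iff_neq_zero)
    then obtain z where z: "0 < z" "z < emeasure ?N B" using dense by blast
    then obtain \<epsilon> where \<epsilon>': "z = ennreal \<epsilon>" by (cases z) auto
    then have \<epsilon>: "ennreal \<epsilon> < emeasure ?N B" "0 < \<epsilon>" using z by auto
    obtain \<delta> where \<delta>: "\<delta> > 0" "ac_bound W \<delta> \<epsilon>"
      using ac \<epsilon>(2) unfolding abs_cont_def by blast
    obtain U where U: "open U" "B \<subseteq> U" "emeasure lborel (U - B) < \<delta>"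
      by (rule outer_regular_lborel[of B \<delta>]) (use B \<delta>(1) in \<open>auto dest: null_setsD2\<close>)
    obtain r where r: "B \<subseteq> ball 0 r"
      using B(2) bounded_subset_ballD by blast
    \<comment> \<open>The ball makes the enclosing open set bounded, so that its components are
      bounded intervals.\<close>
    define G where "G = U \<inter> ball 0 r"
    have G: "open G" "bounded G" "B \<subseteq> G"
      using U r by (auto simp: G_def)
    have "emeasure lborel G \<le> emeasure lborel ((U - B) \<union> B)"
      using B U by (intro emeasure_mono) (auto simp: G_def)
    also have "\<dots> = emeasure lborel (U - B)"
      using B U by (intro emeasure_Un_null_set) auto
    finally have "emeasure lborel G < \<delta>" using U(3) by simp
    then have "measure lborel G < \<delta>"
      using \<delta>(1) unfolding measure_def by (metis ennreal_enn2real_if ennreal_less_iff enn2real_nonneg infinity_ennreal_def less_top order_less_trans ennreal_less_top)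
    from interval_measure_open_le[OF mono cont \<delta>(2) G(1,2) this]
    have "emeasure ?N G \<le> ennreal \<epsilon>" .
    moreover have "emeasure ?N B \<le> emeasure ?N G"
      using G by (intro emeasure_mono) auto
    ultimately show False using \<epsilon>(1) by simp
  qed
  have "A \<inter> ball 0 (real n) \<in> null_sets ?N" for n
  proof -
    have "A \<inter> ball 0 (real n) \<in> null_sets lborel"
      using A by (intro null_set_Int2) auto
    then show ?thesis
      using bounded_null[of "A \<inter> ball 0 (real n)"] A
      by (auto simp: null_sets_def intro: bounded_subset[OF bounded_ball])
  qed
  then have "(\<Union>n::nat. A \<inter> ball 0 (real n)) \<in> null_sets ?N"
    by (intro null_sets_UN) auto
  also have "(\<Union>n::nat. A \<inter> ball 0 (real n)) = A"
    using reals_Archimedean2 by (force simp: dist_norm)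
  finally show "A \<in> null_sets ?N" .
qed

lemma mono_abs_cont_density:
  assumes mono: "mono W" and ac: "abs_cont W"
  shows "\<exists>g. \<forall>a b. a \<le> b \<longrightarrow> set_integrable lborel {a..b} g \<and> (LINT s:{a..b}|lborel. g s) = W b - W a"
proof -
  note cont = abs_cont_imp_continuous[OF ac]
  obtain f where f: "f \<in> borel_measurable lborel" "density lborel f = interval_measure W"
    using sigma_finite_measure.Radon_Nikodym[OF sigma_finite_lborel absolutely_continuous_interval_measure[OF assms]] by auto
  have [measurable]: "f \<in> borel_measurable borel" using f(1) by simp
  have eq: "(\<integral>\<^sup>+x. f x * indicator {a..b} x \<partial>lborel) = ennreal (W b - W a)" if "a \<le> b" for a b
  proof -
    have "(\<integral>\<^sup>+x. f x * indicator {a..b} x \<partial>lborel) = emeasure (interval_measure W) {a..b}"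
      by (simp flip: f(2) add: emeasure_density)
    also have "\<dots> = ennreal (W b - W a)"
      by (rule emeasure_interval_measure_Icc[OF that _ cont]) (rule monoD[OF mono])
    finally show ?thesis .
  qed
  have "(\<integral>\<^sup>+x. ennreal (indicator {a..b} x * enn2real (f x)) \<partial>lborel) = ennreal (W b - W a)"
    if "a \<le> b" for a b
  proof -
    \<comment> \<open>The density is finite almost everywhere on an interval because its integral
      there is finite; passing to \<open>enn2real\<close> therefore changes no integral.\<close>
    have "AE x in lborel. f x * indicator {a..b} x \<noteq> \<infinity>"
      by (rule nn_integral_noteq_infinite) (use eq[OF that] in auto)
    then show ?thesis
      unfolding eq[OF that, symmetric]
      by (intro nn_integral_cong_AE)
        (auto split: split_indicator simp: less_top elim!: eventually_mono)
  qed
  note eq' = this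
  show ?thesis
  proof (intro exI[of _ "\<lambda>x. enn2real (f x)"] allI impI)
    fix a b :: real assume ab: "a \<le> b"
    have "has_bochner_integral lborel (\<lambda>x. indicator {a..b} x * enn2real (f x)) (W b - W a)"
      using eq'[OF ab] ab monoD[OF mono ab]
      by (intro has_bochner_integral_nn_integral) auto
    then show "set_integrable lborel {a..b} (\<lambda>x. enn2real (f x)) \<and>
        (LINT s:{a..b}|lborel. enn2real (f s)) = W b - W a"
      by (auto simp: set_integrable_def set_lebesgue_integral_def has_bochner_integral_iff)
  qed
qed

text \<open>At a point where the derivative fails, arbitrarily short intervals carry an error proportional to
  their length. By the Vitali covering theorem disjoint intervals of this kind cover almost all such
  points, and the Henstock lemma makes their total error, hence their total length, small.\<close>

theorem lebesgue_differentiation: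
  fixes g :: "real \<Rightarrow> real"
  assumes g: "g integrable_on {a..b}" and F: "\<And>x. x \<in> {a..b} \<Longrightarrow> F x = F a + integral {a..x} g"
  shows "negligible {x \<in> {a<..<b}. \<not> (F has_real_derivative g x) (at x)}"
proof -
  define E where "E \<eta> = {x \<in> {a<..<b}. \<forall>d>0. \<exists>y\<in>{a<..<b}. \<bar>y - x\<bar> < d \<and>
      \<bar>F y - F x - g x * (y - x)\<bar> > \<eta> * \<bar>y - x\<bar>}" for \<eta>
  have diff: "F y - F x = integral {x..y} g" if "x \<in> {a..b}" "y \<in> {a..b}" "x \<le> y" for x y
  proof -
    have "integral {a..x} g + integral {x..y} g = integral {a..y} g"
      using that by (intro Henstock_Kurzweil_Integration.integral_combine integrable_subinterval_real[OF g]) auto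
    then show ?thesis using F[OF that(1)] F[OF that(2)] by simp
  qed
  have neg: "negligible (E \<eta>)" if \<eta>: "\<eta> > 0" for \<eta>
    unfolding negligible_outer_le
  proof (intro allI impI)
    fix e :: real assume e: "e > 0"
    \<comment> \<open>The tolerance is \<open>e * \<eta>\<close> because every bad interval
      contributes at least \<open>\<eta>\<close> times its length, which leaves total length at most
      e.\<close>
    obtain \<gamma> where \<gamma>: "gauge \<gamma>" and hen: "\<And>p. p tagged_partial_division_of (cbox a b) \<Longrightarrow> \<gamma> fine p \<Longrightarrow>
        (\<Sum>(x,k)\<in>p. norm (measure lborel k *\<^sub>R g x - integral k g)) < e * \<eta>"
      using Henstock_lemma[of g a b "e * \<eta>"] g e \<eta> by (auto simp: box_real)
    \<comment> \<open>A pair in K encodes the bad interval between x and y together with its tag,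
      the end point x. The condition on \<open>\<gamma> x\<close> makes it usable in a fine partial
      division.\<close>
    define K where "K = {(x, y). x \<in> {a<..<b} \<and> y \<in> {a<..<b} \<and> y \<noteq> x \<and>
        {min x y..max x y} \<subseteq> \<gamma> x \<and> \<bar>F y - F x - g x * (y - x)\<bar> > \<eta> * \<bar>y - x\<bar>}"
    define m r where "m = (\<lambda>(x, y). (x + y) / 2 :: real)" and "r = (\<lambda>(x, y). \<bar>y - x\<bar> / 2 :: real)"
    have cball: "cball (m (x, y)) (r (x, y)) = {min x y..max x y}" for x y
      by (auto simp: m_def r_def cball_eq_atLeastAtMost min_def max_def field_simps)
    have K: "\<exists>i. i \<in> K \<and> x \<in> cball (m i) (r i) \<and> r i < d" if x: "x \<in> E \<eta>" and d: "d > 0" for x d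
    proof -
      obtain d' where d': "d' > 0" "cball x d' \<subseteq> \<gamma> x"
        using \<gamma> unfolding gauge_def by (meson open_contains_cball)
      obtain y where y: "y \<in> {a<..<b}" "\<bar>y - x\<bar> < min d d'" "\<bar>F y - F x - g x * (y - x)\<bar> > \<eta> * \<bar>y - x\<bar>"
      proof -
        have "\<forall>d>0. \<exists>y\<in>{a<..<b}. \<bar>y - x\<bar> < d \<and> \<bar>F y - F x - g x * (y - x)\<bar> > \<eta> * \<bar>y - x\<bar>"
          using x by (simp add: E_def)
        moreover have "min d d' > 0" using d d'(1) by simp
        ultimately show ?thesis using that by blast
      qed
      have "{min x y..max x y} \<subseteq> cball x d'"
        using y(2) by (auto simp: dist_real_def)
      then have "(x, y) \<in> K"
        using x y d'(2) unfolding K_def E_def by auto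
      moreover have "x \<in> cball (m (x, y)) (r (x, y))" unfolding cball by auto
      moreover have "r (x, y) < d" using y(2) d by (auto simp: r_def)
      ultimately show ?thesis by blast
    qed
    have r_pos: "0 < r i" if "i \<in> K" for i
      using that by (auto simp: K_def r_def)
    obtain C where C: "countable C" "C \<subseteq> K"
      "pairwise (\<lambda>i j. disjnt (cball (m i) (r i)) (cball (m j) (r j))) C"
      "negligible (E \<eta> - (\<Union>i\<in>C. cball (m i) (r i)))"
      by (rule Vitali_covering_theorem_cballs[of K r "E \<eta>" m]) (use r_pos K that in blast)+
    let ?B = "\<lambda>i. cball (m i) (r i)"
    have bound: "measure lebesgue (\<Union>i\<in>I. ?B i) \<le> e" if I: "I \<subseteq> C" "finite I" for I
    proof -
      define p where "p = (\<lambda>i. (fst i, ?B i)) ` I"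
      \<comment> \<open>Two members with the same interval coincide, since distinct members have
        disjoint intervals and no interval is empty.\<close>
      have inj: "inj_on (\<lambda>i. (fst i, ?B i)) I"
      proof (rule inj_onI)
        fix i j assume ij: "i \<in> I" "j \<in> I" "(fst i, ?B i) = (fst j, ?B j)"
        show "i = j"
        proof (rule ccontr)
          assume "i \<noteq> j"
          then have "disjnt (?B i) (?B j)" using C(3) I(1) ij(1,2) unfolding pairwise_def by blast
          moreover have "i \<in> K" using I C(2) ij by auto
          then have "m i \<in> ?B i" using r_pos[of i] by simp
          moreover have "?B i = ?B j" using ij(3) by (simp only: prod.inject)
          ultimately show False by (metis IntI disjnt_def emptyE)
        qed
      qed
      have "p tagged_partial_division_of (cbox a b)"
        unfolding tagged_partial_division_of_def
      proof (intro conjI allI impI)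
        show "finite p" using I by (simp add: p_def)
        fix x k assume "(x, k) \<in> p"
        then obtain y where y: "(x, y) \<in> I" "k = {min x y..max x y}"
          unfolding p_def by (auto simp: cball)
        then have "(x, y) \<in> K" using I C(2) by auto
        then show "x \<in> k" "k \<subseteq> cbox a b" "\<exists>a b. k = cbox a b"
          unfolding y(2) K_def by (auto simp: box_real)
      next
        fix x1 K1 x2 K2
        assume "(x1, K1) \<in> p \<and> (x2, K2) \<in> p \<and> (x1, K1) \<noteq> (x2, K2)"
        then obtain i j where "i \<in> I" "j \<in> I" "i \<noteq> j" "K1 = ?B i" "K2 = ?B j"
          unfolding p_def by auto
        then have "disjnt K1 K2" using C(3) I by (auto simp: pairwise_def)
        then show "interior K1 \<inter> interior K2 = {}"
          using interior_subset unfolding disjnt_def by blast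
      qed
      moreover have "\<gamma> fine p"
      proof (rule fineI)
        fix x k assume "(x, k) \<in> p"
        then obtain y where y: "(x, y) \<in> I" "k = {min x y..max x y}"
          unfolding p_def by (auto simp: cball)
        then have "(x, y) \<in> K" using I C(2) by auto
        then show "k \<subseteq> \<gamma> x" unfolding K_def y(2) by auto
      qed
      ultimately have "(\<Sum>(x,k)\<in>p. norm (measure lborel k *\<^sub>R g x - integral k g)) < e * \<eta>"
        by (rule hen)
      also have "(\<Sum>(x,k)\<in>p. norm (measure lborel k *\<^sub>R g x - integral k g)) =
          (\<Sum>i\<in>I. norm (measure lborel (?B i) *\<^sub>R g (fst i) - integral (?B i) g))"
        unfolding p_def by (subst sum.reindex[OF inj]) simp
      finally have less: "(\<Sum>i\<in>I. norm (measure lborel (?B i) *\<^sub>R g (fst i) - integral (?B i) g)) < e * \<eta>" .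
      have ge: "\<eta> * measure lebesgue (?B i) \<le> norm (measure lborel (?B i) *\<^sub>R g (fst i) - integral (?B i) g)"
        if "i \<in> I" for i
      proof -
        obtain x y where i: "i = (x, y)" by fastforce
        then have xy: "(x, y) \<in> K" using that I C(2) by auto
        have c: "measure lborel {min x y..max x y} = \<bar>y - x\<bar>" by (auto simp: min_def max_def)
        have "measure lebesgue {min x y..max x y} = \<bar>y - x\<bar>"
          by (auto simp: min_def max_def)
        moreover have "\<bar>\<bar>y - x\<bar> * g x - integral {min x y..max x y} g\<bar> = \<bar>F y - F x - g x * (y - x)\<bar>"
          using xy diff[of x y] diff[of y x] unfolding K_def
          by (cases "x \<le> y") (auto simp: algebra_simps)
        ultimately show ?thesis
          using xy unfolding i cball K_def by (auto simp: c)
      qed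
      have "measure lebesgue (\<Union>i\<in>I. ?B i) \<le> (\<Sum>i\<in>I. measure lebesgue (?B i))"
        by (rule measure_UNION_le[OF I(2)]) auto
      moreover have "\<eta> * (\<Sum>i\<in>I. measure lebesgue (?B i)) < e * \<eta>"
        unfolding sum_distrib_left
        by (rule order_le_less_trans[OF sum_mono[OF ge] less])
      ultimately show ?thesis using \<eta> by (simp add: mult.commute)
    qed
    have lm: "?B i \<in> lmeasurable" for i by simp
    let ?T = "(E \<eta> - (\<Union>i\<in>C. ?B i)) \<union> (\<Union>i\<in>C. ?B i)"
    have U: "(\<Union>i\<in>C. ?B i) \<in> lmeasurable" "measure lebesgue (\<Union>i\<in>C. ?B i) \<le> e"
      using fmeasurable_UN_bound[OF C(1) lm bound] measure_UN_bound[OF C(1) lm bound] by auto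
    have "?T \<in> lmeasurable"
      by (rule fmeasurable.Un[OF negligible_imp_measurable[OF C(4)] U(1)])
    moreover have "measure lebesgue ?T \<le> measure lebesgue (E \<eta> - (\<Union>i\<in>C. ?B i)) + measure lebesgue (\<Union>i\<in>C. ?B i)"
      by (rule measure_Un_le[OF fmeasurableD[OF negligible_imp_measurable[OF C(4)]] fmeasurableD[OF U(1)]])
    then have "measure lebesgue ?T \<le> e"
      using U(2) negligible_imp_measure0[OF C(4)] by simp
    ultimately show "\<exists>T. E \<eta> \<subseteq> T \<and> T \<in> lmeasurable \<and> measure lebesgue T \<le> e"
      by (intro exI[of _ ?T]) auto
  qed
  have "{x \<in> {a<..<b}. \<not> (F has_real_derivative g x) (at x)} \<subseteq> (\<Union>n::nat. E (1 / (real n + 1)))"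
  proof
    fix x assume x: "x \<in> {x \<in> {a<..<b}. \<not> (F has_real_derivative g x) (at x)}"
    then have "\<not> (F has_derivative (\<lambda>h. g x * h)) (at x)"
      by (simp add: has_field_derivative_def)
    then obtain \<eta> where \<eta>: "\<eta> > 0" "\<And>d. d > 0 \<Longrightarrow> \<exists>y. \<bar>y - x\<bar> < d \<and> \<bar>F y - F x - g x * (y - x)\<bar> > \<eta> * \<bar>y - x\<bar>"
      unfolding has_derivative_at_alt by (auto simp: bounded_linear_mult_right not_le)
    obtain n where n: "1 / (real n + 1) < \<eta>"
      using nat_approx_posE[OF \<eta>(1)] by (metis of_nat_Suc add.commute)
    have "x \<in> E (1 / (real n + 1))"
      unfolding E_def
    proof (intro CollectI conjI allI impI)
      show "x \<in> {a<..<b}" using x by simp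
      fix d :: real assume "d > 0"
      \<comment> \<open>A distance from x smaller than those to a and b keeps y inside the open
        interval.\<close>
      moreover have "min d (min (x - a) (b - x)) > 0" using x \<open>d > 0\<close> by auto
      ultimately obtain y where y: "\<bar>y - x\<bar> < min d (min (x - a) (b - x))"
        "\<bar>F y - F x - g x * (y - x)\<bar> > \<eta> * \<bar>y - x\<bar>" using \<eta>(2) by blast
      moreover have "1 / (real n + 1) * \<bar>y - x\<bar> \<le> \<eta> * \<bar>y - x\<bar>"
        using n by (intro mult_right_mono) auto
      ultimately show "\<exists>y\<in>{a<..<b}. \<bar>y - x\<bar> < d \<and> \<bar>F y - F x - g x * (y - x)\<bar> > 1 / (real n + 1) * \<bar>y - x\<bar>"
        by (intro bexI[of _ y]) auto
    qed
    then show "x \<in> (\<Union>n::nat. E (1 / (real n + 1)))" by blast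
  qed
  moreover have "negligible (\<Union>n::nat. E (1 / (real n + 1)))"
    by (intro negligible_countable_Union[of "range (\<lambda>n::nat. E (1 / (real n + 1)))", simplified]) (auto intro!: neg)
  ultimately show ?thesis by (rule negligible_subset[rotated])
qed


text \<open>Clamping to \<open>{0..t}\<close> is monotone and never lengthens an interval, so the
  constant extension inherits the modulus of f.\<close>

lemma abs_cont_clamp:
  assumes ac: "abs_continuous_on 0 t f" and t: "t > 0"
  shows "abs_cont (\<lambda>x. f (max 0 (min t x)))"
  unfolding abs_cont_def
proof (intro allI impI)
  fix \<epsilon> :: real assume "\<epsilon> > 0"
  then obtain \<delta> where \<delta>: "\<delta> > 0" and ac': "\<And>(m::nat) l u. (\<forall>k<m. 0 \<le> l k \<and> l k \<le> u k \<and> u k \<le> t) \<Longrightarrow>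
        disjoint_intervals l u {..<m} \<Longrightarrow>
        (\<Sum>k<m. u k - l k) < \<delta> \<Longrightarrow> (\<Sum>k<m. \<bar>f (u k) - f (l k)\<bar>) < \<epsilon>"
  proof -
    from ac[unfolded abs_continuous_on_def, rule_format, OF \<open>\<epsilon> > 0\<close>] show ?thesis
      using that by (elim exE conjE) blast
  qed
  have "ac_bound (\<lambda>x. f (max 0 (min t x))) \<delta> \<epsilon>"
    unfolding ac_bound_def
  proof (intro allI impI)
    fix m :: nat and l u
    assume lu: "\<forall>k<m. l k \<le> u k" and disj: "disjoint_intervals l u {..<m}"
      and len: "(\<Sum>k<m. u k - l k) < \<delta>"
    show "(\<Sum>k<m. \<bar>f (max 0 (min t (u k))) - f (max 0 (min t (l k)))\<bar>) < \<epsilon>"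
    proof (rule ac')
      show "\<forall>k<m. 0 \<le> max 0 (min t (l k)) \<and> max 0 (min t (l k)) \<le> max 0 (min t (u k)) \<and> max 0 (min t (u k)) \<le> t"
        using lu t by (auto intro!: max.mono min.mono)
      show "disjoint_family_on (\<lambda>k. {max 0 (min t (l k))<..<max 0 (min t (u k))}) {..<m}"
        by (rule disjoint_family_on_antimono[OF disj]) auto
      have "(\<Sum>k<m. max 0 (min t (u k)) - max 0 (min t (l k))) \<le> (\<Sum>k<m. u k - l k)"
        using lu by (intro sum_mono) (auto simp: max_def min_def)
      then show "(\<Sum>k<m. max 0 (min t (u k)) - max 0 (min t (l k))) < \<delta>" using len by simp
    qed
  qed
  with \<delta> show "\<exists>\<delta>>0. ac_bound (\<lambda>x. f (max 0 (min t x))) \<delta> \<epsilon>" by blast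
qed

theorem abs_continuous_on_derivative:
  assumes ac: "abs_continuous_on 0 t f" and t: "t > 0"
  obtains g where "\<And>x. x \<in> {0..t} \<Longrightarrow> set_integrable lborel {0..x} g"
    "\<And>x. x \<in> {0..t} \<Longrightarrow> f x = f 0 + (LINT s:{0..x}|lborel. g s)"
    "AE x in lborel. x \<in> {0<..<t} \<longrightarrow> (f has_real_derivative g x) (at x)"
proof -
  define F where "F = (\<lambda>x. f (max 0 (min t x)))"
  interpret ac_path F t
    by standard (use abs_cont_clamp[OF ac t] t in \<open>auto simp: F_def\<close>)
  have Ff: "F x = f x" if "x \<in> {0..t}" for x
    using that by (auto simp: F_def)
  obtain g1 where g1: "\<And>a b. a \<le> b \<Longrightarrow> set_integrable lborel {a..b} g1"
    "\<And>a b. a \<le> b \<Longrightarrow> (LINT s:{a..b}|lborel. g1 s) = variation F b - variation F a"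
    using mono_abs_cont_density[OF mono_variation abs_cont_variation] by auto
  obtain g2 where g2: "\<And>a b. a \<le> b \<Longrightarrow> set_integrable lborel {a..b} g2"
    "\<And>a b. a \<le> b \<Longrightarrow> (LINT s:{a..b}|lborel. g2 s) = (variation F b - F b) - (variation F a - F a)"
    using mono_abs_cont_density[OF mono_variation_diff abs_cont_diff[OF abs_cont_variation ac]] by auto
  \<comment> \<open>The densities of the two increasing functions in the Jordan decomposition
    subtract to a density of F itself.\<close>
  define g where "g = (\<lambda>x. g1 x - g2 x)"
  have g: "set_integrable lborel {a..b} g" "(LINT s:{a..b}|lborel. g s) = F b - F a" if "a \<le> b" for a b
    using g1[OF that] g2[OF that] unfolding g_def by (auto simp: set_integral_diff)
  have hk: "g integrable_on {a..b}" "integral {a..b} g = F b - F a" if "a \<le> b" for a b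
    using set_borel_integral_eq_integral[OF g(1)[OF that]] g(2)[OF that] by auto
  have "negligible {x \<in> {0<..<t}. \<not> (F has_real_derivative g x) (at x)}"
    by (rule lebesgue_differentiation) (use hk t in auto)
  then have "AE x in lebesgue. x \<notin> {x \<in> {0<..<t}. \<not> (F has_real_derivative g x) (at x)}"
    by (intro AE_not_in) (simp add: negligible_iff_null_sets)
  then have "AE x in lborel. x \<in> {0<..<t} \<longrightarrow> (F has_real_derivative g x) (at x)"
    by (subst (asm) AE_completion_iff) (auto elim!: eventually_mono)
  then have AE: "AE x in lborel. x \<in> {0<..<t} \<longrightarrow> (f has_real_derivative g x) (at x)"
  proof eventually_elim
    case (elim x)
    show ?case
    proof
      assume x: "x \<in> {0<..<t}"
      show "(f has_real_derivative g x) (at x)"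
        by (rule has_field_derivative_transform_within_open[of F _ _ "{0<..<t}"])
          (use elim x Ff in auto)
    qed
  qed
  show thesis
  proof (rule that[of g])
    fix x assume x: "x \<in> {0..t}"
    then show "set_integrable lborel {0..x} g" using g(1)[of 0 x] by simp
    show "f x = f 0 + (LINT s:{0..x}|lborel. g s)"
      using g(2)[of 0 x] x Ff[of x] Ff[of 0] t by simp
  qed (rule AE)
qed

section \<open>Minimisers of the path functional\<close>

definition line_path :: "real \<Rightarrow> real \<Rightarrow> real \<Rightarrow> real \<Rightarrow> real" where
  "line_path t \<alpha> r = restrict (\<lambda>s. r + (\<alpha> - r) / t * s) {0..<t}"

lemma abs_continuous_on_affine: "abs_continuous_on 0 t (\<lambda>s. a + c * s)"
  unfolding abs_continuous_on_def
proof (intro allI impI)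
  fix \<epsilon> :: real assume \<epsilon>: "\<epsilon> > 0"
  have "(\<Sum>k<m. \<bar>a + c * u k - (a + c * l k)\<bar>) < \<epsilon>"
    if "\<forall>k<m. 0 \<le> l k \<and> l k \<le> u k \<and> u k \<le> t" "(\<Sum>k<m. u k - l k) < \<epsilon> / (\<bar>c\<bar> + 1)"
    for m :: nat and l u
  proof -
    have "(\<Sum>k<m. \<bar>a + c * u k - (a + c * l k)\<bar>) = \<bar>c\<bar> * (\<Sum>k<m. u k - l k)"
      unfolding sum_distrib_left
    proof (rule sum.cong)
      fix k assume "k \<in> {..<m}"
      then have "l k \<le> u k" using that(1) by simp
      then show "\<bar>a + c * u k - (a + c * l k)\<bar> = \<bar>c\<bar> * (u k - l k)"
        by (simp add: abs_mult flip: right_diff_distrib)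
    qed simp
    also have "\<dots> \<le> (\<bar>c\<bar> + 1) * (\<Sum>k<m. u k - l k)"
      using that(1) by (intro mult_right_mono sum_nonneg) auto
    also have "\<dots> < \<epsilon>"
      using that(2) by (simp add: field_simps)
    finally show ?thesis .
  qed
  moreover have "\<epsilon> / (\<bar>c\<bar> + 1) > 0" using \<epsilon> by simp
  ultimately show "\<exists>\<delta>>0. \<forall>(m::nat) l u. (\<forall>k<m. 0 \<le> l k \<and> l k \<le> u k \<and> u k \<le> t) \<longrightarrow>
        disjoint_family_on (\<lambda>k. {l k<..<u k}) {..<m} \<longrightarrow> (\<Sum>k<m. u k - l k) < \<delta> \<longrightarrow>
        (\<Sum>k<m. \<bar>a + c * u k - (a + c * l k)\<bar>) < \<epsilon>"
    by blast
qed

context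
  fixes t \<alpha> :: real
  assumes t: "t > 0"
begin

lemma line_path_0: "line_path t \<alpha> r 0 = r"
  using t by (simp add: line_path_def)

lemma line_path_in_C_paths: "line_path t \<alpha> r \<in> C_paths t"
proof -
  have "continuous_on {0..<t} (\<lambda>s. r + (\<alpha> - r) / t * s)"
    by (intro continuous_intros)
  then have "continuous_on {0..<t} (line_path t \<alpha> r)"
    by (rule continuous_on_eq) (simp add: line_path_def)
  then show ?thesis by (simp add: C_paths_def line_path_def)
qed

lemma deriv_restrict:
  assumes "s \<in> {0<..<t}" "(f has_real_derivative D) (at s)"
  shows "deriv (restrict f {0..<t}) s = D"
proof (rule DERIV_imp_deriv)
  show "(restrict f {0..<t} has_real_derivative D) (at s)"
    by (rule has_field_derivative_transform_within_open[of f _ _ "{0<..<t}"]) (use assms in auto)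
qed

lemma J_line_path: "J_fun V t \<alpha> (line_path t \<alpha> r) = ereal (I_fun V t \<alpha> r)"
proof -
  define c where "c = (\<alpha> - r) / t"
  have c_t: "c * t = \<alpha> - r" using t by (simp add: c_def)
  have line: "line_path t \<alpha> r = restrict (\<lambda>s. r + c * s) {0..<t}"
    by (simp add: line_path_def c_def)
  have AC: "line_path t \<alpha> r \<in> AC_paths t"
    unfolding AC_paths_def line by (rule imageI) (simp add: abs_continuous_on_affine)
  have "((\<lambda>s. r + c * s) \<longlongrightarrow> r + c * t) (at_left t)"
    by (intro tendsto_intros)
  then have lim: "(line_path t \<alpha> r \<longlongrightarrow> \<alpha>) (at_left t)"
    using t by (subst tendsto_cong[where g = "\<lambda>s. r + c * s"])
      (auto simp: line c_t eventually_at_left intro!: exI[of _ 0])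
  have "(\<integral>\<^sup>+s. ennreal ((deriv (line_path t \<alpha> r) s)\<^sup>2) * indicator {0..<t} s \<partial>lborel) =
      (\<integral>\<^sup>+s. ennreal (c\<^sup>2) * indicator {0..<t} s \<partial>lborel)"
  proof (rule nn_integral_cong_AE)
    have "deriv (line_path t \<alpha> r) s = c" if "s \<in> {0<..<t}" for s
      unfolding line using that by (rule deriv_restrict) (auto intro!: derivative_eq_intros)
    \<comment> \<open>Only the point 0 is left over, where the path restricted to
      \<open>{0..<t}\<close> need not be differentiable.\<close>
    then show "AE s in lborel. ennreal ((deriv (line_path t \<alpha> r) s)\<^sup>2) * indicator {0..<t} s =
        ennreal (c\<^sup>2) * indicator {0..<t} s"
      using AE_lborel_singleton[of "0::real"] by (auto elim!: eventually_mono split: split_indicator)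
  qed
  also have "\<dots> = ennreal (c\<^sup>2 * t)"
    using t by (simp add: nn_integral_cmult ennreal_mult)
  finally have int: "(\<integral>\<^sup>+s. ennreal ((deriv (line_path t \<alpha> r) s)\<^sup>2) * indicator {0..<t} s \<partial>lborel) = ennreal (c\<^sup>2 * t)" .
  have "c\<^sup>2 * t / 2 = (r - \<alpha>)\<^sup>2 / (2 * t)"
    using t by (simp add: c_def power2_eq_square field_simps)
  then show ?thesis
    using t AC lim by (simp add: J_fun_def int line_path_0 I_fun_def)
qed

text \<open>Here c is the mean of g over \<open>{0..t}\<close>, so the integral of
  \<open>(g s - c)\<^sup>2\<close> equals \<open>q - c\<^sup>2 * t\<close>. Its nonnegativity gives
  the bound, and its vanishing the equality case.\<close>

lemma square_integral_gap:
  assumes g: "set_integrable lborel {0..t} g" and int: "(LINT s:{0..t}|lborel. g s) = c * t"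
    and fin: "(\<integral>\<^sup>+s. ennreal ((g s)\<^sup>2) * indicator {0..t} s \<partial>lborel) = ennreal q" and q: "q \<ge> 0"
  shows "c\<^sup>2 * t \<le> q" and "q = c\<^sup>2 * t \<Longrightarrow> AE s in lborel. s \<in> {0..t} \<longrightarrow> g s = c"
proof -
  let ?i = "indicator {0..t} :: real \<Rightarrow> real"
  have g': "integrable lborel (\<lambda>s. ?i s * g s)" "(\<integral>s. ?i s * g s \<partial>lborel) = c * t"
    using g int by (auto simp: set_integrable_def set_lebesgue_integral_def)
  have [measurable]: "(\<lambda>s. ?i s * g s) \<in> borel_measurable lborel"
    using g'(1) by (rule borel_measurable_integrable)
  have "has_bochner_integral lborel (\<lambda>s. (?i s * g s)\<^sup>2) q"
  proof (rule has_bochner_integral_nn_integral)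
    show "(\<integral>\<^sup>+s. ennreal ((?i s * g s)\<^sup>2) \<partial>lborel) = ennreal q"
      unfolding fin[symmetric] by (intro nn_integral_cong) (auto split: split_indicator)
  qed (use q in auto)
  then have g2: "integrable lborel (\<lambda>s. (?i s * g s)\<^sup>2)" "(\<integral>s. (?i s * g s)\<^sup>2 \<partial>lborel) = q"
    by (auto simp: has_bochner_integral_iff)
  have i: "integrable lborel ?i" "(\<integral>s. ?i s \<partial>lborel) = t"
    using t by auto
  have eq: "(?i s * (g s - c))\<^sup>2 = (?i s * g s)\<^sup>2 - 2 * c * (?i s * g s) + c\<^sup>2 * ?i s" for s
    by (auto split: split_indicator simp: power2_eq_square algebra_simps)
  have h: "integrable lborel (\<lambda>s. (?i s * (g s - c))\<^sup>2)"
    unfolding eq using g'(1) g2(1) i(1) by (intro Bochner_Integration.integrable_add Bochner_Integration.integrable_diff integrable_mult_right)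
  have "(\<integral>s. (?i s * (g s - c))\<^sup>2 \<partial>lborel) = q - 2 * c * (c * t) + c\<^sup>2 * t"
    unfolding eq using g' g2 i by (simp add: integrable_mult_right)
  then have h': "(\<integral>s. (?i s * (g s - c))\<^sup>2 \<partial>lborel) = q - c\<^sup>2 * t"
    by (simp add: power2_eq_square)
  have "0 \<le> (\<integral>s. (?i s * (g s - c))\<^sup>2 \<partial>lborel)" by (rule integral_nonneg_AE) simp
  then show "c\<^sup>2 * t \<le> q" using h' by simp
  assume "q = c\<^sup>2 * t"
  then have "AE s in lborel. (?i s * (g s - c))\<^sup>2 = 0"
    using h h' by (subst integral_nonneg_eq_0_iff_AE[symmetric]) auto
  then show "AE s in lborel. s \<in> {0..t} \<longrightarrow> g s = c"
    by (rule eventually_mono) (auto split: split_indicator_asm)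
qed

lemma J_fun_ge:
  assumes "\<phi> \<in> C_paths t"
  shows "ereal (I_fun V t \<alpha> (\<phi> 0)) \<le> J_fun V t \<alpha> \<phi>"
    and "J_fun V t \<alpha> \<phi> = ereal (I_fun V t \<alpha> (\<phi> 0)) \<Longrightarrow> \<phi> = line_path t \<alpha> (\<phi> 0)"
proof -
  have "ereal (I_fun V t \<alpha> (\<phi> 0)) \<le> J_fun V t \<alpha> \<phi> \<and>
    (J_fun V t \<alpha> \<phi> = ereal (I_fun V t \<alpha> (\<phi> 0)) \<longrightarrow> \<phi> = line_path t \<alpha> (\<phi> 0))"
  proof (cases "\<phi> \<in> AC_paths t \<and> (\<phi> \<longlongrightarrow> \<alpha>) (at_left t)")
    case False
    then show ?thesis by (auto simp: J_fun_def)
  next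
    case True
    then obtain f where f: "abs_continuous_on 0 t f" "\<phi> = restrict f {0..<t}"
      unfolding AC_paths_def by auto
    obtain g where g: "\<And>x. x \<in> {0..t} \<Longrightarrow> set_integrable lborel {0..x} g"
      "\<And>x. x \<in> {0..t} \<Longrightarrow> f x = f 0 + (LINT s:{0..x}|lborel. g s)"
      "AE x in lborel. x \<in> {0<..<t} \<longrightarrow> (f has_real_derivative g x) (at x)"
      by (rule abs_continuous_on_derivative[OF f(1) t]) (rule that)
    define F where "F = (\<lambda>x. f (max 0 (min t x)))"
    have "continuous_on UNIV F"
      unfolding F_def by (rule abs_cont_imp_continuous[OF abs_cont_clamp[OF f(1) t]])
    \<comment> \<open>A path in \<open>AC_paths t\<close> is only a restriction to
      \<open>{0..<t}\<close>; continuity of the extension up to t identifies the prescribed left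
      limit with the value of f at t.\<close>
    then have "(F \<longlongrightarrow> F t) (at_left t)"
      by (meson continuous_on_def UNIV_I tendsto_within_subset subset_UNIV)
    then have "(\<phi> \<longlongrightarrow> F t) (at_left t)"
      using t by (subst tendsto_cong[where g = F])
        (auto simp: f(2) F_def eventually_at_left intro!: exI[of _ 0])
    then have f_t: "f t = \<alpha>"
      using True t tendsto_unique[of "at_left t" \<phi>] by (auto simp: F_def)
    define r where "r = \<phi> 0"
    have f_0: "f 0 = r" using t by (simp add: r_def f(2))
    define c where "c = (\<alpha> - r) / t"
    have c_t: "c * t = \<alpha> - r" using t by (simp add: c_def)
    have gt: "set_integrable lborel {0..t} g" "(LINT s:{0..t}|lborel. g s) = c * t"
      using g(1,2)[of t] t f_t f_0 c_t by auto
    let ?Q = "\<integral>\<^sup>+s. ennreal ((deriv \<phi> s)\<^sup>2) * indicator {0..<t} s \<partial>lborel"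
    have Q: "?Q = (\<integral>\<^sup>+s. ennreal ((g s)\<^sup>2) * indicator {0..t} s \<partial>lborel)"
    proof (rule nn_integral_cong_AE)
      show "AE s in lborel. ennreal ((deriv \<phi> s)\<^sup>2) * indicator {0..<t} s = ennreal ((g s)\<^sup>2) * indicator {0..t} s"
        using g(3) AE_lborel_singleton[of "0::real"] AE_lborel_singleton[of t]
      proof eventually_elim
        case (elim s)
        show ?case
        proof (cases "s \<in> {0<..<t}")
          case True
          then show ?thesis using elim deriv_restrict[of s f "g s"] by (simp add: f(2))
        qed (use elim in \<open>auto split: split_indicator\<close>)
      qed
    qed
    show ?thesis
    proof (cases ?Q)
      case top
      then show ?thesis using True by (simp add: J_fun_def)
    next
      case (real q)
      note gap = square_integral_gap[OF gt real(2)[unfolded Q] real(1)]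
      have J: "J_fun V t \<alpha> \<phi> = ereal (V r + r\<^sup>2 / 2 + q / 2 - C_const V t \<alpha>)"
        using True real by (simp add: J_fun_def r_def)
      have I: "I_fun V t \<alpha> (\<phi> 0) = V r + r\<^sup>2 / 2 + c\<^sup>2 * t / 2 - C_const V t \<alpha>"
        using t by (simp add: I_fun_def c_def r_def power2_eq_square field_simps)
      \<comment> \<open>If the energy is the least possible, the derivative is c almost everywhere,
        and integrating it recovers the line.\<close>
      have "\<phi> = line_path t \<alpha> (\<phi> 0)" if q: "q = c\<^sup>2 * t"
      proof
        fix x
        show "\<phi> x = line_path t \<alpha> (\<phi> 0) x"
        proof (cases "x \<in> {0..<t}")
          case True
          then have "f x = r + (LINT s:{0..x}|lborel. g s)" using g(2)[of x] f_0 by simp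
          also have "(LINT s:{0..x}|lborel. g s) = (LINT s:{0..x}|lborel. c)"
            using gap(2)[OF q] True g(1)[of x]
            unfolding set_lebesgue_integral_def set_integrable_def
            by (intro integral_cong_AE borel_measurable_integrable) (auto split: split_indicator elim!: eventually_mono)
          also have "\<dots> = c * x"
            using True by (simp add: set_integral_const)
          finally show ?thesis
            using True by (simp add: f(2) line_path_def c_def) (simp add: r_def f(2))
        qed (auto simp: f(2) line_path_def)
      qed
      then show ?thesis using gap(1) unfolding J I by auto
    qed
  qed
  then show "ereal (I_fun V t \<alpha> (\<phi> 0)) \<le> J_fun V t \<alpha> \<phi>"
    "J_fun V t \<alpha> \<phi> = ereal (I_fun V t \<alpha> (\<phi> 0)) \<Longrightarrow> \<phi> = line_path t \<alpha> (\<phi> 0)" by auto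
qed

text \<open>Lines realise the lower bound of \<open>J_fun_ge\<close>. A minimising path compared
  with the line from its own starting point attains the bound and hence is that line.\<close>

lemma arg_min_J_iff:
  "is_arg_min (J_fun V t \<alpha>) (\<lambda>\<phi>. \<phi> \<in> C_paths t) \<phi> \<longleftrightarrow>
     (\<exists>r. is_arg_min (I_fun V t \<alpha>) (\<lambda>_. True) r \<and> \<phi> = line_path t \<alpha> r)"
proof
  assume \<phi>: "is_arg_min (J_fun V t \<alpha>) (\<lambda>\<phi>. \<phi> \<in> C_paths t) \<phi>"
  then have C: "\<phi> \<in> C_paths t" and min: "\<And>\<psi>. \<psi> \<in> C_paths t \<Longrightarrow> J_fun V t \<alpha> \<phi> \<le> J_fun V t \<alpha> \<psi>"
    by (auto simp: is_arg_min_linorder)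
  have le: "J_fun V t \<alpha> \<phi> \<le> ereal (I_fun V t \<alpha> s)" for s
    using min[OF line_path_in_C_paths[of s]] by (simp add: J_line_path)
  have eq: "J_fun V t \<alpha> \<phi> = ereal (I_fun V t \<alpha> (\<phi> 0))"
    by (rule antisym[OF le J_fun_ge(1)[OF C]])
  show "\<exists>r. is_arg_min (I_fun V t \<alpha>) (\<lambda>_. True) r \<and> \<phi> = line_path t \<alpha> r"
    using le J_fun_ge(2)[OF C eq] by (intro exI[of _ "\<phi> 0"]) (auto simp: eq is_arg_min_linorder)
next
  assume "\<exists>r. is_arg_min (I_fun V t \<alpha>) (\<lambda>_. True) r \<and> \<phi> = line_path t \<alpha> r"
  then obtain r where r: "\<And>s. I_fun V t \<alpha> r \<le> I_fun V t \<alpha> s" "\<phi> = line_path t \<alpha> r"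
    by (auto simp: is_arg_min_linorder)
  have "J_fun V t \<alpha> \<phi> \<le> J_fun V t \<alpha> \<psi>" if "\<psi> \<in> C_paths t" for \<psi>
    using r J_fun_ge(1)[OF that, of V] order_trans[of "ereal (I_fun V t \<alpha> r)" "ereal (I_fun V t \<alpha> (\<psi> 0))"]
    by (auto simp: J_line_path)
  then show "is_arg_min (J_fun V t \<alpha>) (\<lambda>\<phi>. \<phi> \<in> C_paths t) \<phi>"
    using line_path_in_C_paths r(2) by (auto simp: is_arg_min_linorder)
qed

lemma ex1_arg_min_J_iff:
  "(\<exists>!r. is_arg_min (I_fun V t \<alpha>) (\<lambda>_. True) r) \<longleftrightarrow>
     (\<exists>!\<phi>. is_arg_min (J_fun V t \<alpha>) (\<lambda>\<phi>. \<phi> \<in> C_paths t) \<phi>)"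
proof -
  let ?P = "is_arg_min (I_fun V t \<alpha>) (\<lambda>_. True)" and ?L = "line_path t \<alpha>"
  have inj: "r = s" if "?L r = ?L s" for r s
    using fun_cong[OF that, of 0] by (simp only: line_path_0)
  show ?thesis
    unfolding arg_min_J_iff
  proof
    assume "\<exists>!r. ?P r"
    then obtain r where "?P r" "\<And>s. ?P s \<Longrightarrow> s = r" by blast
    then show "\<exists>!\<phi>. \<exists>r. ?P r \<and> \<phi> = ?L r"
      by (intro ex1I[of _ "?L r"]) blast+
  next
    assume *: "\<exists>!\<phi>. \<exists>r. ?P r \<and> \<phi> = ?L r"
    then obtain r where "?P r" by blast
    moreover have "s = r" if "?P s" for s
      using * that \<open>?P r\<close> by (intro inj) blast
    ultimately show "\<exists>!r. ?P r" by blast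
  qed
qed

end

section \<open>Gaussian densities and time-evolved measures\<close>

text \<open>Bayes' formula for a normal prior of x with variance \<open>A\<^sup>2\<close> and an
  observation r with mean \<open>c * x + d\<close> and variance \<open>B\<^sup>2\<close>: the right
  side is the marginal density of r times the posterior density of x.\<close>

lemma normal_density_product:
  assumes A: "A > 0" and B: "B > 0" and S: "S = A\<^sup>2 * c\<^sup>2 + B\<^sup>2"
  shows "normal_density 0 A x * normal_density (c * x + d) B r =
    normal_density d (sqrt S) r * normal_density ((r - d) * c * A\<^sup>2 / S) (A * B / sqrt S) x"
proof -
  have S_pos: "S > 0" using B unfolding S by (simp add: add_nonneg_pos)
  have "sqrt (2 * pi * A\<^sup>2) * sqrt (2 * pi * B\<^sup>2) = sqrt (2 * pi * S) * sqrt (2 * pi * (A * B / sqrt S)\<^sup>2)"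
    using A B S_pos by (simp add: real_sqrt_mult[symmetric] power_divide field_simps power_mult_distrib)
  moreover have "x\<^sup>2 / (2 * A\<^sup>2) + (r - (c * x + d))\<^sup>2 / (2 * B\<^sup>2) =
      (r - d)\<^sup>2 / (2 * S) + (x - (r - d) * c * A\<^sup>2 / S)\<^sup>2 / (2 * (A * B / sqrt S)\<^sup>2)"
  proof -
    define \<rho> where "\<rho> = r - d"
    have rho: "r - (c * x + d) = \<rho> - c * x" "r - d = \<rho>" by (simp_all add: \<rho>_def)
    have e: "x - \<rho> * c * A\<^sup>2 / S = (S * x - \<rho> * c * A\<^sup>2) / S" using S_pos by (simp add: field_simps)
    have sq: "(A * B / sqrt S)\<^sup>2 = A\<^sup>2 * B\<^sup>2 / S" using S_pos by (simp add: power_divide power_mult_distrib)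
    have "(x - \<rho> * c * A\<^sup>2 / S)\<^sup>2 / (2 * (A * B / sqrt S)\<^sup>2) = (S * x - \<rho> * c * A\<^sup>2)\<^sup>2 / (2 * A\<^sup>2 * B\<^sup>2 * S)"
      unfolding e sq using S_pos A B by (simp add: power_divide field_simps power2_eq_square)
    then have "\<rho>\<^sup>2 / (2 * S) + (x - \<rho> * c * A\<^sup>2 / S)\<^sup>2 / (2 * (A * B / sqrt S)\<^sup>2) =
        (\<rho>\<^sup>2 * A\<^sup>2 * B\<^sup>2 + (S * x - \<rho> * c * A\<^sup>2)\<^sup>2) / (2 * A\<^sup>2 * B\<^sup>2 * S)"
      using S_pos A B by (simp add: field_simps)
    also have "\<rho>\<^sup>2 * A\<^sup>2 * B\<^sup>2 + (S * x - \<rho> * c * A\<^sup>2)\<^sup>2 = S * (x\<^sup>2 * B\<^sup>2 + (\<rho> - c * x)\<^sup>2 * A\<^sup>2)"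
      unfolding S by (simp add: power2_eq_square algebra_simps)
    also have "S * (x\<^sup>2 * B\<^sup>2 + (\<rho> - c * x)\<^sup>2 * A\<^sup>2) / (2 * A\<^sup>2 * B\<^sup>2 * S) = x\<^sup>2 / (2 * A\<^sup>2) + (\<rho> - c * x)\<^sup>2 / (2 * B\<^sup>2)"
      using S_pos A B by (simp add: field_simps)
    finally show ?thesis unfolding rho by simp
  qed
  ultimately show ?thesis
    using S_pos unfolding normal_density_def
    by (simp add: mult_exp_exp flip: minus_add_distrib)
qed

section \<open>Lebesgue densities of the time-evolved measures\<close>

abbreviation lebesgue_space :: "nat \<Rightarrow> (nat \<Rightarrow> real) measure" where
  "lebesgue_space n \<equiv> PiM {..<n} (\<lambda>_. lborel)"

interpretation lborel_prod: product_sigma_finite "\<lambda>_::nat. lborel :: real measure"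
  by standard

lemma sigma_finite_lebesgue_space: "sigma_finite_measure (lebesgue_space n)"
  by (rule lborel_prod.sigma_finite) simp

lemma sets_lebesgue_space [measurable_cong, simp]: "sets (lebesgue_space n) = sets (borel_space n)"
  by (intro sets_PiM_cong) auto

lemma space_lebesgue_space [simp]: "space (lebesgue_space n) = space (borel_space n)"
  by (rule sets_eq_imp_space_eq) simp

lemma borel_measurable_magnetisation [measurable]: "magnetisation n \<in> borel_measurable (borel_space n)"
  unfolding magnetisation_def[abs_def] by measurable

lemma normal_dist_eq_PiM:
  assumes "c > 0"
  shows "normal_dist n v c = PiM {..<n} (\<lambda>i. density lborel (normal_density (v i) (sqrt c)))"
proof -
  interpret D: product_sigma_finite "\<lambda>i. density lborel (\<lambda>x. ennreal (normal_density (v i) (sqrt c) x))"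
    using assms by (intro product_sigma_finite.intro prob_space_imp_sigma_finite prob_space_normal_density) simp
  show ?thesis
  proof (rule D.PiM_eqI)
    show "sets (normal_dist n v c) = sets (PiM {..<n} (\<lambda>i. density lborel (normal_density (v i) (sqrt c))))"
      by (simp cong: sets_PiM_cong)
    fix A assume A: "\<And>i. i \<in> {..<n} \<Longrightarrow> A i \<in> sets (density lborel (normal_density (v i) (sqrt c)))"
    then have A': "A i \<in> sets borel" if "i < n" for i using that by simp
    then have E: "Pi\<^sub>E {..<n} A \<in> sets (lebesgue_space n)"
      by (intro sets_PiM_I_finite) auto
    have "emeasure (normal_dist n v c) (Pi\<^sub>E {..<n} A) =
        (\<integral>\<^sup>+x. ennreal (\<Prod>i<n. normal_density (v i) (sqrt c) (x i)) * indicator (Pi\<^sub>E {..<n} A) x \<partial>lebesgue_space n)"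
      unfolding normal_dist_def using E by (intro emeasure_density) (auto simp: normal_density_def)
    also have "\<dots> = (\<integral>\<^sup>+x. (\<Prod>i<n. ennreal (normal_density (v i) (sqrt c) (x i)) * indicator (A i) (x i)) \<partial>lebesgue_space n)"
    proof (rule nn_integral_cong)
      fix x assume "x \<in> space (lebesgue_space n)"
      then have "indicator (Pi\<^sub>E {..<n} A) x = (\<Prod>i<n. indicator (A i) (x i) :: ennreal)"
        by (auto simp: indicator_def space_PiM PiE_iff prod.neutral)
      then show "ennreal (\<Prod>i<n. normal_density (v i) (sqrt c) (x i)) * indicator (Pi\<^sub>E {..<n} A) x =
          (\<Prod>i<n. ennreal (normal_density (v i) (sqrt c) (x i)) * indicator (A i) (x i))"
        by (simp add: prod.distrib prod_ennreal)
    qed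
    also have "\<dots> = (\<Prod>i<n. \<integral>\<^sup>+x. ennreal (normal_density (v i) (sqrt c) x) * indicator (A i) x \<partial>lborel)"
      using A' by (intro lborel_prod.product_nn_integral_prod) auto
    also have "\<dots> = (\<Prod>i<n. emeasure (density lborel (normal_density (v i) (sqrt c))) (A i))"
      using A' by (intro prod.cong refl emeasure_density[symmetric]) auto
    finally show "emeasure (normal_dist n v c) (Pi\<^sub>E {..<n} A) =
        (\<Prod>i<n. emeasure (density lborel (normal_density (v i) (sqrt c))) (A i))" .
  qed simp
qed

lemma prob_space_normal_dist: "c > 0 \<Longrightarrow> prob_space (normal_dist n v c)"
  unfolding normal_dist_eq_PiM by (intro prob_space_PiM prob_space_normal_density) simp

text \<open>It reduces an n-fold integral against the interaction factor to a single one, since that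
  factor depends on the magnetisation alone.\<close>

lemma distr_magnetisation_normal_dist:
  assumes c: "c > 0" and n: "n > 0"
  shows "distr (normal_dist n v c) borel (magnetisation n) =
    density lborel (normal_density (magnetisation n v) (sqrt (c / real n)))"
proof -
  let ?D = "\<lambda>i. density lborel (\<lambda>x. ennreal (normal_density (v i) (sqrt c) x))"
  let ?P = "PiM {..<n} ?D"
  have D: "prob_space (?D i)" for i using c by (intro prob_space_normal_density) simp
  interpret P: prob_space ?P by (rule prob_space_PiM[OF D])
  have [measurable_cong]: "sets ?P = sets (borel_space n)"
    by (intro sets_PiM_cong) auto
  have comp: "distr ?P borel (\<lambda>x. x i) = ?D i" if "i < n" for i
  proof -
    have "distr ?P borel (\<lambda>x. x i) = distr ?P (?D i) (\<lambda>x. x i)" by (rule distr_cong) auto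
    also have "\<dots> = ?D i" using that by (intro distr_PiM_component D) auto
    finally show ?thesis .
  qed
  have "P.indep_vars (\<lambda>_. borel) (\<lambda>i x. x i) {..<n}"
  proof (subst P.indep_vars_iff_distr_eq_PiM')
    have "distr ?P (borel_space n) (\<lambda>x. \<lambda>i\<in>{..<n}. x i) = distr ?P ?P (\<lambda>x. x)"
      by (rule distr_cong) (auto simp: space_PiM PiE_restrict cong: sets_PiM_cong intro!: sets_PiM_cong)
    also have "\<dots> = ?P" by (rule distr_id)
    also have "\<dots> = PiM {..<n} (\<lambda>i. distr ?P borel (\<lambda>x. x i))"
      by (intro PiM_cong) (auto simp: comp)
    finally show "distr ?P (borel_space n) (\<lambda>x. \<lambda>i\<in>{..<n}. x i) = PiM {..<n} (\<lambda>i. distr ?P borel (\<lambda>x. x i))" .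
  qed (use n in auto)
  moreover have "distributed ?P lborel (\<lambda>x. x i) (normal_density (v i) (sqrt c))" if "i < n" for i
    unfolding distributed_def using comp[OF that] that by (auto cong: distr_cong)
  ultimately have "distributed ?P lborel (\<lambda>x. \<Sum>i<n. x i)
      (normal_density (\<Sum>i<n. v i) (sqrt (\<Sum>i<n. (sqrt c)\<^sup>2)))"
    using n c by (intro P.sum_indep_normal) auto
  then have "distributed ?P lborel (\<lambda>x. 0 + (1 / real n) * (\<Sum>i<n. x i))
      (normal_density (0 + (1 / real n) * (\<Sum>i<n. v i)) (\<bar>1 / real n\<bar> * sqrt (\<Sum>i<n. (sqrt c)\<^sup>2)))"
    by (rule P.normal_density_affine) (use n c in auto)
  moreover have "\<bar>1 / real n\<bar> * sqrt (\<Sum>i<n. (sqrt c)\<^sup>2) = sqrt (c / real n)"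
    using n c by (simp add: real_sqrt_mult real_sqrt_divide field_simps)
  ultimately have "distributed ?P lborel (magnetisation n) (normal_density (magnetisation n v) (sqrt (c / real n)))"
    by (simp add: magnetisation_def[abs_def])
  then show ?thesis
    unfolding distributed_def normal_dist_eq_PiM[OF c] by (auto cong: distr_cong)
qed

text \<open>The conditional expectation of \<open>exp (- n * V)\<close> at the initial magnetisation
  when the evolved one is m: without interaction the former then has mean \<open>m / (1 + t)\<close>
  and variance \<open>t / ((1 + t) * n)\<close>.\<close>

definition smoothed_weight :: "(real \<Rightarrow> real) \<Rightarrow> real \<Rightarrow> nat \<Rightarrow> real \<Rightarrow> ennreal" where
  "smoothed_weight V t n m =
     (\<integral>\<^sup>+r. ennreal (exp (- real n * V r) * normal_density (m / (1 + t)) (sqrt (t / (1 + t) / real n)) r) \<partial>lborel)"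

lemma measurable_smoothed_weight [measurable]:
  assumes [measurable]: "V \<in> borel_measurable borel"
  shows "smoothed_weight V t n \<in> borel_measurable borel"
  unfolding smoothed_weight_def[abs_def] normal_density_def by measurable

text \<open>Exchanging the integrals over initial and evolved spins and applying Bayes' formula in
  every coordinate leaves an inner integral over the initial configuration given the evolved one,
  and that integral depends on the evolved configuration through its magnetisation only.\<close>

lemma time_evolved_eq_density:
  assumes V[measurable]: "V \<in> borel_measurable borel" and t: "t > 0" and n: "n > 0"
  shows "time_evolved V t n = density (lebesgue_space n)
    (\<lambda>x. ennreal (\<Prod>i<n. normal_density 0 (sqrt (1 + t)) (x i)) * smoothed_weight V t n (magnetisation n x) / normalising_const V n)"
proof (rule measure_eqI)
  show "sets (time_evolved V t n) = sets (density (lebesgue_space n)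
    (\<lambda>x. ennreal (\<Prod>i<n. normal_density 0 (sqrt (1 + t)) (x i)) * smoothed_weight V t n (magnetisation n x) / normalising_const V n))"
    by (simp add: time_evolved_def)
  fix A assume "A \<in> sets (time_evolved V t n)"
  then have A[measurable]: "A \<in> sets (borel_space n)" by (simp add: time_evolved_def)
  let ?L = "lebesgue_space n"
  let ?Z = "normalising_const V n"
  let ?w = "\<lambda>z. ennreal (exp (- real n * V (magnetisation n z)))"
  let ?q = "\<lambda>z x. ennreal (\<Prod>i<n. normal_density 0 1 (z i)) *
        (ennreal (\<Prod>i<n. normal_density (z i) (sqrt t) (x i)) * indicator A x * ?w z)"
  let ?p = "\<lambda>x. ennreal (\<Prod>i<n. normal_density 0 (sqrt (1 + t)) (x i))"
  interpret L: pair_sigma_finite ?L ?L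
    by (intro pair_sigma_finite.intro sigma_finite_lebesgue_space)
  \<comment> \<open>One instance of \<open>normal_density_product\<close> per spin, with prior
    variance 1 and noise variance t.\<close>
  have gauss: "(\<Prod>i<n. normal_density 0 1 (z i)) * (\<Prod>i<n. normal_density (z i) (sqrt t) (x i)) =
      (\<Prod>i<n. normal_density 0 (sqrt (1 + t)) (x i)) * (\<Prod>i<n. normal_density (x i / (1 + t)) (sqrt (t / (1 + t))) (z i))"
    for z x :: "nat \<Rightarrow> real"
    unfolding prod.distrib[symmetric]
    using normal_density_product[of 1 "sqrt t" "1 + t" 1 _ 0] t
    by (intro prod.cong) (auto simp: real_sqrt_divide)
  have [measurable]: "(\<lambda>z. ennreal (\<Prod>i<n. normal_density 0 1 (z i))) \<in> borel_measurable ?L"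
    "?p \<in> borel_measurable ?L" "(\<lambda>z. ennreal (\<Prod>i<n. normal_density (x i) \<sigma> (z i))) \<in> borel_measurable ?L"
    "(\<lambda>x. ennreal (\<Prod>i<n. normal_density (x i) \<sigma> (z i))) \<in> borel_measurable ?L" for x z \<sigma>
    by (auto simp: normal_density_def)
  have meas: "(\<lambda>p. ennreal (\<Prod>i<n. normal_density 0 1 (snd p i)) *
      (ennreal (\<Prod>i<n. normal_density (snd p i) (sqrt t) (fst p i)) * indicator A (fst p) * ?w (snd p)))
      \<in> borel_measurable (?L \<Otimes>\<^sub>M ?L)"
    unfolding normal_density_def by measurable
  let ?g = "\<lambda>x z. ennreal (\<Prod>i<n. normal_density (x i / (1 + t)) (sqrt (t / (1 + t))) (z i))"
  have inner: "(\<integral>\<^sup>+z. ?g x z * ?w z \<partial>?L) =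
      smoothed_weight V t n (magnetisation n x)" for x
  proof -
    have "(\<integral>\<^sup>+z. ?g x z * ?w z \<partial>?L) =
        (\<integral>\<^sup>+z. ?w z \<partial>normal_dist n (\<lambda>i. x i / (1 + t)) (t / (1 + t)))"
      unfolding normal_dist_def by (rule nn_integral_density[symmetric]) (auto simp: normal_density_def)
    also have "\<dots> = (\<integral>\<^sup>+r. ennreal (exp (- real n * V r))
        \<partial>distr (normal_dist n (\<lambda>i. x i / (1 + t)) (t / (1 + t))) borel (magnetisation n))"
      by (subst nn_integral_distr) auto
    also have "\<dots> = (\<integral>\<^sup>+r. ennreal (normal_density (magnetisation n (\<lambda>i. x i / (1 + t))) (sqrt (t / (1 + t) / real n)) r) *
        ennreal (exp (- real n * V r)) \<partial>lborel)"
      using t n by (subst distr_magnetisation_normal_dist) (auto simp: nn_integral_density)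
    also have "magnetisation n (\<lambda>i. x i / (1 + t)) = magnetisation n x / (1 + t)"
      by (simp add: magnetisation_def sum_divide_distrib mult.commute)
    finally show ?thesis
      by (simp add: smoothed_weight_def ennreal_mult mult.commute)
  qed
  have "(\<integral>\<^sup>+z. emeasure (normal_dist n z t) A * ?w z \<partial>normal_dist n (\<lambda>_. 0) 1) =
      (\<integral>\<^sup>+z. (\<integral>\<^sup>+x. ?q z x \<partial>?L) \<partial>?L)"
    unfolding normal_dist_def[of n "\<lambda>_. 0"]
  proof (subst nn_integral_density)
    show "(\<lambda>z. emeasure (normal_dist n z t) A * ?w z) \<in> borel_measurable ?L"
      using measurable_emeasure_normal_dist[OF A] by measurable
    show "(\<integral>\<^sup>+z. ennreal (\<Prod>i<n. normal_density 0 (sqrt 1) (z i)) * (emeasure (normal_dist n z t) A * ?w z) \<partial>?L) =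
      (\<integral>\<^sup>+z. (\<integral>\<^sup>+x. ?q z x \<partial>?L) \<partial>?L)"
      unfolding normal_dist_def
      by (intro nn_integral_cong) (simp add: emeasure_density nn_integral_cmult nn_integral_multc)
  qed simp
  also have "\<dots> = (\<integral>\<^sup>+x. (\<integral>\<^sup>+z. ?q z x \<partial>?L) \<partial>?L)"
    using meas by (subst L.Fubini'[symmetric]) (auto simp: case_prod_beta)
  also have "\<dots> = (\<integral>\<^sup>+x. ?p x * smoothed_weight V t n (magnetisation n x) * indicator A x \<partial>?L)"
  proof (rule nn_integral_cong)
    fix x
    have "(\<integral>\<^sup>+z. ?q z x \<partial>?L) =
      (\<integral>\<^sup>+z. (?p x * indicator A x) * (?g x z * ?w z) \<partial>?L)"
    proof (rule nn_integral_cong)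
      fix z
      have "ennreal (\<Prod>i<n. normal_density 0 1 (z i)) * ennreal (\<Prod>i<n. normal_density (z i) (sqrt t) (x i)) =
        ?p x * ?g x z"
        using gauss[of z x] by (simp add: ennreal_mult[symmetric] prod_nonneg)
      then have "\<And>a. ennreal (\<Prod>i<n. normal_density 0 1 (z i)) * (ennreal (\<Prod>i<n. normal_density (z i) (sqrt t) (x i)) * a) =
        ?p x * (?g x z * a)"
        by (simp only: mult.assoc[symmetric])
      then show "?q z x =
        (?p x * indicator A x) * (?g x z * ?w z)"
        by (simp only: mult.assoc) (simp only: mult.left_commute)
    qed
    also have "\<dots> = (?p x * indicator A x) * smoothed_weight V t n (magnetisation n x)"
      unfolding inner[symmetric] by (rule nn_integral_cmult) measurable
    finally show "(\<integral>\<^sup>+z. ?q z x \<partial>?L) =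
      ?p x * smoothed_weight V t n (magnetisation n x) * indicator A x"
      by (simp add: mult_ac)
  qed
  finally have eq: "(\<integral>\<^sup>+z. emeasure (normal_dist n z t) A * ?w z \<partial>normal_dist n (\<lambda>_. 0) 1) =
    (\<integral>\<^sup>+x. ?p x * smoothed_weight V t n (magnetisation n x) * indicator A x \<partial>?L)" .
  show "emeasure (time_evolved V t n) A = emeasure (density ?L
    (\<lambda>x. ?p x * smoothed_weight V t n (magnetisation n x) / ?Z)) A"
  proof -
    have "(\<integral>\<^sup>+x. ?p x * smoothed_weight V t n (magnetisation n x) * indicator A x \<partial>?L) / ?Z =
        (\<integral>\<^sup>+x. ?p x * smoothed_weight V t n (magnetisation n x) * indicator A x / ?Z \<partial>?L)"
      by (rule nn_integral_divide[symmetric]) measurable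
    also have "\<dots> = (\<integral>\<^sup>+x. ?p x * smoothed_weight V t n (magnetisation n x) / ?Z * indicator A x \<partial>?L)"
      by (intro nn_integral_cong) (simp add: divide_ennreal_def mult_ac)
    finally show ?thesis
      unfolding emeasure_time_evolved[OF V A] eq by (subst emeasure_density) auto
  qed
qed

lemma normalising_const_bounds:
  assumes [measurable]: "V \<in> borel_measurable borel" and V: "\<And>x. V x \<ge> 0"
  shows "normalising_const V n \<le> 1" "normalising_const V n > 0"
proof -
  interpret prob_space "normal_dist n (\<lambda>_. 0) 1" by (rule prob_space_normal_dist) simp
  have "normalising_const V n \<le> (\<integral>\<^sup>+z. 1 \<partial>normal_dist n (\<lambda>_. 0) 1)"
    unfolding normalising_const_def using V by (intro nn_integral_mono) auto
  then show "normalising_const V n \<le> 1" by (simp add: emeasure_space_1)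
  have "normalising_const V n \<noteq> 0"
  proof
    assume "normalising_const V n = 0"
    then have "AE z in normal_dist n (\<lambda>_. 0) 1. False"
      unfolding normalising_const_def by (subst (asm) nn_integral_0_iff_AE) auto
    then show False by simp
  qed
  then show "normalising_const V n > 0" by (simp add: zero_less_iff_neq_zero)
qed

section \<open>The conditional law of the first spin\<close>

definition cons_spin :: "nat \<Rightarrow> real \<times> (nat \<Rightarrow> real) \<Rightarrow> nat \<Rightarrow> real" where
  "cons_spin k = (\<lambda>(a, y). \<lambda>i\<in>{..<Suc k}. case i of 0 \<Rightarrow> a | Suc j \<Rightarrow> y j)"

lemma measurable_cons_spin [measurable]:
  "cons_spin k \<in> measurable (borel \<Otimes>\<^sub>M borel_space k) (borel_space (Suc k))"
  unfolding cons_spin_def case_prod_beta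
proof (rule measurable_restrict)
  fix i assume i: "i \<in> {..<Suc k}"
  show "(\<lambda>p. case i of 0 \<Rightarrow> fst p | Suc j \<Rightarrow> snd p j) \<in> borel_measurable (borel \<Otimes>\<^sub>M borel_space k)"
    using i by (cases i) (auto intro!: measurable_compose[OF measurable_snd] measurable_component_singleton)
qed

lemma distr_cons_spin:
  "distr (lborel \<Otimes>\<^sub>M lebesgue_space k) (lebesgue_space (Suc k)) (cons_spin k) = lebesgue_space (Suc k)"
proof (rule lborel_prod.PiM_eqI)
  interpret L: sigma_finite_measure "lebesgue_space k" by (rule sigma_finite_lebesgue_space)
  fix A :: "nat \<Rightarrow> real set" assume "\<And>i. i \<in> {..<Suc k} \<Longrightarrow> A i \<in> sets lborel"
  then have A: "A i \<in> sets borel" if "i < Suc k" for i using that by simp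
  have E: "Pi\<^sub>E {..<Suc k} A \<in> sets (lebesgue_space (Suc k))"
    using A by (intro sets_PiM_I_finite) auto
  have E': "Pi\<^sub>E {..<k} (\<lambda>i. A (Suc i)) \<in> sets (lebesgue_space k)"
    using A by (intro sets_PiM_I_finite) auto
  have m: "cons_spin k \<in> measurable (lborel \<Otimes>\<^sub>M lebesgue_space k) (lebesgue_space (Suc k))"
    by measurable
  have "cons_spin k p \<in> Pi\<^sub>E {..<Suc k} A \<longleftrightarrow> fst p \<in> A 0 \<and> (\<forall>i<k. snd p i \<in> A (Suc i))" for p
    by (cases p) (simp add: cons_spin_def PiE_iff Ball_def All_less_Suc2)
  then have "cons_spin k -` Pi\<^sub>E {..<Suc k} A \<inter> space (lborel \<Otimes>\<^sub>M lebesgue_space k) =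
      A 0 \<times> Pi\<^sub>E {..<k} (\<lambda>i. A (Suc i))"
    by (auto simp: space_pair_measure space_PiM PiE_iff)
  then have "emeasure (distr (lborel \<Otimes>\<^sub>M lebesgue_space k) (lebesgue_space (Suc k)) (cons_spin k)) (Pi\<^sub>E {..<Suc k} A) =
      emeasure (lborel \<Otimes>\<^sub>M lebesgue_space k) (A 0 \<times> Pi\<^sub>E {..<k} (\<lambda>i. A (Suc i)))"
    by (simp add: emeasure_distr[OF m E])
  also have "\<dots> = emeasure lborel (A 0) * emeasure (lebesgue_space k) (Pi\<^sub>E {..<k} (\<lambda>i. A (Suc i)))"
    using A E' by (intro L.emeasure_pair_measure_Times) auto
  also have "emeasure (lebesgue_space k) (Pi\<^sub>E {..<k} (\<lambda>i. A (Suc i))) = (\<Prod>i<k. emeasure lborel (A (Suc i)))"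
    using A by (intro lborel_prod.emeasure_PiM) auto
  also have "emeasure lborel (A 0) * \<dots> = (\<Prod>i<Suc k. emeasure lborel (A i))"
    by (subst prod.lessThan_Suc_shift) simp
  finally show "emeasure (distr (lborel \<Otimes>\<^sub>M lebesgue_space k) (lebesgue_space (Suc k)) (cons_spin k)) (Pi\<^sub>E {..<Suc k} A) =
      (\<Prod>i<Suc k. emeasure lborel (A i))" .
qed simp_all

lemma nn_integral_cons_spin:
  assumes [measurable]: "f \<in> borel_measurable (borel_space (Suc k))"
  shows "(\<integral>\<^sup>+x. f x \<partial>lebesgue_space (Suc k)) = (\<integral>\<^sup>+y. (\<integral>\<^sup>+a. f (cons_spin k (a, y)) \<partial>lborel) \<partial>lebesgue_space k)"
proof -
  interpret pair_sigma_finite lborel "lebesgue_space k"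
    by (intro pair_sigma_finite.intro sigma_finite_lebesgue_space sigma_finite_lborel)
  have "(\<integral>\<^sup>+x. f x \<partial>lebesgue_space (Suc k)) = (\<integral>\<^sup>+p. f (cons_spin k p) \<partial>(lborel \<Otimes>\<^sub>M lebesgue_space k))"
    by (subst distr_cons_spin[symmetric], subst nn_integral_distr) auto
  also have "\<dots> = (\<integral>\<^sup>+y. (\<integral>\<^sup>+a. f (cons_spin k (a, y)) \<partial>lborel) \<partial>lebesgue_space k)"
    by (rule nn_integral_snd[symmetric]) measurable
  finally show ?thesis .
qed

lemma cons_spin_0: "cons_spin k (a, y) 0 = a"
  by (simp add: cons_spin_def)

lemma other_spins_cons_spin:
  assumes "y \<in> space (borel_space k)" shows "other_spins (Suc k) (cons_spin k (a, y)) = y"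
  using assms by (auto simp: other_spins_def cons_spin_def space_PiM PiE_iff extensional_def fun_eq_iff)

lemma sum_cons_spin: "(\<Sum>i<Suc k. f (cons_spin k (a, y) i)) = f a + (\<Sum>i<k. f (y i))"
  by (subst sum.lessThan_Suc_shift) (simp add: cons_spin_def)

lemma prod_cons_spin: "(\<Prod>i<Suc k. f (cons_spin k (a, y) i)) = f a * (\<Prod>i<k. f (y i))"
  by (subst prod.lessThan_Suc_shift) (simp add: cons_spin_def)

lemma magnetisation_cons_spin:
  "magnetisation (Suc k) (cons_spin k (a, y)) = (a + real k * magnetisation k y) / real (Suc k)"
  using sum_cons_spin[of "\<lambda>x. x" k a y] by (simp add: magnetisation_def)

lemma measurable_other_spins [measurable]:
  "other_spins (Suc k) \<in> measurable (borel_space (Suc k)) (borel_space k)"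
  unfolding other_spins_def by (auto intro!: measurable_restrict measurable_component_singleton)

section \<open>The standard normal law as reference measure\<close>

abbreviation gauss :: "real measure" where
  "gauss \<equiv> density lborel std_normal_density"

interpretation gauss: prob_space gauss
  by (rule prob_space_normal_density) simp

lemma gauss_UNIV [simp]: "emeasure gauss UNIV = 1" "measure gauss UNIV = 1"
  using gauss.emeasure_space_1 gauss.prob_space by simp_all

interpretation gauss2: pair_prob_space gauss gauss ..

text \<open>Writing every normal law as an image of the standard one keeps the reference measure
  fixed. The parameters move into the integrand, where dominated convergence can handle
  them.\<close>

lemma distr_gauss_affine:
  assumes \<sigma>: "\<sigma> > 0"
  shows "distr gauss lborel (\<lambda>x. \<mu> + \<sigma> * x) = density lborel (normal_density \<mu> \<sigma>)"
proof -
  have "distributed gauss lborel (\<lambda>x. x) (normal_density 0 1)"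
    by (auto simp: distributed_def normal_density_def intro!: distr_id2)
  then have "distributed gauss lborel (\<lambda>x. \<mu> + \<sigma> * x) (normal_density (\<mu> + \<sigma> * 0) (\<bar>\<sigma>\<bar> * 1))"
    using \<sigma> by (intro gauss.normal_density_affine) auto
  then show ?thesis
    using \<sigma> by (simp add: distributed_def)
qed

lemma nn_integral_normal_density:
  assumes \<sigma>: "\<sigma> > 0" and [measurable]: "F \<in> borel_measurable borel"
  shows "(\<integral>\<^sup>+r. ennreal (normal_density \<mu> \<sigma> r) * F r \<partial>lborel) = (\<integral>\<^sup>+u. F (\<mu> + \<sigma> * u) \<partial>gauss)"
proof -
  have "(\<integral>\<^sup>+r. F r \<partial>density lborel (normal_density \<mu> \<sigma>)) = (\<integral>\<^sup>+r. F r \<partial>distr gauss lborel (\<lambda>x. \<mu> + \<sigma> * x))"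
    by (simp only: distr_gauss_affine[OF \<sigma>])
  then show ?thesis
    by (simp add: nn_integral_density nn_integral_distr)
qed

section \<open>The conditional law of the first spin as a Gaussian mixture\<close>

locale mean_field =
  fixes V :: "real \<Rightarrow> real" and t :: real
  assumes V_cont: "continuous_on UNIV V" and V_nonneg: "V x \<ge> 0" and t_pos: "t > 0"
begin

lemma V_measurable [measurable]: "V \<in> borel_measurable borel"
  using V_cont by (rule borel_measurable_continuous_onI)

text \<open>Integrating out the first spin by \<open>normal_density_product\<close>, the magnetisation at time 0 becomes
  normally distributed with mean \<open>loc n \<beta>\<close> and standard deviation \<open>scl n\<close>, up to the factor
  \<open>exp (- n * V)\<close>; if it equals \<open>r\<close>, the first spin has mean \<open>slope n * (r - loc n \<beta>)\<close> and standard
  deviation \<open>sdev n\<close>.\<close>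

definition loc :: "nat \<Rightarrow> real \<Rightarrow> real" where
  "loc n \<beta> = (real n - 1) * \<beta> / (real n * (1 + t))"

definition scl :: "nat \<Rightarrow> real" where
  "scl n = sqrt ((1 + real n * t) / ((real n)\<^sup>2 * (1 + t)))"

definition slope :: "nat \<Rightarrow> real" where
  "slope n = real n * (1 + t) / (1 + real n * t)"

definition sdev :: "nat \<Rightarrow> real" where
  "sdev n = sqrt ((1 + t) * real n * t / (1 + real n * t))"

definition weight :: "nat \<Rightarrow> real \<Rightarrow> real \<Rightarrow> real" where
  "weight n \<beta> u = exp (- real n * V (loc n \<beta> + scl n * u))"

definition mass :: "nat \<Rightarrow> real \<Rightarrow> real" where
  "mass n \<beta> = (\<integral>u. weight n \<beta> u \<partial>gauss)"

abbreviation spin_coord :: "nat \<Rightarrow> real \<times> real \<Rightarrow> real" where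
  "spin_coord n p \<equiv> slope n * (scl n * fst p) + sdev n * snd p"

text \<open>The first coordinate \<open>u\<close> of \<open>p\<close> encodes the magnetisation \<open>loc n \<beta> + scl n * u\<close> at time 0.\<close>

definition spin_law :: "nat \<Rightarrow> real \<Rightarrow> real measure" where
  "spin_law n \<beta> = distr (density (gauss \<Otimes>\<^sub>M gauss) (\<lambda>p. ennreal (weight n \<beta> (fst p) / mass n \<beta>))) borel
     (\<lambda>p. spin_coord n p)"

lemma weight_measurable [measurable]:
  "(\<lambda>p. weight n (f p) (g p)) \<in> borel_measurable M" if [measurable]: "f \<in> borel_measurable M" "g \<in> borel_measurable M"
  unfolding weight_def loc_def by measurable

lemma weight_bounds: "0 < weight n \<beta> u" "weight n \<beta> u \<le> 1"
  unfolding weight_def using V_nonneg by auto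

lemma weight_integrable: "integrable gauss (weight n \<beta>)"
  by (rule gauss.integrable_const_bound[of _ 1]) (use weight_bounds less_imp_le in \<open>auto simp: abs_of_pos\<close>)

lemma mass_bounds: "0 < mass n \<beta>" "mass n \<beta> \<le> 1"
proof -
  have "mass n \<beta> \<le> (\<integral>u. 1 \<partial>gauss)"
    unfolding mass_def using weight_bounds by (intro integral_mono weight_integrable) auto
  then show "mass n \<beta> \<le> 1" by (simp)
  have "(\<integral>u. 0 \<partial>gauss) < mass n \<beta>"
    unfolding mass_def
    by (rule gauss.integral_less_AE_space) (use weight_bounds in \<open>auto intro: weight_integrable simp: gauss.emeasure_space_1\<close>)
  then show "0 < mass n \<beta>" by simp
qed

lemma nn_integral_weight: "(\<integral>\<^sup>+u. ennreal (weight n \<beta> u) \<partial>gauss) = ennreal (mass n \<beta>)"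
  unfolding mass_def
  by (intro nn_integral_eq_integral weight_integrable) (auto intro: less_imp_le[OF weight_bounds(1)])

lemma sets_spin_law [simp, measurable_cong]: "sets (spin_law n \<beta>) = sets borel"
  by (simp add: spin_law_def)

text \<open>Multiplication by the mass avoids a quotient of extended nonnegative numbers and matches
  the factor left over when the first spin is integrated out.\<close>

lemma nn_integral_spin_law:
  assumes [measurable]: "F \<in> borel_measurable borel"
  shows "ennreal (mass n \<beta>) * (\<integral>\<^sup>+a. F a \<partial>spin_law n \<beta>) =
    (\<integral>\<^sup>+u. ennreal (weight n \<beta> u) * (\<integral>\<^sup>+x. F (slope n * (scl n * u) + sdev n * x) \<partial>gauss) \<partial>gauss)"
proof -
  have "ennreal (mass n \<beta>) * (\<integral>\<^sup>+a. F a \<partial>spin_law n \<beta>) =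
      (\<integral>\<^sup>+p. ennreal (mass n \<beta>) * (ennreal (weight n \<beta> (fst p) / mass n \<beta>) *
        F (spin_coord n p)) \<partial>(gauss \<Otimes>\<^sub>M gauss))"
    unfolding spin_law_def
    by (simp add: nn_integral_distr nn_integral_density nn_integral_cmult)
  also have "\<dots> = (\<integral>\<^sup>+p. ennreal (weight n \<beta> (fst p)) *
        F (spin_coord n p) \<partial>(gauss \<Otimes>\<^sub>M gauss))"
  proof (rule nn_integral_cong)
    fix p :: "real \<times> real"
    have "ennreal (mass n \<beta>) * ennreal (weight n \<beta> (fst p) / mass n \<beta>) = ennreal (weight n \<beta> (fst p))"
      using mass_bounds(1)[of n \<beta>] weight_bounds(1)[of n \<beta> "fst p"]
      by (subst ennreal_mult[symmetric]) auto
    then show "ennreal (mass n \<beta>) * (ennreal (weight n \<beta> (fst p) / mass n \<beta>) *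
        F (spin_coord n p)) =
      ennreal (weight n \<beta> (fst p)) * F (spin_coord n p)"
      by (simp add: mult.assoc[symmetric])
  qed
  also have "\<dots> = (\<integral>\<^sup>+u. (\<integral>\<^sup>+x. ennreal (weight n \<beta> u) * F (slope n * (scl n * u) + sdev n * x) \<partial>gauss) \<partial>gauss)"
    by (subst gauss.nn_integral_fst[symmetric]) auto
  also have "\<dots> = (\<integral>\<^sup>+u. ennreal (weight n \<beta> u) * (\<integral>\<^sup>+x. F (slope n * (scl n * u) + sdev n * x) \<partial>gauss) \<partial>gauss)"
    by (intro nn_integral_cong nn_integral_cmult) measurable
  finally show ?thesis .
qed

lemma prob_space_spin_law: "prob_space (spin_law n \<beta>)"
proof
  have "ennreal (mass n \<beta>) * emeasure (spin_law n \<beta>) (space (spin_law n \<beta>)) = ennreal (mass n \<beta>) * 1"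
    using nn_integral_spin_law[of "\<lambda>_. 1" n \<beta>] by (simp add: nn_integral_weight gauss.emeasure_space_1)
  then show "emeasure (spin_law n \<beta>) (space (spin_law n \<beta>)) = 1"
    using mass_bounds(1)[of n \<beta>] by (subst (asm) ennreal_mult_cancel_left) auto
qed

text \<open>Bayes' formula with the evolved first spin a, of variance \<open>1 + t\<close>, as the
  unknown and the initial magnetisation r as the observation. Given a, the mean of r is affine in a
  with coefficient \<open>1 / (n * (1 + t))\<close>.\<close>

lemma first_spin_density:
  assumes n: "n > 0"
  shows "normal_density 0 (sqrt (1 + t)) a *
      normal_density ((a + (real n - 1) * \<beta>) / real n / (1 + t)) (sqrt (t / (1 + t) / real n)) r =
    normal_density (loc n \<beta>) (scl n) r * normal_density (slope n * (r - loc n \<beta>)) (sdev n) a"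
proof -
  define c where "c = 1 / (real n * (1 + t))"
  define A where "A = sqrt (1 + t)"
  define B where "B = sqrt (t / (1 + t) / real n)"
  define S where "S = (1 + real n * t) / ((real n)\<^sup>2 * (1 + t))"
  have pos: "A > 0" "B > 0" "S > 0" "1 + t > 0" "1 + real n * t > 0"
    using n t_pos by (auto simp: A_def B_def S_def add_pos_nonneg intro!: divide_pos_pos mult_pos_pos)
  have sq: "A\<^sup>2 = 1 + t" "B\<^sup>2 = t / (1 + t) / real n"
    using t_pos n by (auto simp: A_def B_def)
  \<comment> \<open>The letters q, N and w stand for \<open>1 + t\<close>, n and
    \<open>1 + n * t\<close>; keeping these sums atomic makes the identities easy to clear of
    denominators.\<close>
  have alg: "(1 + N * t) / (N\<^sup>2 * q) = q * (1 / (N * q))\<^sup>2 + t / q / N"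
    "(a + (N - 1) * \<beta>) / N / q = 1 / (N * q) * a + (N - 1) * \<beta> / (N * q)"
    "z * (1 / (N * q)) * q / (w / (N\<^sup>2 * q)) = N * q / w * z"
    "q * (t / q / N) / (w / (N\<^sup>2 * q)) = q * N * t / w"
    if "q > 0" "N > 0" "w > 0" for q N w z :: real
    using that by (simp_all add: field_simps power2_eq_square)
  have N: "real n > 0" using n by simp
  have S: "S = A\<^sup>2 * c\<^sup>2 + B\<^sup>2"
    unfolding sq c_def S_def by (rule alg(1)[OF pos(4) N pos(5)])
  have m: "(a + (real n - 1) * \<beta>) / real n / (1 + t) = c * a + loc n \<beta>"
    unfolding c_def loc_def by (rule alg(2)[OF pos(4) N pos(5)])
  have s: "(r - loc n \<beta>) * c * A\<^sup>2 / S = slope n * (r - loc n \<beta>)"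
    unfolding sq c_def S_def slope_def by (rule alg(3)[OF pos(4) N pos(5)])
  have "A * B / sqrt S = sqrt ((1 + t) * (t / (1 + t) / real n) / S)"
    by (simp add: A_def B_def real_sqrt_mult real_sqrt_divide)
  also have "(1 + t) * (t / (1 + t) / real n) / S = (1 + t) * real n * t / (1 + real n * t)"
    unfolding S_def by (rule alg(4)[OF pos(4) N pos(5)])
  finally have d: "A * B / sqrt S = sdev n" by (simp add: sdev_def)
  have scl: "scl n = sqrt S" by (simp add: scl_def S_def)
  show ?thesis
    using normal_density_product[OF pos(1,2) S, of a "loc n \<beta>" r] unfolding m s d scl
    by (simp add: A_def B_def)
qed

lemma scl_pos: "n > 0 \<Longrightarrow> scl n > 0" and sdev_pos: "n > 0 \<Longrightarrow> sdev n > 0"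
  using t_pos by (auto simp: scl_def sdev_def add_pos_nonneg intro!: divide_pos_pos mult_pos_pos)

text \<open>After Bayes' formula the order of integration is exchanged, so that the first spin is
  averaged for a fixed initial magnetisation. Rescaling that magnetisation to a standard normal
  variable produces \<open>weight\<close>.\<close>

lemma nn_integral_first_spin:
  assumes [measurable]: "F \<in> borel_measurable borel" and n: "n > 0"
  shows "(\<integral>\<^sup>+a. ennreal (normal_density 0 (sqrt (1 + t)) a) *
      smoothed_weight V t n ((a + (real n - 1) * \<beta>) / real n) * F a \<partial>lborel) =
    ennreal (mass n \<beta>) * (\<integral>\<^sup>+a. F a \<partial>spin_law n \<beta>)"
proof -
  let ?e = "\<lambda>r. ennreal (exp (- real n * V r))"
  let ?N = "\<lambda>a r. normal_density ((a + (real n - 1) * \<beta>) / real n / (1 + t)) (sqrt (t / (1 + t) / real n)) r"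
  have [measurable]: "(\<lambda>p. normal_density (slope n * (fst p - loc n \<beta>)) (sdev n) (snd p)) \<in> borel_measurable (borel \<Otimes>\<^sub>M borel)"
    "(\<lambda>a. ?N a r) \<in> borel_measurable borel" "(\<lambda>p. ?N (fst p) (snd p)) \<in> borel_measurable (borel \<Otimes>\<^sub>M borel)" for r
    unfolding normal_density_def by measurable
  have "(\<integral>\<^sup>+a. ennreal (normal_density 0 (sqrt (1 + t)) a) *
      smoothed_weight V t n ((a + (real n - 1) * \<beta>) / real n) * F a \<partial>lborel) =
    (\<integral>\<^sup>+a. (\<integral>\<^sup>+r. ennreal (normal_density 0 (sqrt (1 + t)) a) * F a * ennreal (exp (- real n * V r) * ?N a r) \<partial>lborel) \<partial>lborel)"
    unfolding smoothed_weight_def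
    by (intro nn_integral_cong, subst nn_integral_cmult) (auto simp: mult_ac)
  also have "\<dots> = (\<integral>\<^sup>+a. (\<integral>\<^sup>+r. ennreal (normal_density (loc n \<beta>) (scl n) r) *
      (?e r * (ennreal (normal_density (slope n * (r - loc n \<beta>)) (sdev n) a) * F a)) \<partial>lborel) \<partial>lborel)"
  proof (intro nn_integral_cong)
    fix a r
    have "ennreal (normal_density 0 (sqrt (1 + t)) a) * F a * ennreal (exp (- real n * V r) * ?N a r) =
        ennreal (normal_density 0 (sqrt (1 + t)) a * ?N a r) * (?e r * F a)"
      by (simp add: ennreal_mult mult_ac)
    also have "\<dots> = ennreal (normal_density (loc n \<beta>) (scl n) r * normal_density (slope n * (r - loc n \<beta>)) (sdev n) a) * (?e r * F a)"
      by (simp only: first_spin_density[OF n])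
    finally show "ennreal (normal_density 0 (sqrt (1 + t)) a) * F a * ennreal (exp (- real n * V r) * ?N a r) =
      ennreal (normal_density (loc n \<beta>) (scl n) r) *
      (?e r * (ennreal (normal_density (slope n * (r - loc n \<beta>)) (sdev n) a) * F a))"
      by (simp add: ennreal_mult mult_ac)
  qed
  also have "\<dots> = (\<integral>\<^sup>+r. (\<integral>\<^sup>+a. ennreal (normal_density (loc n \<beta>) (scl n) r) *
      (?e r * (ennreal (normal_density (slope n * (r - loc n \<beta>)) (sdev n) a) * F a)) \<partial>lborel) \<partial>lborel)"
    by (rule lborel_pair.Fubini') measurable
  also have "\<dots> = (\<integral>\<^sup>+r. ennreal (normal_density (loc n \<beta>) (scl n) r) *
      (?e r * (\<integral>\<^sup>+x. F (slope n * (r - loc n \<beta>) + sdev n * x) \<partial>gauss)) \<partial>lborel)"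
    using sdev_pos[OF n] by (intro nn_integral_cong) (simp add: nn_integral_cmult nn_integral_normal_density)
  also have "\<dots> = (\<integral>\<^sup>+u. ?e (loc n \<beta> + scl n * u) *
      (\<integral>\<^sup>+x. F (slope n * (loc n \<beta> + scl n * u - loc n \<beta>) + sdev n * x) \<partial>gauss) \<partial>gauss)"
    using scl_pos[OF n] by (intro nn_integral_normal_density) auto
  also have "\<dots> = ennreal (mass n \<beta>) * (\<integral>\<^sup>+a. F a \<partial>spin_law n \<beta>)"
    unfolding nn_integral_spin_law[OF assms(1)] weight_def by simp
  finally show ?thesis .
qed

text \<open>The Lebesgue density of the remaining k spins; the mass is what integrating out the
  first of \<open>Suc k\<close> spins leaves behind.\<close>

definition others_weight :: "nat \<Rightarrow> (nat \<Rightarrow> real) \<Rightarrow> ennreal" where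
  "others_weight k y = ennreal (\<Prod>i<k. normal_density 0 (sqrt (1 + t)) (y i)) *
     ennreal (mass (Suc k) (magnetisation k y)) / normalising_const V (Suc k)"

lemma weight_tendsto:
  assumes "b \<longlonglongrightarrow> \<beta>" shows "(\<lambda>i. weight n (b i) u) \<longlonglongrightarrow> weight n \<beta> u"
proof -
  have "(\<lambda>i. loc n (b i) + scl n * u) \<longlonglongrightarrow> loc n \<beta> + scl n * u"
    unfolding loc_def divide_inverse by (intro tendsto_intros assms)
  then have "(\<lambda>i. V (loc n (b i) + scl n * u)) \<longlonglongrightarrow> V (loc n \<beta> + scl n * u)"
    using V_cont by (intro isCont_tendsto_compose[of _ V]) (auto simp: continuous_on_eq_continuous_at)
  then show ?thesis unfolding weight_def by (intro tendsto_intros)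
qed

lemma mass_continuous: "continuous_on UNIV (mass n)"
proof (intro continuous_at_imp_continuous_on ballI)
  fix \<beta> :: real
  show "isCont (mass n) \<beta>"
    unfolding continuous_at_sequentially comp_def
  proof (intro allI impI)
    fix b assume b: "b \<longlonglongrightarrow> \<beta>"
    show "(\<lambda>i. mass n (b i)) \<longlonglongrightarrow> mass n \<beta>"
      unfolding mass_def
    proof (rule integral_dominated_convergence[where w = "\<lambda>_. 1"])
      show "AE u in gauss. (\<lambda>i. weight n (b i) u) \<longlonglongrightarrow> weight n \<beta> u"
        by (intro always_eventually allI weight_tendsto b)
    qed (use weight_bounds less_imp_le in \<open>auto simp: abs_of_pos\<close>)
  qed
qed

lemma mass_measurable [measurable]: "mass n \<in> borel_measurable borel"
  by (rule borel_measurable_continuous_onI[OF mass_continuous])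

lemma others_weight_measurable [measurable]: "others_weight k \<in> borel_measurable (borel_space k)"
  unfolding others_weight_def normal_density_def by measurable

lemma spin_law_measurable: "spin_law n \<in> measurable borel (subprob_algebra borel)"
proof (rule measurable_subprob_algebra)
  fix A :: "real set" assume [measurable]: "A \<in> sets borel"
  have "emeasure (spin_law n \<beta>) A = (\<integral>\<^sup>+p. ennreal (weight n \<beta> (fst p) / mass n \<beta>) *
      indicator A (spin_coord n p) \<partial>(gauss \<Otimes>\<^sub>M gauss))" for \<beta>
  proof -
    have "emeasure (spin_law n \<beta>) A = (\<integral>\<^sup>+a. indicator A a \<partial>spin_law n \<beta>)" by simp
    also have "\<dots> = (\<integral>\<^sup>+p. ennreal (weight n \<beta> (fst p) / mass n \<beta>) *
      indicator A (spin_coord n p) \<partial>(gauss \<Otimes>\<^sub>M gauss))"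
      unfolding spin_law_def
      by (subst nn_integral_distr, measurable, subst nn_integral_density) auto
    finally show ?thesis .
  qed
  then show "(\<lambda>\<beta>. emeasure (spin_law n \<beta>) A) \<in> borel_measurable borel"
    by simp
qed (auto intro: prob_space_imp_subprob_space prob_space_spin_law)

text \<open>The disintegration formula in terms of densities. With A the whole line it yields the
  law of the other spins, and relative to that law it says that \<open>spin_law\<close> is a
  conditional probability.\<close>

lemma time_evolved_rectangle:
  assumes A[measurable]: "A \<in> sets borel" and B[measurable]: "B \<in> sets (borel_space k)"
  shows "emeasure (time_evolved V t (Suc k)) {x \<in> space (borel_space (Suc k)). x 0 \<in> A \<and> other_spins (Suc k) x \<in> B} =
    (\<integral>\<^sup>+y. others_weight k y * (indicator B y * emeasure (spin_law (Suc k) (magnetisation k y)) A) \<partial>lebesgue_space k)"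
proof -
  let ?n = "Suc k" and ?Z = "normalising_const V (Suc k)"
  let ?R = "{x \<in> space (borel_space ?n). x 0 \<in> A \<and> other_spins ?n x \<in> B}"
  let ?inner = "\<lambda>y. \<integral>\<^sup>+a. ennreal (\<Prod>i<?n. normal_density 0 (sqrt (1 + t)) (cons_spin k (a, y) i)) *
      smoothed_weight V t ?n (magnetisation ?n (cons_spin k (a, y))) / ?Z * indicator ?R (cons_spin k (a, y)) \<partial>lborel"
  let ?g = "\<lambda>a. ennreal (normal_density 0 (sqrt (1 + t)) a)"
  let ?p = "\<lambda>y. ennreal (\<Prod>i<k. normal_density 0 (sqrt (1 + t)) (y i))"
  have [measurable]: "(\<lambda>x. x 0) \<in> borel_measurable (borel_space ?n)"
    by (rule measurable_component_singleton) simp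
  have R[measurable]: "?R \<in> sets (borel_space ?n)" by measurable
  have [measurable]: "(\<lambda>x. ennreal (\<Prod>i<?n. normal_density 0 (sqrt (1 + t)) (x i))) \<in> borel_measurable (borel_space ?n)"
    unfolding normal_density_def by measurable
  have "emeasure (time_evolved V t ?n) ?R = (\<integral>\<^sup>+x. ennreal (\<Prod>i<?n. normal_density 0 (sqrt (1 + t)) (x i)) *
      smoothed_weight V t ?n (magnetisation ?n x) / ?Z * indicator ?R x \<partial>lebesgue_space ?n)"
    unfolding time_evolved_eq_density[OF V_measurable t_pos zero_less_Suc]
  proof (rule emeasure_density)
    show "?R \<in> sets (lebesgue_space ?n)" using R by simp
  qed measurable
  also have "\<dots> = (\<integral>\<^sup>+y. ?inner y \<partial>lebesgue_space k)"
    by (rule nn_integral_cons_spin) measurable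
  also have "\<dots> = (\<integral>\<^sup>+y. others_weight k y * (indicator B y * emeasure (spin_law ?n (magnetisation k y)) A) \<partial>lebesgue_space k)"
  proof (rule nn_integral_cong)
    fix y assume "y \<in> space (lebesgue_space k)"
    then have y: "y \<in> space (borel_space k)" by simp
    have ind: "indicator ?R (cons_spin k (a, y)) = (indicator A a * indicator B y :: ennreal)" for a
    proof -
      have "cons_spin k (a, y) \<in> space (borel_space ?n)"
        using measurable_space[OF measurable_cons_spin, of "(a, y)"] y by (auto simp: space_pair_measure)
      then show ?thesis
        using other_spins_cons_spin[OF y] by (auto simp: cons_spin_0 indicator_def)
    qed
    have "?inner y =
      (\<integral>\<^sup>+a. (?p y * indicator B y / ?Z) * (?g a * smoothed_weight V t ?n ((a + (real ?n - 1) * magnetisation k y) / real ?n) * indicator A a) \<partial>lborel)"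
      unfolding ind prod_cons_spin magnetisation_cons_spin
      by (intro nn_integral_cong) (simp add: ennreal_mult prod_nonneg divide_ennreal_def mult_ac)
    also have "\<dots> = (?p y * indicator B y / ?Z) * (ennreal (mass ?n (magnetisation k y)) * (\<integral>\<^sup>+a. indicator A a \<partial>spin_law ?n (magnetisation k y)))"
      by (subst nn_integral_first_spin[symmetric]) (auto intro!: nn_integral_cmult)
    finally show "?inner y =
      others_weight k y * (indicator B y * emeasure (spin_law ?n (magnetisation k y)) A)"
      by (simp add: others_weight_def divide_ennreal_def mult_ac)
  qed
  finally show ?thesis .
qed

lemma others_law_time_evolved: "others_law (Suc k) (time_evolved V t (Suc k)) = density (lebesgue_space k) (others_weight k)"
proof (rule measure_eqI)
  show "sets (others_law (Suc k) (time_evolved V t (Suc k))) = sets (density (lebesgue_space k) (others_weight k))"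
    by (simp add: others_law_def)
  fix B assume "B \<in> sets (others_law (Suc k) (time_evolved V t (Suc k)))"
  then have B[measurable]: "B \<in> sets (borel_space k)" by (simp add: others_law_def)
  have sets: "sets (time_evolved V t (Suc k)) = sets (borel_space (Suc k))"
    by (simp add: time_evolved_def)
  have "emeasure (others_law (Suc k) (time_evolved V t (Suc k))) B =
      emeasure (time_evolved V t (Suc k)) {x \<in> space (borel_space (Suc k)). x 0 \<in> UNIV \<and> other_spins (Suc k) x \<in> B}"
    unfolding others_law_def using sets_eq_imp_space_eq[OF sets]
    by (subst emeasure_distr) (auto simp: measurable_cong_sets[OF sets refl] intro!: arg_cong2[where f = emeasure])
  also have "\<dots> = (\<integral>\<^sup>+y. others_weight k y * (indicator B y * emeasure (spin_law (Suc k) (magnetisation k y)) UNIV) \<partial>lebesgue_space k)"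
    by (rule time_evolved_rectangle) auto
  also have "\<dots> = (\<integral>\<^sup>+y. others_weight k y * indicator B y \<partial>lebesgue_space k)"
  proof -
    have "emeasure (spin_law (Suc k) \<beta>) UNIV = 1" for \<beta>
      using prob_space.emeasure_space_1[OF prob_space_spin_law[of "Suc k" \<beta>]]
      by (simp add: sets_eq_imp_space_eq[OF sets_spin_law])
    then show ?thesis by simp
  qed
  also have "\<dots> = emeasure (density (lebesgue_space k) (others_weight k)) B"
    by (rule emeasure_density[symmetric]) auto
  finally show "emeasure (others_law (Suc k) (time_evolved V t (Suc k))) B = emeasure (density (lebesgue_space k) (others_weight k)) B" .
qed

lemma regular_cond_prob_spin_law:
  "regular_cond_prob (Suc k) (time_evolved V t (Suc k)) (\<lambda>y. spin_law (Suc k) (magnetisation k y))"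
  unfolding regular_cond_prob_def others_law_time_evolved diff_Suc_1
proof (intro conjI ballI)
  show m: "(\<lambda>y. spin_law (Suc k) (magnetisation k y)) \<in> borel_space k \<rightarrow>\<^sub>M subprob_algebra borel"
    by (rule measurable_compose[OF borel_measurable_magnetisation spin_law_measurable])
  fix A :: "real set" and B assume A[measurable]: "A \<in> sets borel" and B[measurable]: "B \<in> sets (borel_space k)"
  have [measurable]: "(\<lambda>y. emeasure (spin_law (Suc k) (magnetisation k y)) A) \<in> borel_measurable (borel_space k)"
    by (rule measurable_emeasure_kernel[OF m A])
  show "emeasure (time_evolved V t (Suc k)) {x \<in> space (borel_space (Suc k)). x 0 \<in> A \<and> other_spins (Suc k) x \<in> B} =
    (\<integral>\<^sup>+y. indicator B y * emeasure (spin_law (Suc k) (magnetisation k y)) A \<partial>density (lebesgue_space k) (others_weight k))"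
    unfolding time_evolved_rectangle[OF A B] by (rule nn_integral_density[symmetric]) auto
qed

end

section \<open>Uniqueness of weakly continuous kernels\<close>

lemma topspace_euclid: "topspace (euclid k) = space (borel_space k)"
  by (simp add: space_PiM)

lemma rational_interval_in_open:
  fixes S :: "real set"
  assumes "open S" "x \<in> S"
  shows "\<exists>a\<in>\<rat>. \<exists>b\<in>\<rat>. a < x \<and> x < b \<and> {a<..<b} \<subseteq> S"
proof -
  obtain e where e: "e > 0" "ball x e \<subseteq> S" using assms open_contains_ball by blast
  obtain a b where "a \<in> \<rat>" "x - e < a" "a < x" "b \<in> \<rat>" "x < b" "b < x + e"
    using Rats_dense_in_real[of "x - e" x] Rats_dense_in_real[of x "x + e"] e(1) by auto
  moreover from this have "{a<..<b} \<subseteq> ball x e" by (auto simp: dist_real_def)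
  ultimately show ?thesis using e(2) by blast
qed

text \<open>Rational end points leave only countably many boxes, so an open set is a countable union
  of boxes and thus Borel; a single box inside it gives positive Lebesgue measure.\<close>

lemma openin_euclid_box:
  assumes U: "openin (euclid k) U" and y: "y \<in> U"
  shows "\<exists>q \<in> Pi\<^sub>E {..<k} (\<lambda>_. \<rat> \<times> \<rat>). y \<in> Pi\<^sub>E {..<k} (\<lambda>i. {fst (q i)<..<snd (q i)}) \<and>
    Pi\<^sub>E {..<k} (\<lambda>i. {fst (q i)<..<snd (q i)}) \<subseteq> U"
proof -
  from U[unfolded openin_product_topology_alt, rule_format, OF y]
  obtain W where openin_W: "\<forall>i\<in>{..<k}. openin euclideanreal (W i)"
    and W: "y \<in> Pi\<^sub>E {..<k} W" "Pi\<^sub>E {..<k} W \<subseteq> U"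
    by (elim exE conjE)
  have open_W: "open (W i)" if "i < k" for i
    by (rule open_openin[THEN iffD2]) (use openin_W that in blast)
  have "\<exists>p\<in>\<rat> \<times> \<rat>. fst p < y i \<and> y i < snd p \<and> {fst p<..<snd p} \<subseteq> W i" if "i < k" for i
  proof -
    have "y i \<in> W i" by (rule PiE_mem[OF W(1)]) (simp add: that)
    from rational_interval_in_open[OF open_W[OF that] this] obtain a b where
      "a \<in> \<rat>" "b \<in> \<rat>" "a < y i" "y i < b" "{a<..<b} \<subseteq> W i"
      by (elim bexE conjE)
    then show ?thesis by (intro bexI[of _ "(a, b)"]) auto
  qed
  then obtain p where p: "\<And>i. i < k \<Longrightarrow> p i \<in> \<rat> \<times> \<rat> \<and> fst (p i) < y i \<and> y i < snd (p i) \<and> {fst (p i)<..<snd (p i)} \<subseteq> W i"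
    by metis
  let ?q = "restrict p {..<k}"
  have "?q \<in> Pi\<^sub>E {..<k} (\<lambda>_. \<rat> \<times> \<rat>)" using p by (auto simp: PiE_iff)
  moreover have "y \<in> Pi\<^sub>E {..<k} (\<lambda>i. {fst (?q i)<..<snd (?q i)})"
    using p W(1) by (auto simp: PiE_iff)
  moreover have "Pi\<^sub>E {..<k} (\<lambda>i. {fst (?q i)<..<snd (?q i)}) \<subseteq> Pi\<^sub>E {..<k} W"
    using p by (intro PiE_mono) auto
  ultimately show ?thesis using W(2) by (intro bexI[of _ ?q] conjI) (assumption | rule order_trans)+
qed

lemma box_in_sets: "Pi\<^sub>E {..<k} (\<lambda>i. {fst (q i)<..<snd (q i)::real}) \<in> sets (borel_space k)"
  by (intro sets_PiM_I_finite) auto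

lemma openin_euclid_imp_sets:
  assumes U: "openin (euclid k) U" shows "U \<in> sets (borel_space k)"
proof -
  let ?box = "\<lambda>q. Pi\<^sub>E {..<k} (\<lambda>i. {fst (q i)<..<snd (q i)::real})"
  define Q where "Q = {q \<in> Pi\<^sub>E {..<k} (\<lambda>_. \<rat> \<times> \<rat>). ?box q \<subseteq> U}"
  have "countable (Pi\<^sub>E {..<k} (\<lambda>_. \<rat> \<times> \<rat> :: (real \<times> real) set))"
    by (intro countable_PiE countable_SIGMA countable_rat) auto
  then have "countable Q" by (rule countable_subset[rotated]) (auto simp: Q_def)
  moreover have "U = (\<Union>q\<in>Q. ?box q)"
  proof (intro equalityI subsetI)
    fix y assume "y \<in> U"
    from openin_euclid_box[OF U this] show "y \<in> (\<Union>q\<in>Q. ?box q)" unfolding Q_def by auto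
  qed (auto simp: Q_def)
  ultimately show ?thesis
    using box_in_sets by (metis (no_types, lifting) sets.countable_UN'')
qed

lemma openin_euclid_emeasure_pos:
  assumes U: "openin (euclid k) U" and ne: "U \<noteq> {}"
  shows "emeasure (lebesgue_space k) U > 0"
proof -
  obtain y where "y \<in> U" using ne by blast
  from openin_euclid_box[OF U this] obtain q where
    q: "y \<in> Pi\<^sub>E {..<k} (\<lambda>i. {fst (q i)<..<snd (q i)})" "Pi\<^sub>E {..<k} (\<lambda>i. {fst (q i)<..<snd (q i)}) \<subseteq> U" by blast
  have less: "fst (q i) < snd (q i)" if "i < k" for i
    using q(1) that by (force simp: PiE_iff)
  have "emeasure (lebesgue_space k) (Pi\<^sub>E {..<k} (\<lambda>i. {fst (q i)<..<snd (q i)})) = (\<Prod>i<k. emeasure lborel {fst (q i)<..<snd (q i)})"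
    by (intro lborel_prod.emeasure_PiM) auto
  also have "\<dots> = (\<Prod>i<k. ennreal (snd (q i) - fst (q i)))"
    using less by (intro prod.cong) (auto intro!: emeasure_lborel_Ioo less_imp_le)
  also have "\<dots> = ennreal (\<Prod>i<k. snd (q i) - fst (q i))"
    using less by (intro prod_ennreal) (auto intro: less_imp_le)
  also have "\<dots> > 0" using less by (auto intro!: prod_pos)
  also have "emeasure (lebesgue_space k) (Pi\<^sub>E {..<k} (\<lambda>i. {fst (q i)<..<snd (q i)})) \<le> emeasure (lebesgue_space k) U"
    using openin_euclid_imp_sets[OF U] q(2) by (intro emeasure_mono) simp_all
  finally show ?thesis .
qed

text \<open>Two kernels that disintegrate the same measure average every test function in the same way over
  every Borel set of conditions; a strict inequality would persist on an open set, which has positive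
  measure.\<close>

lemma regular_cond_prob_integral_le:
  fixes f :: "real \<Rightarrow> real"
  assumes rcp: "regular_cond_prob n \<rho> \<gamma>1" "regular_cond_prob n \<rho> \<gamma>2"
    and cont: "weakly_continuous_kernel (euclid (n - 1)) \<gamma>1" "weakly_continuous_kernel (euclid (n - 1)) \<gamma>2"
    and full: "\<And>U. openin (euclid (n - 1)) U \<Longrightarrow> U \<noteq> {} \<Longrightarrow> emeasure (others_law n \<rho>) U > 0"
    and fin: "finite_measure (others_law n \<rho>)"
    and f: "continuous_on UNIV f" "\<And>x. 0 \<le> f x" "\<And>x. f x \<le> C"
    and y: "y \<in> space (borel_space (n - 1))"
  shows "(\<integral>x. f x \<partial>\<gamma>1 y) \<le> (\<integral>x. f x \<partial>\<gamma>2 y)"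
proof (rule ccontr)
  let ?S = "borel_space (n - 1)" and ?M = "others_law n \<rho>"
  assume less: "\<not> (\<integral>x. f x \<partial>\<gamma>1 y) \<le> (\<integral>x. f x \<partial>\<gamma>2 y)"
  have [measurable_cong]: "sets ?M = sets ?S" and space_M: "space ?M = space ?S"
    by (simp_all add: others_law_def)
  note m1[measurable] = rcp(1)[unfolded regular_cond_prob_def, THEN conjunct1]
  note m2[measurable] = rcp(2)[unfolded regular_cond_prob_def, THEN conjunct1]
  have [measurable]: "f \<in> borel_measurable borel" using f(1) by (rule borel_measurable_continuous_onI)
  define u1 u2 where "u1 = (\<lambda>y. \<integral>x. f x \<partial>\<gamma>1 y)" and "u2 = (\<lambda>y. \<integral>x. f x \<partial>\<gamma>2 y)"
  have bdd: "bounded (range f)"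
    using f(2,3) by (intro boundedI[of _ C]) auto
  have u_cont: "continuous_map (euclid (n - 1)) euclideanreal u1" "continuous_map (euclid (n - 1)) euclideanreal u2"
    using cont f(1) bdd unfolding weakly_continuous_kernel_def u1_def u2_def by blast+
  \<comment> \<open>Continuity of both averages makes the set where the inequality fails
    open.\<close>
  define B where "B = {y \<in> topspace (euclid (n - 1)). u1 y - u2 y \<in> {0<..}}"
  have B_open: "openin (euclid (n - 1)) B"
    unfolding B_def by (rule openin_continuous_map_preimage[OF continuous_map_diff[OF u_cont]]) simp
  have [measurable]: "B \<in> sets ?S" using B_open by (rule openin_euclid_imp_sets)
  have "y \<in> B" using y less unfolding B_def topspace_euclid u1_def u2_def by simp
  then have B_pos: "emeasure ?M B > 0" using full[OF B_open] by blast
  have nn: "(\<integral>\<^sup>+x. ennreal (f x) \<partial>\<gamma> y) = ennreal (\<integral>x. f x \<partial>\<gamma> y)"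
    if "\<gamma> \<in> measurable ?S (subprob_algebra borel)" "y \<in> space ?S" for \<gamma> y
  proof -
    interpret subprob_space "\<gamma> y" using that by (rule subprob_space_kernel)
    have "sets (\<gamma> y) = sets borel" using that by (rule sets_kernel)
    then have [measurable]: "f \<in> borel_measurable (\<gamma> y)" by (simp cong: measurable_cong_sets)
    show ?thesis
      using f(2,3) by (intro nn_integral_eq_integral integrable_const_bound[of _ C]) auto
  qed
  \<comment> \<open>Restricting the conditions to B and composing with a kernel gives a measure on
    the line. The disintegration formula makes the two compositions equal on Borel sets, and this
    carries over to the integrand f.\<close>
  let ?D = "density ?M (indicator B)"
  have ne: "space ?D \<noteq> {}" using y by (auto simp: space_M)
  have mD: "\<gamma>1 \<in> measurable ?D (subprob_algebra borel)" "\<gamma>2 \<in> measurable ?D (subprob_algebra borel)"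
    by measurable
  have "?D \<bind> \<gamma>1 = ?D \<bind> \<gamma>2"
  proof (rule measure_eqI)
    have s: "sets (?D \<bind> \<gamma>1) = sets borel" "sets (?D \<bind> \<gamma>2) = sets borel"
      by (rule sets_bind_measurable[OF mD(1) ne], rule sets_bind_measurable[OF mD(2) ne])
    then show "sets (?D \<bind> \<gamma>1) = sets (?D \<bind> \<gamma>2)" by simp
    fix A assume "A \<in> sets (?D \<bind> \<gamma>1)"
    then have A[measurable]: "A \<in> sets borel" using s by simp
    have "emeasure (?D \<bind> \<gamma>) A = emeasure \<rho> {x \<in> space (borel_space n). x 0 \<in> A \<and> other_spins n x \<in> B}"
      if "regular_cond_prob n \<rho> \<gamma>" for \<gamma>
    proof -
      have [measurable]: "\<gamma> \<in> measurable ?S (subprob_algebra borel)"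
        using that unfolding regular_cond_prob_def by blast
      have "(\<lambda>y. emeasure (\<gamma> y) A) \<in> borel_measurable ?S" by (rule measurable_emeasure_kernel) measurable
      then have "emeasure (?D \<bind> \<gamma>) A = (\<integral>\<^sup>+y. indicator B y * emeasure (\<gamma> y) A \<partial>?M)"
        using ne by (subst emeasure_bind[where N = borel]) (auto simp: nn_integral_density cong: measurable_cong_sets)
      also have "\<dots> = emeasure \<rho> {x \<in> space (borel_space n). x 0 \<in> A \<and> other_spins n x \<in> B}"
        using that[unfolded regular_cond_prob_def, THEN conjunct2, rule_format, OF A \<open>B \<in> sets ?S\<close>] by (rule sym)
      finally show ?thesis .
    qed
    then show "emeasure (?D \<bind> \<gamma>1) A = emeasure (?D \<bind> \<gamma>2) A"
      using rcp by simp
  qed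
  then have "(\<integral>\<^sup>+x. ennreal (f x) \<partial>(?D \<bind> \<gamma>1)) = (\<integral>\<^sup>+x. ennreal (f x) \<partial>(?D \<bind> \<gamma>2))" by simp
  then have "(\<integral>\<^sup>+y. \<integral>\<^sup>+x. ennreal (f x) \<partial>\<gamma>1 y \<partial>?D) = (\<integral>\<^sup>+y. \<integral>\<^sup>+x. ennreal (f x) \<partial>\<gamma>2 y \<partial>?D)"
    by (simp add: nn_integral_bind[OF _ mD(1)] nn_integral_bind[OF _ mD(2)])
  moreover have "(\<integral>\<^sup>+y. \<integral>\<^sup>+x. ennreal (f x) \<partial>\<gamma>1 y \<partial>?D) = (\<integral>\<^sup>+y. ennreal (u1 y) \<partial>?D)"
    by (intro nn_integral_cong) (simp add: nn[OF m1] space_M u1_def)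
  moreover have "(\<integral>\<^sup>+y. \<integral>\<^sup>+x. ennreal (f x) \<partial>\<gamma>2 y \<partial>?D) = (\<integral>\<^sup>+y. ennreal (u2 y) \<partial>?D)"
    by (intro nn_integral_cong) (simp add: nn[OF m2] space_M u2_def)
  moreover have mu[measurable]: "u1 \<in> borel_measurable ?S" "u2 \<in> borel_measurable ?S"
    unfolding u1_def u2_def by measurable
  moreover have u_nonneg: "0 \<le> u1 y" "0 \<le> u2 y" for y
    unfolding u1_def u2_def using f(2) by (auto intro: integral_nonneg_AE)
  ultimately have eq: "(\<integral>\<^sup>+y. ennreal (u1 y) * indicator B y \<partial>?M) = (\<integral>\<^sup>+y. ennreal (u2 y) * indicator B y \<partial>?M)"
    by (simp add: nn_integral_density mult.commute)
  have "u2 y \<le> C" if "y \<in> space ?S" for y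
  proof -
    interpret subprob_space "\<gamma>2 y" using m2 that by (rule subprob_space_kernel)
    have C: "0 \<le> C" using f(2,3) order_trans by blast
    have "sets (\<gamma>2 y) = sets borel" using m2 that by (rule sets_kernel)
    then have [measurable]: "f \<in> borel_measurable (\<gamma>2 y)" by (simp cong: measurable_cong_sets)
    have "u2 y \<le> (\<integral>x. C \<partial>\<gamma>2 y)"
      unfolding u2_def using f(2,3) C by (intro integral_mono integrable_const_bound[of _ C]) auto
    also have "\<dots> \<le> C" using C subprob_measure_le_1[of "space (\<gamma>2 y)"] by (simp add: mult_left_le_one_le)
    finally show ?thesis .
  qed
  then have "(\<integral>\<^sup>+y. ennreal (u2 y) * indicator B y \<partial>?M) \<le> (\<integral>\<^sup>+y. ennreal C \<partial>?M)"
    by (intro nn_integral_mono) (auto simp: space_M ennreal_leI split: split_indicator)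
  also have "\<dots> < \<infinity>"
    using finite_measure.emeasure_finite[OF fin] by (simp add: ennreal_mult_less_top less_top)
  \<comment> \<open>Finiteness is what permits cancelling this integral in an equation between
    extended numbers.\<close>
  finally have fin2: "(\<integral>\<^sup>+y. ennreal (u2 y) * indicator B y \<partial>?M) \<noteq> \<infinity>" by simp
  have "(\<integral>\<^sup>+y. ennreal (u1 y) * indicator B y \<partial>?M) =
      (\<integral>\<^sup>+y. ennreal (u2 y) * indicator B y + ennreal (u1 y - u2 y) * indicator B y \<partial>?M)"
    using u_nonneg by (intro nn_integral_cong) (auto simp: B_def ennreal_plus[symmetric] simp del: ennreal_plus split: split_indicator)
  also have "\<dots> = (\<integral>\<^sup>+y. ennreal (u2 y) * indicator B y \<partial>?M) + (\<integral>\<^sup>+y. ennreal (u1 y - u2 y) * indicator B y \<partial>?M)"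
    by (rule nn_integral_add) measurable
  finally have sum: "(\<integral>\<^sup>+y. ennreal (u1 y) * indicator B y \<partial>?M) =
      (\<integral>\<^sup>+y. ennreal (u2 y) * indicator B y \<partial>?M) + (\<integral>\<^sup>+y. ennreal (u1 y - u2 y) * indicator B y \<partial>?M)" .
  have cancel: "d = 0" if "a = a + d" "a \<noteq> \<infinity>" for a d :: ennreal
    using ennreal_add_left_cancel[of a d 0] that by simp
  have "(\<integral>\<^sup>+y. ennreal (u1 y - u2 y) * indicator B y \<partial>?M) = 0"
    by (rule cancel[OF sum[unfolded eq] fin2])
  then have "AE y in ?M. ennreal (u1 y - u2 y) * indicator B y = 0"
    by (subst (asm) nn_integral_0_iff_AE) measurable
  then have "AE y in ?M. y \<notin> B"
    by (rule eventually_mono) (auto simp: B_def split: split_indicator_asm)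
  then have "B \<in> null_sets ?M"
    by (subst AE_iff_null_sets) auto
  then show False using B_pos by auto
qed

text \<open>A bounded test function becomes nonnegative after a constant is added. The constant can
  be taken off again because constants are test functions too, so that the kernels have equal total
  masses.\<close>

lemma regular_cond_prob_integral_unique:
  fixes f :: "real \<Rightarrow> real"
  assumes rcp: "regular_cond_prob n \<rho> \<gamma>1" "regular_cond_prob n \<rho> \<gamma>2"
    and cont: "weakly_continuous_kernel (euclid (n - 1)) \<gamma>1" "weakly_continuous_kernel (euclid (n - 1)) \<gamma>2"
    and full: "\<And>U. openin (euclid (n - 1)) U \<Longrightarrow> U \<noteq> {} \<Longrightarrow> emeasure (others_law n \<rho>) U > 0"
    and fin: "finite_measure (others_law n \<rho>)"
    and f: "continuous_on UNIV f" "bounded (range f)"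
    and y: "y \<in> space (borel_space (n - 1))"
  shows "(\<integral>x. f x \<partial>\<gamma>1 y) = (\<integral>x. f x \<partial>\<gamma>2 y)"
proof -
  obtain C where C: "\<And>x. \<bar>f x\<bar> \<le> C" using f(2) by (auto simp: bounded_iff)
  have eq: "(\<integral>x. g x \<partial>\<gamma>1 y) = (\<integral>x. g x \<partial>\<gamma>2 y)" if "continuous_on UNIV g" "\<And>x. 0 \<le> g x" "\<And>x. g x \<le> D" for g :: "real \<Rightarrow> real" and D
    using regular_cond_prob_integral_le[OF rcp cont full fin that y]
      regular_cond_prob_integral_le[OF rcp(2,1) cont(2,1) full fin that y] by (intro antisym)
  have split: "(\<integral>x. f x + C \<partial>\<gamma> y) = (\<integral>x. f x \<partial>\<gamma> y) + (\<integral>x. C \<partial>\<gamma> y)"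
    if "regular_cond_prob n \<rho> \<gamma>" for \<gamma>
  proof -
    have m: "\<gamma> \<in> measurable (borel_space (n - 1)) (subprob_algebra borel)"
      using that unfolding regular_cond_prob_def by blast
    interpret subprob_space "\<gamma> y" using m y by (rule subprob_space_kernel)
    have "sets (\<gamma> y) = sets borel" using m y by (rule sets_kernel)
    then have [measurable]: "f \<in> borel_measurable (\<gamma> y)"
      using borel_measurable_continuous_onI[OF f(1)] by (simp cong: measurable_cong_sets)
    show ?thesis
      using C order_trans[OF abs_ge_zero C] by (intro Bochner_Integration.integral_add integrable_const_bound[of _ C]) auto
  qed
  have "(\<integral>x. f x + C \<partial>\<gamma>1 y) = (\<integral>x. f x + C \<partial>\<gamma>2 y)"
  proof (rule eq[of _ "C + C"])
    show "0 \<le> f x + C" "f x + C \<le> C + C" for x using C[of x] by (auto simp: abs_le_iff)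
  qed (intro continuous_intros f)
  moreover have "(\<integral>x. C \<partial>\<gamma>1 y) = (\<integral>x. C \<partial>\<gamma>2 y)"
    using C[of 0] by (intro eq[of "\<lambda>_. C" C]) auto
  ultimately show ?thesis using split[OF rcp(1)] split[OF rcp(2)] by linarith
qed

section \<open>Full support of the law of the other spins and weak continuity of the explicit
  kernel\<close>

context mean_field
begin

lemma others_weight_pos: "others_weight k y > 0"
proof -
  have "0 < ennreal (\<Prod>i<k. normal_density 0 (sqrt (1 + t)) (y i)) * ennreal (mass (Suc k) (magnetisation k y))"
    using t_pos mass_bounds(1) by (auto simp: ennreal_zero_less_mult_iff intro!: prod_pos normal_density_pos)
  moreover have "normalising_const V (Suc k) < top"
    using normalising_const_bounds(1)[OF V_measurable V_nonneg, of "Suc k"] by (auto intro: order_le_less_trans)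
  ultimately show ?thesis
    unfolding others_weight_def by (simp add: ennreal_zero_less_divide)
qed

lemma others_law_openin_pos:
  assumes U: "openin (euclid k) U" "U \<noteq> {}"
  shows "emeasure (others_law (Suc k) (time_evolved V t (Suc k))) U > 0"
proof (rule ccontr)
  have [measurable]: "U \<in> sets (borel_space k)" using U(1) by (rule openin_euclid_imp_sets)
  assume "\<not> ?thesis"
  then have "emeasure (density (lebesgue_space k) (others_weight k)) U = 0"
    unfolding others_law_time_evolved by (simp add: zero_less_iff_neq_zero)
  then have "(\<integral>\<^sup>+y. others_weight k y * indicator U y \<partial>lebesgue_space k) = 0"
    by (simp add: emeasure_density)
  then have "AE y in lebesgue_space k. others_weight k y * indicator U y = 0"
    by (subst (asm) nn_integral_0_iff_AE) measurable
  then have "AE y in lebesgue_space k. y \<notin> U"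
    by (rule eventually_mono) (use others_weight_pos[of k] in \<open>auto simp: zero_less_iff_neq_zero split: split_indicator_asm\<close>)
  then have "U \<in> null_sets (lebesgue_space k)"
    by (subst AE_iff_null_sets) auto
  then show False using openin_euclid_emeasure_pos[OF U] by auto
qed

text \<open>Full support leaves no point at which the kernel would have to vanish.\<close>

lemma proper_kernel_time_evolved: "proper_kernel (Suc k) (time_evolved V t (Suc k)) \<gamma>"
proof -
  have "measure_support (euclid k) (others_law (Suc k) (time_evolved V t (Suc k))) = space (borel_space k)"
    unfolding measure_support_def topspace_euclid using others_law_openin_pos by blast
  then show ?thesis by (simp add: proper_kernel_def)
qed

lemma prob_space_time_evolved: "prob_space (time_evolved V t n)"
proof
  have sets: "sets (time_evolved V t n) = sets (borel_space n)"
    by (simp add: time_evolved_def)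
  have "emeasure (normal_dist n z t) (space (borel_space n)) = 1" for z
    using prob_space.emeasure_space_1[OF prob_space_normal_dist[OF t_pos]]
    by (simp add: sets_eq_imp_space_eq[OF sets_normal_dist])
  then have "emeasure (time_evolved V t n) (space (borel_space n)) = normalising_const V n / normalising_const V n"
    by (subst emeasure_time_evolved[OF V_measurable]) (simp_all add: normalising_const_def)
  also have "\<dots> = 1"
    using normalising_const_bounds[OF V_measurable V_nonneg, of n]
    by (intro ennreal_divide_self) (auto intro: order_le_less_trans)
  finally show "emeasure (time_evolved V t n) (space (time_evolved V t n)) = 1"
    by (simp add: sets_eq_imp_space_eq[OF sets])
qed

lemma finite_measure_others_law: "finite_measure (others_law (Suc k) (time_evolved V t (Suc k)))"
proof -
  have sets: "sets (time_evolved V t (Suc k)) = sets (borel_space (Suc k))"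
    by (simp add: time_evolved_def)
  have "other_spins (Suc k) \<in> measurable (time_evolved V t (Suc k)) (borel_space k)"
    unfolding measurable_cong_sets[OF sets refl] by (rule measurable_other_spins)
  from prob_space.prob_space_distr[OF prob_space_time_evolved this] show ?thesis
    unfolding others_law_def by (simp add: prob_space.finite_measure)
qed

lemma integral_spin_law:
  fixes f :: "real \<Rightarrow> real"
  assumes [measurable]: "f \<in> borel_measurable borel"
  shows "(\<integral>x. f x \<partial>spin_law n \<beta>) =
    (\<integral>p. weight n \<beta> (fst p) * f (spin_coord n p) \<partial>(gauss \<Otimes>\<^sub>M gauss)) / mass n \<beta>"
proof -
  have "(\<integral>x. f x \<partial>spin_law n \<beta>) = (\<integral>p. (weight n \<beta> (fst p) / mass n \<beta>) *
      f (spin_coord n p) \<partial>(gauss \<Otimes>\<^sub>M gauss))"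
    unfolding spin_law_def using weight_bounds(1) mass_bounds(1)
    by (subst integral_distr, simp, simp, subst integral_density) (auto intro!: divide_nonneg_nonneg less_imp_le)
  then show ?thesis by simp
qed

lemma integral_spin_law_continuous:
  fixes f :: "real \<Rightarrow> real"
  assumes f: "continuous_on UNIV f" "bounded (range f)"
  shows "continuous_on UNIV (\<lambda>\<beta>. \<integral>x. f x \<partial>spin_law n \<beta>)"
proof (intro continuous_at_imp_continuous_on ballI)
  fix \<beta> :: real
  have [measurable]: "f \<in> borel_measurable borel" using f(1) by (rule borel_measurable_continuous_onI)
  obtain C where C: "\<And>x. \<bar>f x\<bar> \<le> C" using f(2) by (auto simp: bounded_iff)
  show "isCont (\<lambda>\<beta>. \<integral>x. f x \<partial>spin_law n \<beta>) \<beta>"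
    unfolding continuous_at_sequentially comp_def
  proof (intro allI impI)
    fix b assume b: "b \<longlonglongrightarrow> \<beta>"
    have "(\<lambda>i. mass n (b i)) \<longlonglongrightarrow> mass n \<beta>"
      using mass_continuous by (intro isCont_tendsto_compose[OF _ b]) (auto simp: continuous_on_eq_continuous_at)
    moreover have "(\<lambda>i. \<integral>p. weight n (b i) (fst p) * f (spin_coord n p) \<partial>(gauss \<Otimes>\<^sub>M gauss))
      \<longlonglongrightarrow> (\<integral>p. weight n \<beta> (fst p) * f (spin_coord n p) \<partial>(gauss \<Otimes>\<^sub>M gauss))"
    proof (rule integral_dominated_convergence[where w = "\<lambda>_. C"])
      show "AE p in gauss \<Otimes>\<^sub>M gauss. (\<lambda>i. weight n (b i) (fst p) * f (spin_coord n p))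
        \<longlonglongrightarrow> weight n \<beta> (fst p) * f (spin_coord n p)"
        by (intro always_eventually allI tendsto_intros weight_tendsto b)
      show "AE p in gauss \<Otimes>\<^sub>M gauss. norm (weight n (b i) (fst p) * f (spin_coord n p)) \<le> C" for i
      proof (intro always_eventually allI)
        fix p :: "real \<times> real"
        have "\<bar>weight n (b i) (fst p)\<bar> * \<bar>f (spin_coord n p)\<bar> \<le> 1 * C"
          using weight_bounds[of n "b i" "fst p"] C by (intro mult_mono) auto
        then show "norm (weight n (b i) (fst p) * f (spin_coord n p)) \<le> C"
          by (simp add: abs_mult)
      qed
    qed auto
    ultimately show "(\<lambda>i. \<integral>x. f x \<partial>spin_law n (b i)) \<longlonglongrightarrow> (\<integral>x. f x \<partial>spin_law n \<beta>)"
      unfolding integral_spin_law[OF \<open>f \<in> borel_measurable borel\<close>]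
      using mass_bounds(1)[of n \<beta>] by (intro tendsto_divide) auto
  qed
qed

lemma continuous_map_magnetisation: "continuous_map (euclid k) euclideanreal (magnetisation k)"
  unfolding magnetisation_def
  by (intro continuous_map_real_mult continuous_map_sum continuous_map_product_projection) auto

lemma weakly_continuous_spin_law:
  "weakly_continuous_kernel (euclid k) (\<lambda>y. spin_law n (magnetisation k y))"
  unfolding weakly_continuous_kernel_def
proof (intro allI impI)
  fix f :: "real \<Rightarrow> real" assume "continuous_on UNIV f" "bounded (range f)"
  then have "continuous_map euclideanreal euclideanreal (\<lambda>\<beta>. \<integral>x. f x \<partial>spin_law n \<beta>)"
    using integral_spin_law_continuous by simp
  from continuous_map_compose[OF continuous_map_magnetisation this]
  show "continuous_map (euclid k) euclideanreal (\<lambda>y. \<integral>x. f x \<partial>spin_law n (magnetisation k y))"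
    by (simp add: comp_def)
qed

end

section \<open>Concentration of the magnetisation at time 0\<close>

lemma integral_gauss_affine:
  fixes h :: "real \<Rightarrow> real"
  assumes \<sigma>: "\<sigma> > 0" and [measurable]: "h \<in> borel_measurable borel"
  shows "(\<integral>u. h (\<mu> + \<sigma> * u) \<partial>gauss) = (\<integral>r. normal_density \<mu> \<sigma> r * h r \<partial>lborel)"
proof -
  have "(\<integral>r. h r \<partial>density lborel (normal_density \<mu> \<sigma>)) = (\<integral>r. h r \<partial>distr gauss lborel (\<lambda>x. \<mu> + \<sigma> * x))"
    by (simp only: distr_gauss_affine[OF \<sigma>])
  then show ?thesis
    by (simp add: integral_density integral_distr)
qed

context mean_field
begin

text \<open>\<open>I_fun\<close> with the square in r completed and the terms free of r dropped, so
  both have the same minimisers. The quadratic part is the limit of the Gaussian exponents centred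
  at \<open>loc n \<beta>\<close>.\<close>

definition energy :: "real \<Rightarrow> real \<Rightarrow> real" where
  "energy \<beta> r = V r + (1 + t) / t / 2 * (r - \<beta> / (1 + t))\<^sup>2"

lemma I_fun_diff: "I_fun V t \<beta> r - I_fun V t \<beta> s = energy \<beta> r - energy \<beta> s"
proof -
  have "r\<^sup>2 / 2 + (r - \<beta>)\<^sup>2 / (2 * t) = (1 + t) / t / 2 * (r - \<beta> / (1 + t))\<^sup>2 + \<beta>\<^sup>2 / (2 * (1 + t))" for r
  proof -
    have t: "t \<noteq> 0" "1 + t \<noteq> 0" using t_pos by auto
    have "(r - \<beta> / (1 + t)) = ((1 + t) * r - \<beta>) / (1 + t)" using t by (simp add: field_simps)
    then have "(1 + t) / t / 2 * (r - \<beta> / (1 + t))\<^sup>2 = ((1 + t) * r - \<beta>)\<^sup>2 / (2 * t * (1 + t))"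
      using t by (simp add: power_divide power2_eq_square)
    moreover have "r\<^sup>2 / 2 + (r - \<beta>)\<^sup>2 / (2 * t) = (t * r\<^sup>2 + (r - \<beta>)\<^sup>2) * (1 + t) / (2 * t * (1 + t))"
      using t by (simp add: divide_simps)
    moreover have "\<beta>\<^sup>2 / (2 * (1 + t)) = t * \<beta>\<^sup>2 / (2 * t * (1 + t))" using t by simp
    moreover have "(t * r\<^sup>2 + (r - \<beta>)\<^sup>2) * (1 + t) = ((1 + t) * r - \<beta>)\<^sup>2 + t * \<beta>\<^sup>2"
      by (simp add: power2_eq_square algebra_simps)
    ultimately show ?thesis by (simp only: add_divide_distrib)
  qed
  from this[of r] this[of s] show ?thesis by (simp add: I_fun_def energy_def)
qed

lemma arg_min_I_iff: "is_arg_min (I_fun V t \<beta>) (\<lambda>_. True) r \<longleftrightarrow> (\<forall>s. energy \<beta> r \<le> energy \<beta> s)"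
proof -
  have "I_fun V t \<beta> r \<le> I_fun V t \<beta> s \<longleftrightarrow> energy \<beta> r \<le> energy \<beta> s" for s
    using I_fun_diff[of \<beta> r s] by linarith
  then show ?thesis by (simp add: is_arg_min_linorder)
qed

lemma energy_nonneg: "0 \<le> energy \<beta> r"
  unfolding energy_def using V_nonneg t_pos by simp

lemma energy_continuous: "continuous_on UNIV (energy \<beta>)"
  unfolding energy_def by (intro continuous_intros V_cont)

text \<open>The quadratic term keeps the energy above \<open>c + 1\<close> outside a ball, and on
  the compact rest of S the continuous energy attains its minimum.\<close>

lemma energy_gap:
  assumes S: "closed S" and less: "\<And>r. r \<in> S \<Longrightarrow> c < energy \<beta> r"
  shows "\<exists>\<eta>>0. \<forall>r\<in>S. c + \<eta> \<le> energy \<beta> r"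
proof -
  \<comment> \<open>At distance R from the centre the quadratic term equals
    \<open>\<bar>c\<bar> + 1\<close>.\<close>
  define R where "R = sqrt (2 * t / (1 + t) * (\<bar>c\<bar> + 1))"
  have R: "R \<ge> 0" "R\<^sup>2 = 2 * t / (1 + t) * (\<bar>c\<bar> + 1)" using t_pos by (auto simp: R_def)
  define K where "K = cball (\<beta> / (1 + t)) R"
  have out: "c + 1 \<le> energy \<beta> r" if "r \<notin> K" for r
  proof -
    have "R \<le> \<bar>r - \<beta> / (1 + t)\<bar>" using that by (simp add: K_def dist_real_def abs_minus_commute)
    then have "R\<^sup>2 \<le> (r - \<beta> / (1 + t))\<^sup>2" using R(1) by (metis power2_abs power_mono)
    then have "(1 + t) / t / 2 * R\<^sup>2 \<le> (1 + t) / t / 2 * (r - \<beta> / (1 + t))\<^sup>2"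
      using t_pos by (intro mult_left_mono) auto
    moreover have "(1 + t) / t / 2 * R\<^sup>2 = \<bar>c\<bar> + 1" proof -
      have "q / t / 2 * (2 * t / q * x) = x" if "q > 0" for q x :: real
        using that t_pos by (simp add: field_simps)
      then show ?thesis unfolding R(2) using t_pos by simp
    qed
    ultimately show ?thesis using V_nonneg[of r] by (simp add: energy_def)
  qed
  show ?thesis
  proof (cases "S \<inter> K = {}")
    case True
    then show ?thesis using out by (intro exI[of _ 1]) auto
  next
    case False
    have "compact (S \<inter> K)" using S by (simp add: K_def closed_Int_compact)
    then obtain r0 where r0: "r0 \<in> S \<inter> K" "\<And>r. r \<in> S \<inter> K \<Longrightarrow> energy \<beta> r0 \<le> energy \<beta> r"
      using continuous_attains_inf[OF _ False continuous_on_subset[OF energy_continuous subset_UNIV]] by metis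
    have "c + min 1 (energy \<beta> r0 - c) \<le> energy \<beta> r" if "r \<in> S" for r
      using r0(2)[of r] out[of r] that by (cases "r \<in> K") (auto simp: min_def)
    then show ?thesis using less r0(1) by (intro exI[of _ "min 1 (energy \<beta> r0 - c)"]) auto
  qed
qed

text \<open>Without a minimiser the energy would exceed its infimum everywhere, hence by
  \<open>energy_gap\<close> with a uniform margin.\<close>

lemma energy_attains_min: "\<exists>r. \<forall>s. energy \<beta> r \<le> energy \<beta> s"
proof (rule ccontr)
  let ?c = "Inf (range (energy \<beta>))"
  have bdd: "bdd_below (range (energy \<beta>))" using energy_nonneg by (auto intro: bdd_belowI[of _ 0])
  assume "\<not> ?thesis"
  then have "\<exists>s. energy \<beta> s < energy \<beta> r" for r by (meson not_le)
  then have "?c < energy \<beta> r" for r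
    by (meson bdd cInf_lower order_le_less_trans rangeI)
  then obtain \<eta> where "\<eta> > 0" "\<And>r. ?c + \<eta> \<le> energy \<beta> r"
    using energy_gap[of UNIV ?c \<beta>] by auto
  then have "?c + \<eta> \<le> ?c" by (intro cInf_greatest) auto
  with \<open>\<eta> > 0\<close> show False by simp
qed

text \<open>Up to its sign, the exponent of the mixing density per spin, at size n and not only in
  the limit.\<close>

definition energy_n :: "nat \<Rightarrow> real \<Rightarrow> real \<Rightarrow> real" where
  "energy_n n \<beta> r = V r + slope n / 2 * (r - loc n \<beta>)\<^sup>2"

lemma slope_ge_1: "n > 0 \<Longrightarrow> slope n \<ge> 1"
  using t_pos by (simp add: slope_def field_simps add_pos_nonneg)

lemma slope_eq: "n > 0 \<Longrightarrow> slope n = (1 + t) / t * (1 - 1 / (1 + real n * t))"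
proof -
  assume "n > 0"
  then have "1 + real n * t > 0" using t_pos by (simp add: add_pos_nonneg)
  then have "1 - 1 / (1 + real n * t) = real n * t / (1 + real n * t)" by (simp add: field_simps)
  then show ?thesis using t_pos by (simp add: slope_def)
qed

lemma weight_density:
  assumes n: "n > 0"
  shows "normal_density (loc n \<beta>) (scl n) r * exp (- real n * V r) =
    1 / sqrt (2 * pi * (scl n)\<^sup>2) * exp (- real n * energy_n n \<beta> r)"
proof -
  have pos: "1 + t > 0" "1 + real n * t > 0" "real n > 0" using t_pos n by (auto simp: add_pos_nonneg)
  have "(scl n)\<^sup>2 = (1 + real n * t) / ((real n)\<^sup>2 * (1 + t))"
    using pos by (simp add: scl_def)
  then have "1 / (2 * (scl n)\<^sup>2) = real n * (slope n / 2)"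
  proof -
    have "1 / (2 * (w / (N\<^sup>2 * q))) = N * (N * q / w / 2)" if "q > 0" "N > 0" "w > 0" for q N w :: real
      using that by (simp add: field_simps power2_eq_square)
    from this[OF pos(1,3,2)] show ?thesis
      unfolding slope_def \<open>(scl n)\<^sup>2 = _\<close> .
  qed
  then have "- (r - loc n \<beta>)\<^sup>2 / (2 * (scl n)\<^sup>2) = - (real n * (slope n / 2) * (r - loc n \<beta>)\<^sup>2)"
    by (metis divide_inverse inverse_eq_divide mult.commute mult_minus_left)
  then have "- (r - loc n \<beta>)\<^sup>2 / (2 * (scl n)\<^sup>2) + - real n * V r = - real n * energy_n n \<beta> r"
    by (simp add: energy_n_def algebra_simps)
  then show ?thesis
    unfolding normal_density_def by (simp add: mult_exp_exp)
qed

text \<open>The probability that the initial magnetisation lies in S under the mixing law behind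
  \<open>spin_law n \<beta>\<close>.\<close>

definition tilted_prob :: "nat \<Rightarrow> real \<Rightarrow> real set \<Rightarrow> real" where
  "tilted_prob n \<beta> S = (\<integral>u. weight n \<beta> u * indicator S (loc n \<beta> + scl n * u) \<partial>gauss) / mass n \<beta>"

lemma integrable_normal_density_mult: "integrable lborel (\<lambda>r. normal_density \<mu> \<sigma> r * h r)"
  if "\<sigma> > 0" "h \<in> borel_measurable borel" "\<And>r. \<bar>h r\<bar> \<le> C" for h :: "real \<Rightarrow> real"
proof (rule Bochner_Integration.integrable_bound[of _ "\<lambda>r. C * normal_density \<mu> \<sigma> r"])
  have "norm (normal_density \<mu> \<sigma> r * h r) \<le> norm (C * normal_density \<mu> \<sigma> r)" for r
    using mult_left_mono[OF that(3)[of r], of "normal_density \<mu> \<sigma> r"] order_trans[OF abs_ge_zero that(3)[of r]]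
    by (simp add: abs_mult mult.commute)
  then show "AE r in lborel. norm (normal_density \<mu> \<sigma> r * h r) \<le> norm (C * normal_density \<mu> \<sigma> r)" by simp
qed (use that in auto)

text \<open>Of the n copies of the energy in the exponent, \<open>n - 1\<close> are bounded below by
  m and one is kept, because its Gaussian part makes the integral over an unbounded S finite. The
  mass is bounded below by its part over an interval around \<open>r0\<close>, and the common
  normalising factor cancels.\<close>

lemma laplace_bound:
  assumes n: "n > 0" and [measurable]: "S \<in> sets borel"
    and low: "\<And>r. r \<in> S \<Longrightarrow> m \<le> energy_n n \<beta> r"
    and up: "\<And>r. r \<in> {r0 - \<delta>..r0 + \<delta>} \<Longrightarrow> energy_n n \<beta> r \<le> M" and \<delta>: "\<delta> > 0"
  shows "tilted_prob n \<beta> S \<le> sqrt (2 * pi) / (2 * \<delta>) * exp (- (real n - 1) * m + real n * M)"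
proof -
  define c where "c = 1 / sqrt (2 * pi * (scl n)\<^sup>2)"
  have c: "c > 0" using scl_pos[OF n] by (simp add: c_def)
  let ?N = "normal_density (loc n \<beta>) (scl n)"
  let ?e = "\<lambda>r. exp (- real n * V r)"
  have e_le: "\<bar>?e r\<bar> \<le> 1" for r using V_nonneg[of r] by simp
  have numer: "(\<integral>u. weight n \<beta> u * indicator S (loc n \<beta> + scl n * u) \<partial>gauss) = (\<integral>r. ?N r * (?e r * indicator S r) \<partial>lborel)"
    unfolding weight_def by (rule integral_gauss_affine[OF scl_pos[OF n]]) measurable
  have denom: "mass n \<beta> = (\<integral>r. ?N r * ?e r \<partial>lborel)"
    unfolding mass_def weight_def by (rule integral_gauss_affine[OF scl_pos[OF n]]) measurable
  have s: "slope n > 0" using slope_ge_1[OF n] by simp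
  have "(\<integral>r. ?N r * (?e r * indicator S r) \<partial>lborel) \<le>
      (\<integral>r. c * exp (- (real n - 1) * m) * (sqrt (2 * pi / slope n) * normal_density (loc n \<beta>) (1 / sqrt (slope n)) r) \<partial>lborel)"
  proof (rule integral_mono)
    show "integrable lborel (\<lambda>r. ?N r * (?e r * indicator S r))"
      by (rule integrable_normal_density_mult[where C = 1]) (use scl_pos[OF n] e_le in \<open>auto simp: abs_mult split: split_indicator\<close>)
    show "integrable lborel (\<lambda>r. c * exp (- (real n - 1) * m) * (sqrt (2 * pi / slope n) * normal_density (loc n \<beta>) (1 / sqrt (slope n)) r))"
      using s by (intro integrable_mult_right integrable_normal_density) simp
    fix r
    \<comment> \<open>The retained Gaussian is a multiple of a probability density with variance
      \<open>1 / slope n\<close>, so its integral is known.\<close>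
    have nd: "sqrt (2 * pi / slope n) * normal_density (loc n \<beta>) (1 / sqrt (slope n)) r = exp (- (slope n / 2 * (r - loc n \<beta>)\<^sup>2))"
      using s by (simp add: normal_density_def power_divide real_sqrt_divide real_sqrt_mult)
    show "?N r * (?e r * indicator S r) \<le> c * exp (- (real n - 1) * m) * (sqrt (2 * pi / slope n) * normal_density (loc n \<beta>) (1 / sqrt (slope n)) r)"
    proof (cases "r \<in> S")
      case True
      have "(real n - 1) * m \<le> (real n - 1) * energy_n n \<beta> r"
        using low[OF True] n by (intro mult_left_mono) auto
      moreover have "slope n / 2 * (r - loc n \<beta>)\<^sup>2 \<le> energy_n n \<beta> r"
        using V_nonneg[of r] by (simp add: energy_n_def)
      ultimately have "- real n * energy_n n \<beta> r \<le> - (real n - 1) * m + - (slope n / 2 * (r - loc n \<beta>)\<^sup>2)"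
        by (simp add: algebra_simps)
      then have "exp (- real n * energy_n n \<beta> r) \<le> exp (- (real n - 1) * m) * exp (- (slope n / 2 * (r - loc n \<beta>)\<^sup>2))"
        by (simp only: exp_add[symmetric] exp_le_cancel_iff)
      then have "c * exp (- real n * energy_n n \<beta> r) \<le> c * (exp (- (real n - 1) * m) * exp (- (slope n / 2 * (r - loc n \<beta>)\<^sup>2)))"
        using c by (intro mult_left_mono) auto
      then show ?thesis
        using True weight_density[OF n, of \<beta> r] unfolding nd c_def[symmetric] by (simp add: mult.assoc)
    next
      case False
      then show ?thesis unfolding nd using c by simp
    qed
  qed
  also have "\<dots> = c * exp (- (real n - 1) * m) * sqrt (2 * pi / slope n)"
    using s by (simp add: integral_normal_density)
  also have "\<dots> \<le> c * exp (- (real n - 1) * m) * sqrt (2 * pi)"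
    using c slope_ge_1[OF n] by (intro mult_left_mono real_sqrt_le_mono) (auto simp: field_simps)
  finally have num: "(\<integral>r. ?N r * (?e r * indicator S r) \<partial>lborel) \<le> c * exp (- (real n - 1) * m) * sqrt (2 * pi)" .
  have "(\<integral>r. c * exp (- real n * M) * indicator {r0 - \<delta>..r0 + \<delta>} r \<partial>lborel) \<le> (\<integral>r. ?N r * ?e r \<partial>lborel)"
  proof (rule integral_mono)
    show "integrable lborel (\<lambda>r. ?N r * ?e r)"
      by (rule integrable_normal_density_mult[where C = 1]) (use scl_pos[OF n] e_le in auto)
    fix r
    show "c * exp (- real n * M) * indicator {r0 - \<delta>..r0 + \<delta>} r \<le> ?N r * ?e r"
    proof (cases "r \<in> {r0 - \<delta>..r0 + \<delta>}")
      case True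
      then show ?thesis
        using weight_density[OF n, of \<beta> r] up[OF True] n c unfolding c_def[symmetric] by simp
    qed (simp add: normal_density_nonneg)
    show "integrable lborel (\<lambda>r. c * exp (- real n * M) * indicator {r0 - \<delta>..r0 + \<delta>} r)"
      by (intro integrable_mult_right) (auto intro!: integrable_real_indicator simp: emeasure_lborel_Icc_eq)
  qed
  then have den: "c * exp (- real n * M) * (2 * \<delta>) \<le> mass n \<beta>"
    using \<delta> by (simp add: denom)
  have "tilted_prob n \<beta> S \<le> (c * exp (- (real n - 1) * m) * sqrt (2 * pi)) / mass n \<beta>"
    unfolding tilted_prob_def numer using num mass_bounds(1)[of n \<beta>] by (intro divide_right_mono) auto
  also have "\<dots> \<le> (c * exp (- (real n - 1) * m) * sqrt (2 * pi)) / (c * exp (- real n * M) * (2 * \<delta>))"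
    using den c \<delta> mass_bounds(1)[of n \<beta>] by (intro divide_left_mono) auto
  also have "\<dots> = sqrt (2 * pi) / (2 * \<delta>) * (exp (- (real n - 1) * m) / exp (- real n * M))"
    using c by (simp add: mult.commute)
  also have "exp (- (real n - 1) * m) / exp (- real n * M) = exp (- (real n - 1) * m + real n * M)"
    by (simp add: exp_diff[symmetric])
  finally show ?thesis .
qed

section \<open>Limits of the parameters and concentration near the energy minimum\<close>

lemma loc_tendsto:
  assumes "b \<longlonglongrightarrow> \<beta>" shows "(\<lambda>n. loc n (b n)) \<longlonglongrightarrow> \<beta> / (1 + t)"
proof -
  have "(\<lambda>n. (1 - 1 / real n) * b n / (1 + t)) \<longlonglongrightarrow> (1 - 0) * \<beta> / (1 + t)"
    using t_pos by (intro tendsto_intros assms lim_1_over_n) auto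
  moreover have "\<forall>\<^sub>F n in sequentially. (1 - 1 / real n) * b n / (1 + t) = loc n (b n)"
    using eventually_gt_at_top[of 0] by eventually_elim (simp add: loc_def field_simps)
  ultimately show ?thesis by (simp add: tendsto_cong)
qed

lemma slope_error_tendsto: "(\<lambda>n. 1 / (1 + real n * t)) \<longlonglongrightarrow> 0"
proof (rule tendsto_divide_0[OF tendsto_const])
  have "filterlim (\<lambda>n. real n * t) at_top sequentially"
    using t_pos by (intro filterlim_at_top_mult_tendsto_pos[OF tendsto_const _ filterlim_real_sequentially]) auto
  then show "filterlim (\<lambda>n. 1 + real n * t) at_infinity sequentially"
    by (intro filterlim_at_top_imp_at_infinity filterlim_tendsto_add_at_top[OF tendsto_const])
qed

lemma slope_tendsto: "slope \<longlonglongrightarrow> (1 + t) / t"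
proof -
  have "(\<lambda>n. (1 + t) / t * (1 - 1 / (1 + real n * t))) \<longlonglongrightarrow> (1 + t) / t * (1 - 0)"
    by (intro tendsto_intros slope_error_tendsto)
  moreover have "\<forall>\<^sub>F n in sequentially. (1 + t) / t * (1 - 1 / (1 + real n * t)) = slope n"
    using eventually_gt_at_top[of 0] by eventually_elim (rule slope_eq[symmetric])
  ultimately show ?thesis by (simp add: tendsto_cong)
qed

lemma sdev_tendsto: "sdev \<longlonglongrightarrow> sqrt (1 + t)"
proof -
  have eq: "sdev n = sqrt (t * slope n)" for n
    by (simp add: sdev_def slope_def mult_ac)
  have "(\<lambda>n. sqrt (t * slope n)) \<longlonglongrightarrow> sqrt (t * ((1 + t) / t))"
    by (intro tendsto_intros slope_tendsto)
  then show ?thesis using t_pos by (simp add: eq[abs_def])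
qed

text \<open>Young's inequality, obtained by expanding the square of \<open>e * u + v\<close> with
  \<open>u = r - b\<close> and \<open>v = b - l\<close>.\<close>

lemma square_diff_ge:
  fixes r l b e :: real
  assumes "0 < e" "e < 1"
  shows "(r - l)\<^sup>2 \<ge> (1 - e) * (r - b)\<^sup>2 - (1 / e - 1) * (b - l)\<^sup>2"
proof -
  define u v where "u = r - b" and "v = b - l"
  have "0 \<le> (e * u + v)\<^sup>2 / e" using assms by simp
  also have "(e * u + v)\<^sup>2 / e = e * u\<^sup>2 + 2 * u * v + v\<^sup>2 / e"
    using assms by (simp add: power2_eq_square field_simps)
  also have "\<dots> = (u + v)\<^sup>2 - ((1 - e) * u\<^sup>2 - (1 / e - 1) * v\<^sup>2)"
    by (simp add: power2_eq_square algebra_simps)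
  finally show ?thesis by (simp add: u_def v_def)
qed

text \<open>On an unbounded S the energies need not converge uniformly, but they compare up to a
  factor: eventually \<open>energy_n n (b n) r\<close> is at least
  \<open>(1 - 2 * e) * energy \<beta> r - e\<close> on S. In the factor one e pays for the slope and
  the other for the shifted centre.\<close>

lemma energy_n_lower:
  assumes b: "b \<longlonglongrightarrow> \<beta>" and \<eta>: "\<eta> > 0" and S: "\<And>r. r \<in> S \<Longrightarrow> c + 2 * \<eta> \<le> energy \<beta> r" and c: "c \<ge> 0"
  shows "\<forall>\<^sub>F n in sequentially. \<forall>r\<in>S. c + \<eta> \<le> energy_n n (b n) r"
proof -
  define \<kappa> where "\<kappa> = (1 + t) / t"
  have \<kappa>: "\<kappa> > 0" using t_pos by (simp add: \<kappa>_def)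
  \<comment> \<open>The total loss \<open>2 * e * (c + 2 * \<eta>) + e\<close> must not exceed
    \<open>\<eta>\<close>; the cap \<open>1/4\<close> keeps the factor \<open>1 - 2 * e\<close>
    positive.\<close>
  define e where "e = min (1/4) (\<eta> / (2 * (c + 2 * \<eta>) + 1))"
  have D: "2 * (c + 2 * \<eta>) + 1 > 0" using c \<eta> by simp
  have e: "0 < e" "e < 1" "2 * e \<le> 1" "e * (2 * (c + 2 * \<eta>) + 1) \<le> \<eta>"
  proof -
    show "0 < e" "e < 1" "2 * e \<le> 1" using \<eta> D by (auto simp: e_def)
    have "e \<le> \<eta> / (2 * (c + 2 * \<eta>) + 1)" by (simp add: e_def)
    then show "e * (2 * (c + 2 * \<eta>) + 1) \<le> \<eta>" using D by (simp only: pos_le_divide_eq)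
  qed
  have "(\<lambda>n. \<kappa> / 2 * (1 / e - 1) * (\<beta> / (1 + t) - loc n (b n))\<^sup>2) \<longlonglongrightarrow> \<kappa> / 2 * (1 / e - 1) * (\<beta> / (1 + t) - \<beta> / (1 + t))\<^sup>2"
    by (intro tendsto_intros loc_tendsto b)
  then have ev: "\<forall>\<^sub>F n in sequentially. \<kappa> / 2 * (1 / e - 1) * (\<beta> / (1 + t) - loc n (b n))\<^sup>2 < e"
    by (rule order_tendstoD(2)) (use e in simp)
  have ev2: "\<forall>\<^sub>F n in sequentially. 1 / (1 + real n * t) < e"
    using order_tendstoD(2)[OF slope_error_tendsto e(1)] .
  show ?thesis
    using ev ev2 eventually_gt_at_top[of 0]
  proof eventually_elim
    case (elim n)
    show ?case
    proof
      fix r assume "r \<in> S"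
      define \<epsilon> where "\<epsilon> = 1 / (1 + real n * t)"
      have \<epsilon>: "0 \<le> \<epsilon>" "\<epsilon> < e" using elim t_pos by (simp_all add: \<epsilon>_def)
      have s: "slope n = \<kappa> * (1 - \<epsilon>)" unfolding \<kappa>_def \<epsilon>_def by (rule slope_eq[OF elim(3)])
      define X where "X = (r - \<beta> / (1 + t))\<^sup>2"
      define Y where "Y = (\<beta> / (1 + t) - loc n (b n))\<^sup>2"
      have XY: "X \<ge> 0" "Y \<ge> 0" by (simp_all add: X_def Y_def)
      have "(1 - e) * X - (1 / e - 1) * Y \<le> (r - loc n (b n))\<^sup>2"
        unfolding X_def Y_def by (rule square_diff_ge[OF e(1,2)])
      then have "\<kappa> / 2 * (1 - \<epsilon>) * ((1 - e) * X - (1 / e - 1) * Y) \<le> \<kappa> / 2 * (1 - \<epsilon>) * (r - loc n (b n))\<^sup>2"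
        using \<kappa> \<epsilon> e by (intro mult_left_mono) auto
      moreover have "\<kappa> / 2 * (1 - \<epsilon>) * ((1 - e) * X - (1 / e - 1) * Y) =
          \<kappa> / 2 * X * ((1 - \<epsilon>) * (1 - e)) - (1 - \<epsilon>) * (\<kappa> / 2 * (1 / e - 1) * Y)"
      proof -
        have "h * (1 - \<epsilon>) * ((1 - e) * X - k * Y) = h * X * ((1 - \<epsilon>) * (1 - e)) - (1 - \<epsilon>) * (h * k * Y)" for h k
          by (simp add: algebra_simps)
        then show ?thesis .
      qed
      moreover have "\<kappa> / 2 * X * (1 - 2 * e) \<le> \<kappa> / 2 * X * ((1 - \<epsilon>) * (1 - e))"
      proof (rule mult_left_mono)
        have "0 \<le> \<epsilon> * e" using \<epsilon> e by simp
        moreover have "(1 - \<epsilon>) * (1 - e) = 1 - \<epsilon> - e + \<epsilon> * e" by (simp add: algebra_simps)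
        ultimately show "1 - 2 * e \<le> (1 - \<epsilon>) * (1 - e)" using \<epsilon> by linarith
      qed (use \<kappa> XY in simp)
      moreover have "(1 - \<epsilon>) * (\<kappa> / 2 * (1 / e - 1) * Y) \<le> 1 * (\<kappa> / 2 * (1 / e - 1) * Y)"
        using \<epsilon> e \<kappa> XY by (intro mult_right_mono mult_nonneg_nonneg) (auto simp: field_simps)
      moreover have "\<kappa> / 2 * (1 / e - 1) * Y < e" using elim(1) by (simp add: Y_def)
      ultimately have "\<kappa> / 2 * X * (1 - 2 * e) - e \<le> \<kappa> / 2 * (1 - \<epsilon>) * (r - loc n (b n))\<^sup>2"
        by linarith
      moreover have "slope n / 2 * (r - loc n (b n))\<^sup>2 = \<kappa> / 2 * (1 - \<epsilon>) * (r - loc n (b n))\<^sup>2" by (simp add: s)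
      moreover have "(1 - 2 * e) * V r \<le> V r" using V_nonneg[of r] e by (simp add: mult_left_le_one_le)
      moreover have "(1 - 2 * e) * energy \<beta> r = (1 - 2 * e) * V r + \<kappa> / 2 * X * (1 - 2 * e)"
        by (simp only: energy_def X_def \<kappa>_def distrib_left mult.commute)
      ultimately have "(1 - 2 * e) * energy \<beta> r - e \<le> energy_n n (b n) r"
        unfolding energy_n_def by linarith
      moreover have "(1 - 2 * e) * (c + 2 * \<eta>) \<le> (1 - 2 * e) * energy \<beta> r"
        using S[OF \<open>r \<in> S\<close>] e by (intro mult_left_mono) auto
      moreover have "c + \<eta> \<le> (1 - 2 * e) * (c + 2 * \<eta>) - e"
        using e(4) by (simp add: algebra_simps)
      ultimately show "c + \<eta> \<le> energy_n n (b n) r" by linarith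
    qed
  qed
qed

text \<open>Joint convergence along the product of the filter for n with the neighbourhoods of
  \<open>r0\<close> supplies one neighbourhood that serves all large n.\<close>

lemma energy_n_upper:
  assumes b: "b \<longlonglongrightarrow> \<beta>" and \<eta>: "\<eta> > 0"
  shows "\<exists>\<delta>>0. \<forall>\<^sub>F n in sequentially. \<forall>r\<in>{r0 - \<delta>..r0 + \<delta>}. energy_n n (b n) r \<le> energy \<beta> r0 + \<eta>"
proof -
  let ?F = "sequentially \<times>\<^sub>F nhds r0"
  have fst: "filterlim fst sequentially ?F" and snd: "(snd \<longlongrightarrow> r0) ?F"
    by (rule filterlim_fst filterlim_snd)+
  have "((\<lambda>p. V (snd p) + slope (fst p) / 2 * (snd p - loc (fst p) (b (fst p)))\<^sup>2) \<longlongrightarrow>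
      V r0 + (1 + t) / t / 2 * (r0 - \<beta> / (1 + t))\<^sup>2) ?F"
    using V_cont t_pos
    by (intro tendsto_intros snd filterlim_compose[OF slope_tendsto fst] filterlim_compose[OF loc_tendsto[OF b] fst]
        isCont_tendsto_compose[OF _ snd]) (auto simp: continuous_on_eq_continuous_at)
  then have "\<forall>\<^sub>F p in ?F. V (snd p) + slope (fst p) / 2 * (snd p - loc (fst p) (b (fst p)))\<^sup>2 < energy \<beta> r0 + \<eta>"
    by (rule order_tendstoD(2)) (use \<eta> in \<open>simp add: energy_def\<close>)
  then have "\<forall>\<^sub>F p in ?F. energy_n (fst p) (b (fst p)) (snd p) \<le> energy \<beta> r0 + \<eta>"
    by (rule eventually_mono) (simp add: energy_n_def)
  then obtain P Q where P: "eventually P sequentially" and Q: "eventually Q (nhds r0)"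
    and PQ: "\<And>n r. P n \<Longrightarrow> Q r \<Longrightarrow> energy_n n (b n) r \<le> energy \<beta> r0 + \<eta>"
    unfolding eventually_prod_filter by auto
  obtain d where d: "d > 0" "\<And>r. dist r r0 < d \<Longrightarrow> Q r"
    using Q unfolding eventually_nhds_metric by auto
  show ?thesis
  proof (intro exI[of _ "d / 2"] conjI)
    show "\<forall>\<^sub>F n in sequentially. \<forall>r\<in>{r0 - d / 2..r0 + d / 2}. energy_n n (b n) r \<le> energy \<beta> r0 + \<eta>"
      using P by eventually_elim (use d in \<open>auto intro!: PQ simp: dist_real_def abs_if\<close>)
  qed (use d in simp)
qed

lemma tilted_prob_nonneg: "0 \<le> tilted_prob n \<beta> S"
  unfolding tilted_prob_def using mass_bounds(1)[THEN less_imp_le] weight_bounds(1)[THEN less_imp_le]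
  by (intro divide_nonneg_nonneg integral_nonneg_AE) auto

text \<open>Eventually \<open>energy_n\<close> exceeds the energy of q by at least
  \<open>\<eta> / 2\<close> on S and by at most \<open>\<eta> / 4\<close> near q, which leaves
  exponential decay at rate \<open>\<eta> / 4\<close>.\<close>

lemma tilted_prob_tendsto_0:
  assumes b: "b \<longlonglongrightarrow> \<beta>" and \<eta>: "\<eta> > 0" and S: "S \<in> sets borel" "\<And>r. r \<in> S \<Longrightarrow> energy \<beta> q + \<eta> \<le> energy \<beta> r"
  shows "(\<lambda>n. tilted_prob n (b n) S) \<longlonglongrightarrow> 0"
proof -
  let ?c = "energy \<beta> q"
  have lower: "\<forall>\<^sub>F n in sequentially. \<forall>r\<in>S. ?c + \<eta> / 2 \<le> energy_n n (b n) r"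
    by (rule energy_n_lower[OF b]) (use \<eta> S(2) energy_nonneg in auto)
  have "\<eta> / 4 > 0" using \<eta> by simp
  from energy_n_upper[OF b this, of q] obtain \<delta> where \<delta>: "\<delta> > 0"
    "\<forall>\<^sub>F n in sequentially. \<forall>r\<in>{q - \<delta>..q + \<delta>}. energy_n n (b n) r \<le> ?c + \<eta> / 4" by blast
  have le: "\<forall>\<^sub>F n in sequentially. tilted_prob n (b n) S \<le> sqrt (2 * pi) / (2 * \<delta>) * exp (?c + \<eta> / 2 - real n * (\<eta> / 4))"
    using lower \<delta>(2) eventually_gt_at_top[of 0]
  proof eventually_elim
    case (elim n)
    have "tilted_prob n (b n) S \<le> sqrt (2 * pi) / (2 * \<delta>) * exp (- (real n - 1) * (?c + \<eta> / 2) + real n * (?c + \<eta> / 4))"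
      using elim \<delta>(1) S(1) by (intro laplace_bound) auto
    also have "- (real n - 1) * (?c + \<eta> / 2) + real n * (?c + \<eta> / 4) = ?c + \<eta> / 2 - real n * (\<eta> / 4)"
      by (simp add: field_simps)
    finally show ?case .
  qed
  have "filterlim (\<lambda>n. real n * (\<eta> / 4)) at_top sequentially"
    using \<eta> by (intro filterlim_at_top_mult_tendsto_pos[OF tendsto_const _ filterlim_real_sequentially]) auto
  then have "filterlim (\<lambda>n. - (real n * (\<eta> / 4))) at_bot sequentially"
    by (simp add: filterlim_uminus_at_top)
  then have "(\<lambda>n. exp (- (real n * (\<eta> / 4)))) \<longlonglongrightarrow> 0"
    by (rule filterlim_compose[OF exp_at_bot])
  then have "(\<lambda>n. sqrt (2 * pi) / (2 * \<delta>) * exp (?c + \<eta> / 2) * exp (- (real n * (\<eta> / 4)))) \<longlonglongrightarrow> 0"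
    by (rule tendsto_mult_right_zero)
  then have lim: "(\<lambda>n. sqrt (2 * pi) / (2 * \<delta>) * exp (?c + \<eta> / 2 - real n * (\<eta> / 4))) \<longlonglongrightarrow> 0"
    by (simp only: diff_conv_add_uminus exp_add mult.assoc)
  show ?thesis
    by (rule tendsto_sandwich[OF always_eventually le tendsto_const lim]) (simp add: tilted_prob_nonneg)
qed

end

section \<open>Limits of the conditional laws\<close>

text \<open>For letting a parameter tend to its limit so slowly that statements which hold
  eventually for each fixed parameter remain true.\<close>

lemma eventually_diagonal:
  assumes P: "\<And>k. eventually (P k) sequentially"
  shows "\<exists>k :: nat \<Rightarrow> nat. filterlim k at_top sequentially \<and> eventually (\<lambda>n. P (k n) n) sequentially"
proof -
  define K where "K = (\<lambda>n. {j. j \<le> n \<and> (j = 0 \<or> (\<forall>m\<ge>n. P j m))})"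
  define k where "k = (\<lambda>n. Max (K n))"
  have fin: "finite (K n)" for n by (rule finite_subset[of _ "{..n}"]) (auto simp: K_def)
  have kK: "k n \<in> K n" for n
    unfolding k_def by (rule Max_in[OF fin]) (auto simp: K_def)
  have large: "eventually (\<lambda>n. j \<le> k n) sequentially" for j
  proof -
    obtain N where N: "\<And>m. m \<ge> N \<Longrightarrow> P j m" using P[of j] unfolding eventually_sequentially by blast
    have "j \<le> k n" if "n \<ge> max N j" for n
      unfolding k_def using N that by (intro Max_ge[OF fin]) (auto simp: K_def)
    then show ?thesis unfolding eventually_sequentially by blast
  qed
  have "eventually (\<lambda>n. P (k n) n) sequentially"
    using large[of 1]
  proof eventually_elim
    case (elim n)
    then show ?case using kK[of n] by (auto simp: K_def)
  qed
  then show ?thesis using large by (intro exI[of _ k]) (simp add: filterlim_at_top)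
qed

section \<open>Averages of a test function over one normal law\<close>

definition gauss_average :: "(real \<Rightarrow> real) \<Rightarrow> real \<Rightarrow> real \<Rightarrow> real" where
  "gauss_average f z s = (\<integral>x. f (z + s * x) \<partial>gauss)"

text \<open>A general filter is allowed so that mean and standard deviation may depend on n and r
  jointly.\<close>

lemma gauss_average_tendsto:
  fixes f :: "real \<Rightarrow> real"
  assumes f: "continuous_on UNIV f" "bounded (range f)" and F: "(z \<longlongrightarrow> z0) F" "(s \<longlongrightarrow> s0) F"
  shows "((\<lambda>i. gauss_average f (z i) (s i)) \<longlongrightarrow> gauss_average f z0 s0) F"
proof -
  have [measurable]: "f \<in> borel_measurable borel" using f(1) by (rule borel_measurable_continuous_onI)
  obtain C where C: "\<And>x. \<bar>f x\<bar> \<le> C" using f(2) by (auto simp: bounded_iff)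
  have "isCont (\<lambda>p. gauss_average f (fst p) (snd p)) (z0, s0)"
    unfolding continuous_at_sequentially comp_def
  proof (intro allI impI)
    fix p :: "nat \<Rightarrow> real \<times> real" assume p: "p \<longlonglongrightarrow> (z0, s0)"
    have "(\<lambda>i. gauss_average f (fst (p i)) (snd (p i))) \<longlonglongrightarrow> gauss_average f z0 s0"
      unfolding gauss_average_def
    proof (rule integral_dominated_convergence[where w = "\<lambda>_. C"])
      show "AE x in gauss. (\<lambda>i. f (fst (p i) + snd (p i) * x)) \<longlonglongrightarrow> f (z0 + s0 * x)"
      proof (intro always_eventually allI)
        fix x
        have "(\<lambda>i. fst (p i) + snd (p i) * x) \<longlonglongrightarrow> z0 + s0 * x"
          using tendsto_fst[OF p] tendsto_snd[OF p] by (auto intro!: tendsto_intros)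
        then show "(\<lambda>i. f (fst (p i) + snd (p i) * x)) \<longlonglongrightarrow> f (z0 + s0 * x)"
          using f(1) by (intro isCont_tendsto_compose[of _ f]) (auto simp: continuous_on_eq_continuous_at)
      qed
    qed (use C in auto)
    then show "(\<lambda>i. gauss_average f (fst (p i)) (snd (p i))) \<longlonglongrightarrow> gauss_average f (fst (z0, s0)) (snd (z0, s0))" by simp
  qed
  from isCont_tendsto_compose[OF this tendsto_Pair[OF F]] show ?thesis by simp
qed

lemma gauss_average_bound:
  fixes f :: "real \<Rightarrow> real"
  assumes [measurable]: "f \<in> borel_measurable borel" and C: "\<And>x. \<bar>f x\<bar> \<le> C"
  shows "\<bar>gauss_average f z s\<bar> \<le> C"
proof -
  have int: "integrable gauss (\<lambda>x. f (z + s * x))"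
    by (rule gauss.integrable_const_bound[of _ C]) (use C in auto)
  have "\<bar>gauss_average f z s\<bar> \<le> (\<integral>x. \<bar>f (z + s * x)\<bar> \<partial>gauss)"
    unfolding gauss_average_def by (rule integral_abs_bound)
  also have "\<dots> \<le> (\<integral>x. C \<partial>gauss)"
    using C int by (intro integral_mono) auto
  finally show ?thesis by simp
qed

lemma gauss_average_strict_mono:
  fixes f :: "real \<Rightarrow> real"
  assumes f: "continuous_on UNIV f" "bounded (range f)" "strict_mono f" and z: "z1 < z2"
  shows "gauss_average f z1 s < gauss_average f z2 s"
proof -
  have [measurable]: "f \<in> borel_measurable borel" using f(1) by (rule borel_measurable_continuous_onI)
  obtain C where C: "\<And>x. \<bar>f x\<bar> \<le> C" using f(2) by (auto simp: bounded_iff)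
  have int: "integrable gauss (\<lambda>x. f (z + s * x))" for z
    by (rule gauss.integrable_const_bound[of _ C]) (use C in auto)
  show ?thesis
    unfolding gauss_average_def
    by (rule gauss.integral_less_AE_space[OF int int]) (use z f(3) in \<open>auto simp: strict_mono_less\<close>)
qed

context mean_field
begin

text \<open>The conditional expectation of f at the first spin when the initial magnetisation is
  r.\<close>

definition spin_average :: "(real \<Rightarrow> real) \<Rightarrow> nat \<Rightarrow> real \<Rightarrow> real \<Rightarrow> real" where
  "spin_average f n \<beta> r = gauss_average f (slope n * (r - loc n \<beta>)) (sdev n)"

lemma spin_average_measurable [measurable]:
  assumes [measurable]: "f \<in> borel_measurable borel" shows "spin_average f n \<beta> \<in> borel_measurable borel"
  unfolding spin_average_def[abs_def] gauss_average_def by measurable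

lemma integral_spin_law_average:
  assumes [measurable]: "f \<in> borel_measurable borel" and C: "\<And>x. \<bar>f x\<bar> \<le> C"
  shows "(\<integral>x. f x \<partial>spin_law n \<beta>) = (\<integral>u. weight n \<beta> u * spin_average f n \<beta> (loc n \<beta> + scl n * u) \<partial>gauss) / mass n \<beta>"
proof -
  let ?h = "\<lambda>p. weight n \<beta> (fst p) * f (spin_coord n p)"
  have bound: "\<bar>?h p\<bar> \<le> C" for p
  proof -
    have "\<bar>weight n \<beta> (fst p)\<bar> * \<bar>f (spin_coord n p)\<bar> \<le> 1 * C"
      using weight_bounds[of n \<beta> "fst p"] C by (intro mult_mono) auto
    then show ?thesis by (simp add: abs_mult)
  qed
  have "integrable (gauss \<Otimes>\<^sub>M gauss) ?h"
    by (rule gauss2.P.integrable_const_bound[of _ C]) (use bound in auto)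
  from gauss2.integral_fst'[OF this]
  have "(\<integral>p. ?h p \<partial>(gauss \<Otimes>\<^sub>M gauss)) = (\<integral>u. weight n \<beta> u * gauss_average f (slope n * (scl n * u)) (sdev n) \<partial>gauss)"
    by (simp add: gauss_average_def)
  then show ?thesis
    unfolding integral_spin_law[OF assms(1)] spin_average_def by simp
qed

text \<open>\<open>spin_law\<close> mixes the averages over r: off S they are at least L, and on S
  they fall short of L by at most D.\<close>

lemma integral_spin_law_ge:
  assumes f[measurable]: "f \<in> borel_measurable borel" and C: "\<And>x. \<bar>f x\<bar> \<le> C" and S[measurable]: "S \<in> sets borel"
    and out: "\<And>r. r \<notin> S \<Longrightarrow> L \<le> spin_average f n \<beta> r" and all: "\<And>r. L - D \<le> spin_average f n \<beta> r"
  shows "L - D * tilted_prob n \<beta> S \<le> (\<integral>x. f x \<partial>spin_law n \<beta>)"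
proof -
  let ?r = "\<lambda>u. loc n \<beta> + scl n * u"
  have i1: "integrable gauss (\<lambda>u. weight n \<beta> u * indicator S (?r u))"
    by (rule gauss.integrable_const_bound[of _ 1])
      (use weight_bounds weight_bounds(1)[THEN less_imp_le] in \<open>auto split: split_indicator\<close>)
  have i2: "integrable gauss (\<lambda>u. weight n \<beta> u * spin_average f n \<beta> (?r u))"
  proof (rule gauss.integrable_const_bound[of _ C])
    have "\<bar>weight n \<beta> u\<bar> * \<bar>spin_average f n \<beta> (?r u)\<bar> \<le> 1 * C" for u
      using weight_bounds[of n \<beta> u] gauss_average_bound[OF f C] unfolding spin_average_def
      by (intro mult_mono) auto
    then show "AE u in gauss. norm (weight n \<beta> u * spin_average f n \<beta> (?r u)) \<le> C"
      by (auto simp: abs_mult)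
  qed measurable
  have "(\<integral>u. L * weight n \<beta> u - D * (weight n \<beta> u * indicator S (?r u)) \<partial>gauss) \<le>
      (\<integral>u. weight n \<beta> u * spin_average f n \<beta> (?r u) \<partial>gauss)"
  proof (rule integral_mono[OF _ i2])
    show "integrable gauss (\<lambda>u. L * weight n \<beta> u - D * (weight n \<beta> u * indicator S (?r u)))"
      by (intro Bochner_Integration.integrable_diff integrable_mult_right i1 weight_integrable)
    fix u
    have "L - D * indicator S (?r u) \<le> spin_average f n \<beta> (?r u)"
      using out[of "?r u"] all[of "?r u"] by (auto split: split_indicator)
    from mult_left_mono[OF this less_imp_le[OF weight_bounds(1)[of n \<beta> u]]]
    show "L * weight n \<beta> u - D * (weight n \<beta> u * indicator S (?r u)) \<le> weight n \<beta> u * spin_average f n \<beta> (?r u)"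
      by (simp add: algebra_simps)
  qed
  also have "(\<integral>u. L * weight n \<beta> u - D * (weight n \<beta> u * indicator S (?r u)) \<partial>gauss) =
      L * mass n \<beta> - D * (\<integral>u. weight n \<beta> u * indicator S (?r u) \<partial>gauss)"
    using i1 weight_integrable by (simp add: mass_def)
  finally have "(L * mass n \<beta> - D * (\<integral>u. weight n \<beta> u * indicator S (?r u) \<partial>gauss)) / mass n \<beta> \<le>
      (\<integral>u. weight n \<beta> u * spin_average f n \<beta> (?r u) \<partial>gauss) / mass n \<beta>"
    using mass_bounds(1)[of n \<beta>] by (intro divide_right_mono) auto
  then show ?thesis
    unfolding integral_spin_law_average[OF f C] tilted_prob_def
    using mass_bounds(1)[of n \<beta>] by (simp add: diff_divide_distrib)
qed

lemma spin_average_uminus: "spin_average (\<lambda>x. - f x) n \<beta> r = - spin_average f n \<beta> r"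
  by (simp add: spin_average_def gauss_average_def)

lemma integral_spin_law_le:
  assumes f[measurable]: "f \<in> borel_measurable borel" and C: "\<And>x. \<bar>f x\<bar> \<le> C" and S: "S \<in> sets borel"
    and out: "\<And>r. r \<notin> S \<Longrightarrow> spin_average f n \<beta> r \<le> L" and all: "\<And>r. spin_average f n \<beta> r \<le> L + D"
  shows "(\<integral>x. f x \<partial>spin_law n \<beta>) \<le> L + D * tilted_prob n \<beta> S"
proof -
  have "- L - D * tilted_prob n \<beta> S \<le> (\<integral>x. - f x \<partial>spin_law n \<beta>)"
  proof (rule integral_spin_law_ge[OF _ _ S])
    show "- L - D \<le> spin_average (\<lambda>x. - f x) n \<beta> r" for r
      using all[of r] by (simp add: spin_average_uminus)
  qed (use C out in \<open>auto simp: spin_average_uminus\<close>)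
  then show ?thesis by simp
qed

lemma spin_average_tendsto:
  assumes f: "continuous_on UNIV f" "bounded (range f)" and b: "b \<longlonglongrightarrow> \<beta>"
  shows "((\<lambda>p. spin_average f (fst p) (b (fst p)) (snd p)) \<longlongrightarrow>
    gauss_average f ((1 + t) / t * (r - \<beta> / (1 + t))) (sqrt (1 + t))) (sequentially \<times>\<^sub>F nhds r)"
proof -
  let ?F = "sequentially \<times>\<^sub>F nhds r"
  have fst: "filterlim fst sequentially ?F" and snd: "(snd \<longlongrightarrow> r) ?F"
    by (rule filterlim_fst filterlim_snd)+
  show ?thesis
    unfolding spin_average_def
    by (intro gauss_average_tendsto[OF f] tendsto_intros snd filterlim_compose[OF slope_tendsto fst]
        filterlim_compose[OF loc_tendsto[OF b] fst] filterlim_compose[OF sdev_tendsto fst])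
qed

text \<open>Near \<open>r0\<close> the averages are close to the limit, jointly in n and r, while
  outside a ball the energy gap makes the probability vanish.\<close>

lemma integral_spin_law_tendsto:
  assumes min: "\<And>r. r \<noteq> r0 \<Longrightarrow> energy \<alpha> r0 < energy \<alpha> r" and b: "b \<longlonglongrightarrow> \<alpha>"
    and f: "continuous_on UNIV f" "bounded (range f)"
  shows "(\<lambda>n. \<integral>x. f x \<partial>spin_law n (b n)) \<longlonglongrightarrow> gauss_average f ((1 + t) / t * (r0 - \<alpha> / (1 + t))) (sqrt (1 + t))"
    (is "_ \<longlonglongrightarrow> ?L")
proof (rule LIMSEQ_I)
  fix e :: real assume e: "e > 0"
  have [measurable]: "f \<in> borel_measurable borel" using f(1) by (rule borel_measurable_continuous_onI)
  note fm = this
  obtain C where C: "\<And>x. \<bar>f x\<bar> \<le> C" using f(2) by (auto simp: bounded_iff)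
  have LC: "\<bar>?L\<bar> \<le> C" by (rule gauss_average_bound[OF fm C])
  have avg: "\<bar>spin_average f n \<beta> r\<bar> \<le> C" for n \<beta> r
    unfolding spin_average_def by (rule gauss_average_bound[OF fm C])
  have "\<forall>\<^sub>F p in sequentially \<times>\<^sub>F nhds r0. dist (spin_average f (fst p) (b (fst p)) (snd p)) ?L < e / 2"
    using spin_average_tendsto[OF f b, of r0] by (rule tendstoD) (use e in simp)
  then obtain P Q where P: "eventually P sequentially" and Q: "eventually Q (nhds r0)"
    and PQ: "\<And>n r. P n \<Longrightarrow> Q r \<Longrightarrow> \<bar>spin_average f n (b n) r - ?L\<bar> < e / 2"
    unfolding eventually_prod_filter by (auto simp: dist_real_def)
  obtain d where d: "d > 0" "\<And>r. dist r r0 < d \<Longrightarrow> Q r"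
    using Q unfolding eventually_nhds_metric by auto
  define S where "S = - ball r0 d"
  have S: "closed S" "S \<in> sets borel" by (auto simp: S_def)
  have "\<exists>\<eta>>0. \<forall>r\<in>S. energy \<alpha> r0 + \<eta> \<le> energy \<alpha> r"
    using d(1) by (intro energy_gap S min) (auto simp: S_def)
  then obtain \<eta> where \<eta>: "\<eta> > 0" "\<And>r. r \<in> S \<Longrightarrow> energy \<alpha> r0 + \<eta> \<le> energy \<alpha> r" by blast
  \<comment> \<open>Both the averages and the limit are bounded by C, so a far-away magnetisation
    costs at most \<open>2 * C\<close>.\<close>
  have "(\<lambda>n. 2 * C * tilted_prob n (b n) S) \<longlonglongrightarrow> 0"
    by (rule tendsto_mult_right_zero[OF tilted_prob_tendsto_0[OF b \<eta>(1) S(2) \<eta>(2)]])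
  then have "\<forall>\<^sub>F n in sequentially. 2 * C * tilted_prob n (b n) S < e / 2"
    by (rule order_tendstoD(2)) (use e in simp)
  then have "\<forall>\<^sub>F n in sequentially. norm ((\<integral>x. f x \<partial>spin_law n (b n)) - ?L) < e"
    using P
  proof eventually_elim
    case (elim n)
    have near: "\<bar>spin_average f n (b n) r - ?L\<bar> < e / 2" if "r \<notin> S" for r
      using that d(2)[of r] PQ[OF elim(2)] by (auto simp: S_def dist_commute)
    have "(?L - e / 2) - 2 * C * tilted_prob n (b n) S \<le> (\<integral>x. f x \<partial>spin_law n (b n))"
    proof (rule integral_spin_law_ge[OF fm C S(2)])
      show "?L - e / 2 \<le> spin_average f n (b n) r" if "r \<notin> S" for r using near[OF that] by linarith
      show "?L - e / 2 - 2 * C \<le> spin_average f n (b n) r" for r using avg[of n "b n" r] LC e by linarith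
    qed
    moreover have "(\<integral>x. f x \<partial>spin_law n (b n)) \<le> (?L + e / 2) + 2 * C * tilted_prob n (b n) S"
    proof (rule integral_spin_law_le[OF fm C S(2)])
      show "spin_average f n (b n) r \<le> ?L + e / 2" if "r \<notin> S" for r using near[OF that] by linarith
      show "spin_average f n (b n) r \<le> ?L + e / 2 + 2 * C" for r using avg[of n "b n" r] LC e by linarith
    qed
    ultimately show ?case using elim(1) by (simp add: abs_less_iff)
  qed
  then show "\<exists>N. \<forall>n\<ge>N. norm ((\<integral>x. f x \<partial>spin_law n (b n)) - ?L) < e"
    unfolding eventually_sequentially .
qed

text \<open>Raising \<beta> above \<alpha> favours large r, by an amount proportional to the
  distance of the two magnetisations; the squares of \<beta> cancel in the difference.\<close>

lemma energy_shift: "energy \<beta> r - energy \<beta> s = energy \<alpha> r - energy \<alpha> s + (s - r) * (\<beta> - \<alpha>) / t"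
proof -
  have t: "t \<noteq> 0" "1 + t \<noteq> 0" using t_pos by auto
  have "energy \<gamma> r = V r + (1 + t) / t / 2 * r\<^sup>2 - r * \<gamma> / t + \<gamma>\<^sup>2 / (2 * t * (1 + t))" for \<gamma> r
  proof -
    have "(1 + t) / t / 2 * (r - \<gamma> / (1 + t))\<^sup>2 = (1 + t) / t / 2 * r\<^sup>2 - r * \<gamma> / t + \<gamma>\<^sup>2 / (2 * t * (1 + t))"
    proof -
      have "q / t / 2 * (r - \<gamma> / q)\<^sup>2 = q / t / 2 * r\<^sup>2 - r * \<gamma> / t + \<gamma>\<^sup>2 / (2 * t * q)" if "q \<noteq> 0" for q
        using t(1) that by (simp add: field_simps power2_eq_square)
      from this[OF t(2)] show ?thesis .
    qed
    then show ?thesis by (simp add: energy_def)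
  qed
  from this[of \<beta> r] this[of \<beta> s] this[of \<alpha> r] this[of \<alpha> s] show ?thesis
    by (simp add: algebra_simps diff_divide_distrib add_divide_distrib)
qed

text \<open>No minimiser at \<beta> has to be located: magnetisations in S are unlikely, and the
  averages at all others are at least the one at the threshold r, whose limit is explicit.\<close>

lemma spin_law_eventually_gt:
  fixes f :: "real \<Rightarrow> real"
  assumes f: "continuous_on UNIV f" "bounded (range f)"
    and S: "S \<in> sets borel" "\<And>r. r \<in> S \<Longrightarrow> energy \<beta> q + \<eta> \<le> energy \<beta> r" "\<eta> > 0"
    and out: "\<And>n s. n > 0 \<Longrightarrow> s \<notin> S \<Longrightarrow> spin_average f n \<beta> r \<le> spin_average f n \<beta> s"
    and c: "c < gauss_average f ((1 + t) / t * (r - \<beta> / (1 + t))) (sqrt (1 + t))"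
  shows "\<forall>\<^sub>F n in sequentially. c < (\<integral>x. f x \<partial>spin_law n \<beta>)"
proof -
  have fm: "f \<in> borel_measurable borel" using f(1) by (rule borel_measurable_continuous_onI)
  obtain C where C: "\<And>x. \<bar>f x\<bar> \<le> C" using f(2) by (auto simp: bounded_iff)
  have avg: "\<bar>spin_average f n \<beta> r\<bar> \<le> C" for n r
    unfolding spin_average_def by (rule gauss_average_bound[OF fm C])
  have "filterlim (\<lambda>n. (n, r)) (sequentially \<times>\<^sub>F nhds r) sequentially"
    by (intro filterlim_Pair filterlim_ident tendsto_const)
  from filterlim_compose[OF spin_average_tendsto[OF f tendsto_const[of \<beta>], of r] this]
  have "(\<lambda>n. spin_average f n \<beta> r - 2 * C * tilted_prob n \<beta> S) \<longlonglongrightarrow>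
      gauss_average f ((1 + t) / t * (r - \<beta> / (1 + t))) (sqrt (1 + t)) - 2 * C * 0"
    by (intro tendsto_intros tilted_prob_tendsto_0[OF tendsto_const S(3,1,2)]) simp_all
  then have "\<forall>\<^sub>F n in sequentially. c < spin_average f n \<beta> r - 2 * C * tilted_prob n \<beta> S"
    by (rule order_tendstoD(1)) (use c in simp)
  then show ?thesis
    using eventually_gt_at_top[of 0]
  proof eventually_elim
    case (elim n)
    have "spin_average f n \<beta> r - 2 * C \<le> spin_average f n \<beta> s" for s
      using avg[of n s] avg[of n r] by linarith
    from integral_spin_law_ge[OF fm C S(1) out[OF elim(2)] this] elim(1) show ?case by linarith
  qed
qed

text \<open>If two magnetisations minimise the energy, then tilting \<open>\<alpha>\<close> slightly upwards or downwards selects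
  different ones, so the conditional laws have different limits along the two kinds of sequences.\<close>

lemma two_minimisers_no_limit:
  fixes f :: "real \<Rightarrow> real"
  assumes r12: "r1 < r2" and min: "\<And>r. energy \<alpha> r1 \<le> energy \<alpha> r" "\<And>r. energy \<alpha> r2 \<le> energy \<alpha> r"
    and f: "continuous_on UNIV f" "bounded (range f)" "strict_mono f"
    and lim: "\<And>b. b \<longlonglongrightarrow> \<alpha> \<Longrightarrow> (\<lambda>n. \<integral>x. f x \<partial>spin_law n (b n)) \<longlonglongrightarrow> L"
  shows False
proof -
  let ?E = "\<lambda>n \<beta>. \<integral>x. f x \<partial>spin_law n \<beta>"
  \<comment> \<open>The thresholds \<open>r1 + d\<close> and \<open>r2 - d\<close> are
    \<open>2 * d\<close> apart. Moving \<beta> by at most \<open>\<delta>\<close> shifts the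
    limiting centre by at most \<open>d / 2\<close> in either direction, so the means compared below
    keep their order.\<close>
  define d where "d = (r2 - r1) / 4"
  define \<delta> where "\<delta> = (1 + t) * d / 2"
  have d: "d > 0" "\<delta> > 0" using r12 t_pos by (auto simp: d_def \<delta>_def)
  let ?z = "\<lambda>r \<beta>. (1 + t) / t * (r - \<beta> / (1 + t))"
  let ?\<Gamma> = "\<lambda>z. gauss_average f z (sqrt (1 + t))"
  define \<Gamma>1 \<Gamma>2 where "\<Gamma>1 = ?\<Gamma> (?z (r1 + d) (\<alpha> - \<delta>))" and "\<Gamma>2 = ?\<Gamma> (?z (r2 - d) (\<alpha> + \<delta>))"
  have mono: "?\<Gamma> z \<le> ?\<Gamma> z'" if "z \<le> z'" for z z'
    using gauss_average_strict_mono[OF f, of z z' "sqrt (1 + t)"] that by (cases "z = z'") auto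
  have "q * d / 2 / q = d / 2" if "q \<noteq> 0" for q using that by simp
  from this[of "1 + t"] have "\<delta> / (1 + t) = d / 2" using t_pos by (simp add: \<delta>_def)
  then have "r1 + d - (\<alpha> - \<delta>) / (1 + t) < r2 - d - (\<alpha> + \<delta>) / (1 + t)"
    using d by (simp add: diff_divide_distrib add_divide_distrib d_def)
  then have "?z (r1 + d) (\<alpha> - \<delta>) < ?z (r2 - d) (\<alpha> + \<delta>)"
    using t_pos by (intro mult_strict_left_mono) auto
  then have \<Gamma>: "\<Gamma>1 < \<Gamma>2" unfolding \<Gamma>1_def \<Gamma>2_def by (rule gauss_average_strict_mono[OF f])
  \<comment> \<open>A third of the gap: a common limit would have to be at least
    \<open>\<Gamma>2 - e\<close> and at most \<open>\<Gamma>1 + e\<close>.\<close>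
  define e where "e = (\<Gamma>2 - \<Gamma>1) / 3"
  have e: "e > 0" using \<Gamma> by (simp add: e_def)
  have avg_mono: "spin_average f n \<beta> r \<le> spin_average f n \<beta> r'" if "r \<le> r'" "n > 0" for n \<beta> r r'
  proof (cases "r = r'")
    case False
    then have "slope n * (r - loc n \<beta>) < slope n * (r' - loc n \<beta>)"
      using slope_ge_1[OF that(2)] that(1) by (intro mult_strict_left_mono) auto
    then show ?thesis unfolding spin_average_def by (intro less_imp_le gauss_average_strict_mono[OF f])
  qed simp
  \<comment> \<open>For \<beta> above \<alpha>, everything below \<open>r2 - d\<close> has energy
    larger than that of \<open>r2\<close> by at least
    \<open>d * (\<beta> - \<alpha>) / t\<close>.\<close>
  have up: "\<forall>\<^sub>F n in sequentially. \<Gamma>2 - e < ?E n \<beta>" if \<beta>: "\<alpha> < \<beta>" "\<beta> \<le> \<alpha> + \<delta>" for \<beta>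
  proof (rule spin_law_eventually_gt[where S = "{..<r2 - d}" and r = "r2 - d", OF f(1,2)])
    show "d * (\<beta> - \<alpha>) / t > 0" using d \<beta> t_pos by simp
    show "energy \<beta> r2 + d * (\<beta> - \<alpha>) / t \<le> energy \<beta> r" if "r \<in> {..<r2 - d}" for r
    proof -
      have "d * (\<beta> - \<alpha>) / t \<le> (r2 - r) * (\<beta> - \<alpha>) / t"
        using that \<beta> t_pos by (intro divide_right_mono mult_right_mono) auto
      then show ?thesis using energy_shift[of \<beta> r r2 \<alpha>] min(2)[of r] by linarith
    qed
    have "?z (r2 - d) (\<alpha> + \<delta>) \<le> ?z (r2 - d) \<beta>"
      using \<beta> t_pos by (intro mult_left_mono diff_left_mono divide_right_mono) auto
    then show "\<Gamma>2 - e < ?\<Gamma> (?z (r2 - d) \<beta>)" using mono e unfolding \<Gamma>2_def by fastforce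
  qed (auto intro: avg_mono)
  have down: "\<forall>\<^sub>F n in sequentially. ?E n \<beta> < \<Gamma>1 + e" if \<beta>: "\<beta> < \<alpha>" "\<alpha> - \<delta> \<le> \<beta>" for \<beta>
  proof -
    have "\<forall>\<^sub>F n in sequentially. - (\<Gamma>1 + e) < (\<integral>x. - f x \<partial>spin_law n \<beta>)"
    proof (rule spin_law_eventually_gt[where S = "{r1 + d<..}" and r = "r1 + d"])
      show "continuous_on UNIV (\<lambda>x. - f x)" "bounded (range (\<lambda>x. - f x))"
        using f(1,2) by (auto intro!: continuous_intros simp: bounded_iff)
      show "d * (\<alpha> - \<beta>) / t > 0" using d \<beta> t_pos by simp
      show "energy \<beta> r1 + d * (\<alpha> - \<beta>) / t \<le> energy \<beta> r" if "r \<in> {r1 + d<..}" for r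
      proof -
        have "d * (\<alpha> - \<beta>) / t \<le> (r - r1) * (\<alpha> - \<beta>) / t"
          using that \<beta> t_pos by (intro divide_right_mono mult_right_mono) auto
        also have "(r - r1) * (\<alpha> - \<beta>) / t = (r1 - r) * (\<beta> - \<alpha>) / t" by (simp add: algebra_simps)
        finally show ?thesis using energy_shift[of \<beta> r r1 \<alpha>] min(1)[of r] by linarith
      qed
      have "?z (r1 + d) \<beta> \<le> ?z (r1 + d) (\<alpha> - \<delta>)"
        using \<beta> t_pos by (intro mult_left_mono diff_left_mono divide_right_mono) auto
      then have "?\<Gamma> (?z (r1 + d) \<beta>) < \<Gamma>1 + e" using mono e unfolding \<Gamma>1_def by fastforce
      then show "- (\<Gamma>1 + e) < gauss_average (\<lambda>x. - f x) (?z (r1 + d) \<beta>) (sqrt (1 + t))"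
        by (simp add: gauss_average_def)
    qed (auto intro: avg_mono simp: spin_average_uminus)
    then show ?thesis by (rule eventually_mono) simp
  qed
  \<comment> \<open>Each shift \<open>\<delta> / (k + 1)\<close> gives the bounds only for n large
    depending on k, so k has to grow slowly with n.\<close>
  have step: "0 < \<delta> / (real k + 1)" "\<delta> / (real k + 1) \<le> \<delta>" for k :: nat
    using d(2) by (auto simp: field_simps)
  have "\<forall>\<^sub>F n in sequentially. \<Gamma>2 - e < ?E n (\<alpha> + \<delta> / (real k + 1)) \<and>
      ?E n (\<alpha> - \<delta> / (real k + 1)) < \<Gamma>1 + e" for k
    using step[of k] by (intro eventually_conj up down) auto
  from eventually_diagonal[of "\<lambda>k n. \<Gamma>2 - e < ?E n (\<alpha> + \<delta> / (real k + 1)) \<and>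
      ?E n (\<alpha> - \<delta> / (real k + 1)) < \<Gamma>1 + e", OF this]
  obtain k :: "nat \<Rightarrow> nat" where k: "filterlim k at_top sequentially" and
    ev: "\<forall>\<^sub>F n in sequentially. \<Gamma>2 - e < ?E n (\<alpha> + \<delta> / (real (k n) + 1)) \<and>
      ?E n (\<alpha> - \<delta> / (real (k n) + 1)) < \<Gamma>1 + e" by blast
  have "(\<lambda>n. \<delta> * (1 / (real n + 1))) \<longlonglongrightarrow> \<delta> * 0"
    using LIMSEQ_inverse_real_of_nat by (intro tendsto_intros) (simp add: inverse_eq_divide add.commute)
  then have "(\<lambda>n. \<delta> / (real (k n) + 1)) \<longlonglongrightarrow> 0"
    using filterlim_compose[OF _ k] by simp
  then have "(\<lambda>n. \<alpha> + \<delta> / (real (k n) + 1)) \<longlonglongrightarrow> \<alpha> + 0" "(\<lambda>n. \<alpha> - \<delta> / (real (k n) + 1)) \<longlonglongrightarrow> \<alpha> - 0"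
    by (intro tendsto_intros; simp)+
  then have lims: "(\<lambda>n. ?E n (\<alpha> + \<delta> / (real (k n) + 1))) \<longlonglongrightarrow> L"
    "(\<lambda>n. ?E n (\<alpha> - \<delta> / (real (k n) + 1))) \<longlonglongrightarrow> L"
    by (simp_all add: lim)
  have "\<Gamma>2 - e \<le> L"
    by (rule tendsto_lowerbound[OF lims(1) eventually_mono[OF ev]]) auto
  moreover have "L \<le> \<Gamma>1 + e"
    by (rule tendsto_upperbound[OF lims(2) eventually_mono[OF ev]]) auto
  moreover have "3 * e = \<Gamma>2 - \<Gamma>1" by (simp add: e_def)
  ultimately show False using e by linarith
qed

end

section \<open>Good magnetisations and unique minimisers\<close>

context mean_field
begin

lemma ex1_arg_min_I_iff:
  "(\<exists>!r. is_arg_min (I_fun V t \<alpha>) (\<lambda>_. True) r) \<longleftrightarrow> (\<exists>r0. \<forall>r. r \<noteq> r0 \<longrightarrow> energy \<alpha> r0 < energy \<alpha> r)"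
  unfolding arg_min_I_iff
proof
  assume "\<exists>!r. \<forall>s. energy \<alpha> r \<le> energy \<alpha> s"
  then obtain r0 where r0: "\<And>s. energy \<alpha> r0 \<le> energy \<alpha> s"
    "\<And>r. (\<forall>s. energy \<alpha> r \<le> energy \<alpha> s) \<Longrightarrow> r = r0" by blast
  have "energy \<alpha> r0 < energy \<alpha> r" if "r \<noteq> r0" for r
  proof (rule ccontr)
    assume "\<not> energy \<alpha> r0 < energy \<alpha> r"
    then have "\<forall>s. energy \<alpha> r \<le> energy \<alpha> s" using r0(1) by (meson not_less order_trans)
    with r0(2) that show False by blast
  qed
  then show "\<exists>r0. \<forall>r. r \<noteq> r0 \<longrightarrow> energy \<alpha> r0 < energy \<alpha> r" by blast
next
  assume "\<exists>r0. \<forall>r. r \<noteq> r0 \<longrightarrow> energy \<alpha> r0 < energy \<alpha> r"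
  then obtain r0 where r0: "\<And>r. r \<noteq> r0 \<Longrightarrow> energy \<alpha> r0 < energy \<alpha> r" by blast
  show "\<exists>!r. \<forall>s. energy \<alpha> r \<le> energy \<alpha> s"
  proof (rule ex1I[of _ r0])
    show "\<forall>s. energy \<alpha> r0 \<le> energy \<alpha> s" using r0 by (metis less_imp_le order_refl)
    show "r = r0" if "\<forall>s. energy \<alpha> r \<le> energy \<alpha> s" for r
      using r0[of r] that by (meson not_less)
  qed
qed

lemma kernel_properties:
  assumes "n \<ge> 2"
  shows "regular_cond_prob n (time_evolved V t n) (\<lambda>y. spin_law n (magnetisation (n - 1) y))"
    "proper_kernel n (time_evolved V t n) \<gamma>"
    "weakly_continuous_kernel (euclid (n - 1)) (\<lambda>y. spin_law n (magnetisation (n - 1) y))"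
proof -
  obtain k where n: "n = Suc k" using assms by (cases n) auto
  show "regular_cond_prob n (time_evolved V t n) (\<lambda>y. spin_law n (magnetisation (n - 1) y))"
    using regular_cond_prob_spin_law[of k] by (simp add: n)
  show "proper_kernel n (time_evolved V t n) \<gamma>"
    using proper_kernel_time_evolved[of k] by (simp add: n)
  show "weakly_continuous_kernel (euclid (n - 1)) (\<lambda>y. spin_law n (magnetisation (n - 1) y))"
    by (rule weakly_continuous_spin_law)
qed

text \<open>It lets the kernel supplied by \<open>good_magnetisation\<close> be exchanged for the
  explicit one under every test function.\<close>

lemma kernel_unique:
  fixes f :: "real \<Rightarrow> real"
  assumes n: "n \<ge> 2" and \<gamma>: "regular_cond_prob n (time_evolved V t n) \<gamma>" "weakly_continuous_kernel (euclid (n - 1)) \<gamma>"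
    and f: "continuous_on UNIV f" "bounded (range f)" and y: "y \<in> space (borel_space (n - 1))"
  shows "(\<integral>x. f x \<partial>\<gamma> y) = (\<integral>x. f x \<partial>spin_law n (magnetisation (n - 1) y))"
proof -
  obtain k where k: "n = Suc k" using n by (cases n) auto
  show ?thesis
  proof (rule regular_cond_prob_integral_unique[OF \<gamma>(1) kernel_properties(1)[OF n] \<gamma>(2) kernel_properties(3)[OF n] _ _ f y])
    show "finite_measure (others_law n (time_evolved V t n))"
      unfolding k by (rule finite_measure_others_law)
    show "emeasure (others_law n (time_evolved V t n)) U > 0" if "openin (euclid (n - 1)) U" "U \<noteq> {}" for U
      using others_law_openin_pos[of k U] that by (simp add: k)
  qed
qed

lemma good_magnetisation_if:
  assumes min: "\<And>r. r \<noteq> r0 \<Longrightarrow> energy \<alpha> r0 < energy \<alpha> r"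
  shows "good_magnetisation (time_evolved V t) \<alpha>"
  unfolding good_magnetisation_def
proof (intro exI[of _ "\<lambda>n y. spin_law n (magnetisation (n - 1) y)"] conjI allI impI)
  let ?z = "(1 + t) / t * (r0 - \<alpha> / (1 + t))"
  let ?X = "\<lambda>x. ?z + sqrt (1 + t) * x"
  have X: "?X \<in> borel_measurable gauss" by simp
  show "\<exists>\<gamma>\<alpha>. real_distribution \<gamma>\<alpha> \<and> (\<forall>v. (\<forall>n\<ge>2. v (n - 1) \<in> space (borel_space (n - 1))) \<longrightarrow>
      (\<lambda>n. magnetisation (n - 1) (v (n - 1))) \<longlonglongrightarrow> \<alpha> \<longrightarrow>
      converges_weakly (\<lambda>n. spin_law n (magnetisation (n - 1) (v (n - 1)))) \<gamma>\<alpha>)"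
  proof (intro exI[of _ "distr gauss borel ?X"] conjI allI impI)
    show "real_distribution (distr gauss borel ?X)"
      by (rule gauss.real_distribution_distr[OF X])
    fix v :: "nat \<Rightarrow> nat \<Rightarrow> real"
    assume lim: "(\<lambda>n. magnetisation (n - 1) (v (n - 1))) \<longlonglongrightarrow> \<alpha>"
    show "converges_weakly (\<lambda>n. spin_law n (magnetisation (n - 1) (v (n - 1)))) (distr gauss borel ?X)"
      unfolding converges_weakly_def
    proof (intro allI impI)
      fix f :: "real \<Rightarrow> real" assume f: "continuous_on UNIV f" "bounded (range f)"
      have "(\<integral>x. f x \<partial>distr gauss borel ?X) = gauss_average f ?z (sqrt (1 + t))"
        using borel_measurable_continuous_onI[OF f(1)]
        by (subst integral_distr[OF X]) (auto simp: gauss_average_def)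
      then show "(\<lambda>n. \<integral>x. f x \<partial>spin_law n (magnetisation (n - 1) (v (n - 1)))) \<longlonglongrightarrow> (\<integral>x. f x \<partial>distr gauss borel ?X)"
        using integral_spin_law_tendsto[OF min lim f] by simp
    qed
  qed
qed (rule kernel_properties; assumption)+

lemma good_magnetisation_imp:
  assumes "good_magnetisation (time_evolved V t) \<alpha>"
  shows "\<exists>r0. \<forall>r. r \<noteq> r0 \<longrightarrow> energy \<alpha> r0 < energy \<alpha> r"
proof (rule ccontr)
  assume no: "\<not> ?thesis"
  obtain r where r: "\<And>s. energy \<alpha> r \<le> energy \<alpha> s" using energy_attains_min[of \<alpha>] by blast
  from no obtain r' where r': "r' \<noteq> r" "\<not> energy \<alpha> r < energy \<alpha> r'" by blast
  then have r'_min: "energy \<alpha> r' \<le> energy \<alpha> s" for s using r[of s] by simp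
  obtain r1 r2 where r12: "r1 < r2" "\<And>s. energy \<alpha> r1 \<le> energy \<alpha> s" "\<And>s. energy \<alpha> r2 \<le> energy \<alpha> s"
    using r r'_min r'(1) by (metis linorder_neqE)
  obtain \<gamma> \<gamma>\<alpha> where rcp: "\<And>n. n \<ge> 2 \<Longrightarrow> regular_cond_prob n (time_evolved V t n) (\<gamma> n)"
    and wc: "\<And>n. n \<ge> 2 \<Longrightarrow> weakly_continuous_kernel (euclid (n - 1)) (\<gamma> n)"
    and conv: "\<And>v. (\<forall>n\<ge>2. v (n - 1) \<in> space (borel_space (n - 1))) \<Longrightarrow>
      (\<lambda>n. magnetisation (n - 1) (v (n - 1))) \<longlonglongrightarrow> \<alpha> \<Longrightarrow> converges_weakly (\<lambda>n. \<gamma> n (v (n - 1))) \<gamma>\<alpha>"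
    using assms unfolding good_magnetisation_def by blast
  have f: "continuous_on UNIV arctan" "bounded (range arctan)" "strict_mono arctan"
  proof -
    have "norm (arctan x) \<le> pi / 2" for x using arctan_bounded[of x] by (simp only: real_norm_def) linarith
    then show "bounded (range arctan)" by (intro boundedI) blast
  qed (auto intro!: continuous_intros strict_monoI arctan_monotone)
  show False
  proof (rule two_minimisers_no_limit[OF r12 f])
    fix b assume b: "b \<longlonglongrightarrow> \<alpha>"
    \<comment> \<open>A constant configuration of \<open>n - 1\<close> spins has exactly the
      magnetisation \<open>b n\<close>. The index is \<open>Suc m\<close> because a vector of m
      other spins conditions the first of \<open>m + 1\<close>.\<close>
    define v where "v = (\<lambda>m. \<lambda>i\<in>{..<m}. b (Suc m) :: real)"
    have v: "v m \<in> space (borel_space m)" for m by (auto simp: v_def space_PiM)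
    have m: "magnetisation (n - 1) (v (n - 1)) = b n" if "n \<ge> 2" for n
      using that by (simp add: magnetisation_def v_def)
    have ev: "\<forall>\<^sub>F n in sequentially. n \<ge> 2" by (rule eventually_ge_at_top)
    have "(\<lambda>n. magnetisation (n - 1) (v (n - 1))) \<longlonglongrightarrow> \<alpha>"
      by (rule tendsto_cong[THEN iffD2, OF _ b]) (rule eventually_mono[OF ev m])
    then have "(\<lambda>n. \<integral>x. arctan x \<partial>\<gamma> n (v (n - 1))) \<longlonglongrightarrow> (\<integral>x. arctan x \<partial>\<gamma>\<alpha>)"
      using conv[of v] v f(1,2) unfolding converges_weakly_def by blast
    moreover have "\<forall>\<^sub>F n in sequentially. (\<integral>x. arctan x \<partial>\<gamma> n (v (n - 1))) = (\<integral>x. arctan x \<partial>spin_law n (b n))"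
      using ev
    proof eventually_elim
      case (elim n)
      show ?case using kernel_unique[OF elim rcp[OF elim] wc[OF elim] f(1,2) v[of "n - 1"]] m[OF elim] by simp
    qed
    ultimately show "(\<lambda>n. \<integral>x. arctan x \<partial>spin_law n (b n)) \<longlonglongrightarrow> (\<integral>x. arctan x \<partial>\<gamma>\<alpha>)"
      by (rule Lim_transform_eventually)
  qed
qed

lemma good_magnetisation_iff:
  "good_magnetisation (time_evolved V t) \<alpha> \<longleftrightarrow> (\<exists>!r. is_arg_min (I_fun V t \<alpha>) (\<lambda>_. True) r)"
  unfolding ex1_arg_min_I_iff using good_magnetisation_if good_magnetisation_imp by blast

end

theorem corollary1:
  fixes V :: "real \<Rightarrow> real" and t :: real
  assumes "V C1_differentiable_on UNIV" and "\<And>x. V x \<ge> 0" and "t > 0"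
  shows "(\<forall>\<alpha>.
            (good_magnetisation (time_evolved V t) \<alpha> \<longleftrightarrow>
              (\<exists>!r. is_arg_min (I_fun V t \<alpha>) (\<lambda>_. True) r)) \<and>
            ((\<exists>!r. is_arg_min (I_fun V t \<alpha>) (\<lambda>_. True) r) \<longleftrightarrow>
              (\<exists>!\<phi>. is_arg_min (J_fun V t \<alpha>) (\<lambda>\<phi>. \<phi> \<in> C_paths t) \<phi>))) \<and>
         (sequentially_Gibbs (time_evolved V t) \<longleftrightarrow>
            (\<forall>\<alpha>. \<exists>!r. is_arg_min (I_fun V t \<alpha>) (\<lambda>_. True) r)) \<and>
         ((\<forall>\<alpha>. \<exists>!r. is_arg_min (I_fun V t \<alpha>) (\<lambda>_. True) r) \<longleftrightarrow>
            (\<forall>\<alpha>. \<exists>!\<phi>. is_arg_min (J_fun V t \<alpha>) (\<lambda>\<phi>. \<phi> \<in> C_paths t) \<phi>))"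
proof -
  interpret mean_field V t
    using assms by unfold_locales (auto intro: C1_differentiable_imp_continuous_on)
  show ?thesis
    unfolding sequentially_Gibbs_def good_magnetisation_iff ex1_arg_min_J_iff[OF assms(3), symmetric]
    by blast
qed

end
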